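(* Let $(R,\mathfrak m,\mathsf k)$ be a Noetherian local ring with associated graded ring $A=G_{\mathfrak m}(R)$, let $F$ be a free $R$-module of finite rank, and let $N\subset \mathfrak m F$ be a nonzero submodule. Let $s=\nu(N)$ be the order of $N$ as a submodule of $F$, and let $k=\mu(N)$ be the minimal number of generators of $N$. Let $N^*\subset G_{\mathfrak m}(F)$ be the graded $A$-submodule generated by the initial forms of the elements of $N$. Then the following statements are equivalent: (i) $N^*$ is equigenerated (in degree $s$). (ii) $N^*\simeq G_{\mathfrak m}(N)(-s)$ as graded $A$-modules. (iii) $N\cap \mathfrak m^iF=\mathfrak m^{i-s}N$ for all $i\ge s$. (iv) $N\cap \mathfrak m^{s+1}F=\mathfrak m N$ and $\mu(N^* )=k$. (v) Every minimal generating set $\{y_1,\dots,y_k\}$ of $N$ is a standard basis of $N$ and satisfies $\nu(y_i)=s$ for all $i$. (vi) There is a minimal generating set $\{y_1,\dots,y_k\}$ of $N$ which is a standard basis of $N$ and satisfies $\nu(y_i)=s$ for all $i$.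
   Context: For a finitely generated $R$-module $L$, $G_{\mathfrak m}(L)=\bigoplus_{i\ge 0}\mathfrak m^iL/\mathfrak m^{i+1}L$, a finitely generated graded module over the standard graded $\mathsf k$-algebra $A=G_{\mathfrak m}(R)=\bigoplus_{i\ge0}\mathfrak m^i/\mathfrak m^{i+1}$. For $0\ne x\in F$, $\nu(x)$ (the order of $x$, always computed in $F$) is the integer $i$ with $x\in\mathfrak m^iF\setminus\mathfrak m^{i+1}F$, and the initial form of $x$ is $x^*=x+\mathfrak m^{i+1}F\in \mathfrak m^iF/\mathfrak m^{i+1}F\subset G_{\mathfrak m}(F)$, where $i=\nu(x)$. For a nonzero submodule $N\subset F$: $\nu(N)=\min\{\nu(x): x\in N\setminus\{0\}\}$, and $N^*=\langle x^*: x\in N\setminus\{0\}\rangle\subset G_{\mathfrak m}(F)$. A subset $\{y_1,\dots,y_k\}$ of $N$ is a standard basis of $N$ if $\langle y_1^*,\dots,y_k^*\rangle=N^*$. $\mu(\cdot)$ denotes the minimal number of generators (homogeneous ones, for a graded $A$-module). A finitely generated graded $A$-module is equigenerated if it is generated by homogeneous elements all of one and the same degree $n$. The $n$-twist of a graded module $L$ is $L(n)$ with $L(n)_j=L_{n+j}$. *)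

theory Defs
  imports "HOL-Algebra.Algebra"
begin

section \<open>Noetherian local rings and modules over them\<close>

locale noetherian_local_ring = cring R + noetherian_ring R
  for R :: "('a, 'm) ring_scheme" (structure) +
  fixes \<mm> :: "'a set"
  assumes maximal: "maximalideal \<mm> R"
    and unique_maximal: "maximalideal I R \<Longrightarrow> I = \<mm>"

definition free_of_finite_rank ::
    "('a, 'm) ring_scheme \<Rightarrow> ('a, 'b, 'n) module_scheme \<Rightarrow> bool" where
  "free_of_finite_rank R F \<longleftrightarrow> module R F \<and>
     (\<exists>B \<subseteq> carrier F. finite B \<and>
        (\<forall>x \<in> carrier F. \<exists>!c. c \<in> B \<rightarrow>\<^sub>E carrier R \<and>
            x = (\<Oplus>\<^bsub>F\<^esub>b \<in> B. c b \<odot>\<^bsub>F\<^esub> b)))"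

definition module_span ::
    "('a, 'm) ring_scheme \<Rightarrow> ('a, 'b, 'n) module_scheme \<Rightarrow> 'b set \<Rightarrow> 'b set" where
  "module_span R L S = (\<lambda>H. submodule H R L) hull S"

abbreviation restrict_module ::
    "('a, 'b, 'n) module_scheme \<Rightarrow> 'b set \<Rightarrow> ('a, 'b, 'n) module_scheme" where
  "restrict_module L H \<equiv> L\<lparr>carrier := H\<rparr>"

definition ideal_smult ::
    "('a, 'm) ring_scheme \<Rightarrow> 'a set \<Rightarrow> ('a, 'b, 'n) module_scheme \<Rightarrow> 'b set" where
  "ideal_smult R I L = module_span R L {a \<odot>\<^bsub>L\<^esub> x | a x. a \<in> I \<and> x \<in> carrier L}"

text \<open>The power \<open>\<mm>\<^sup>i\<close>, with \<open>\<mm>\<^sup>0 = R\<close>, and the submodule \<open>\<mm>\<^sup>i L\<close>.\<close>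

definition ideal_power :: "('a, 'm) ring_scheme \<Rightarrow> 'a set \<Rightarrow> nat \<Rightarrow> 'a set" where
  "ideal_power R \<mm> i = \<mm> [^]\<^bsub>ideals_set R\<^esub> i"

definition adic_filtration ::
    "('a, 'm) ring_scheme \<Rightarrow> 'a set \<Rightarrow> ('a, 'b, 'n) module_scheme \<Rightarrow> nat \<Rightarrow> 'b set" where
  "adic_filtration R \<mm> L i = ideal_smult R (ideal_power R \<mm> i) L"

definition min_number_generators ::
    "('a, 'm) ring_scheme \<Rightarrow> ('a, 'b, 'n) module_scheme \<Rightarrow> nat" where
  "min_number_generators R L =
     (LEAST n. \<exists>Y \<subseteq> carrier L. finite Y \<and> card Y = n \<and> module_span R L Y = carrier L)"

definition minimal_generating_set ::
    "('a, 'm) ring_scheme \<Rightarrow> ('a, 'b, 'n) module_scheme \<Rightarrow> 'b set \<Rightarrow> bool" where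
  "minimal_generating_set R L Y \<longleftrightarrow> Y \<subseteq> carrier L \<and> module_span R L Y = carrier L \<and>
     (\<forall>Z. Z \<subset> Y \<longrightarrow> module_span R L Z \<noteq> carrier L)"

section \<open>Graded modules\<close>

text \<open>
  A graded module is a module record together with its homogeneous components, indexed by
  \<open>\<int>\<close> so that twists in both directions make sense. The record carries only the data.
\<close>

record ('a, 'b) graded_module = "('a, 'b) module" +
  graded_part :: "int \<Rightarrow> 'b set"

definition twist ::
    "int \<Rightarrow> ('a, 'b, 'n) graded_module_scheme \<Rightarrow> ('a, 'b, 'n) graded_module_scheme" where
  "twist n L = L\<lparr>graded_part := (\<lambda>j. graded_part L (n + j))\<rparr>"

definition graded_submodule ::
    "('a, 'b, 'n) graded_module_scheme \<Rightarrow> 'b set \<Rightarrow> ('a, 'b, 'n) graded_module_scheme" where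
  "graded_submodule L H = L\<lparr>carrier := H, graded_part := (\<lambda>j. graded_part L j \<inter> H)\<rparr>"

definition graded_isomorphic ::
    "('a, 'm) ring_scheme \<Rightarrow> ('a, 'b, 'n) graded_module_scheme \<Rightarrow>
     ('a, 'c, 'p) graded_module_scheme \<Rightarrow> bool" where
  "graded_isomorphic A L L' \<longleftrightarrow>
     (\<exists>\<phi> \<in> iso (add_monoid L) (add_monoid L').
        (\<forall>a \<in> carrier A. \<forall>x \<in> carrier L. \<phi> (a \<odot>\<^bsub>L\<^esub> x) = a \<odot>\<^bsub>L'\<^esub> \<phi> x) \<and>
        (\<forall>j. \<phi> ` graded_part L j = graded_part L' j))"

definition equigenerated_in ::
    "('a, 'm) ring_scheme \<Rightarrow> ('a, 'b, 'n) graded_module_scheme \<Rightarrow> int \<Rightarrow> bool" where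
  "equigenerated_in A L n \<longleftrightarrow>
     (\<exists>Y \<subseteq> graded_part L n. module_span A L Y = carrier L)"

definition equigenerated ::
    "('a, 'm) ring_scheme \<Rightarrow> ('a, 'b, 'n) graded_module_scheme \<Rightarrow> bool" where
  "equigenerated A L \<longleftrightarrow> (\<exists>n. equigenerated_in A L n)"

definition min_number_homogeneous_generators ::
    "('a, 'm) ring_scheme \<Rightarrow> ('a, 'b, 'n) graded_module_scheme \<Rightarrow> nat" where
  "min_number_homogeneous_generators A L =
     (LEAST n. \<exists>Y \<subseteq> (\<Union>j. graded_part L j).
        finite Y \<and> card Y = n \<and> module_span A L Y = carrier L)"

section \<open>Associated graded rings and modules\<close>

text \<open>
  For a descending filtration \<open>E\<close> of the additive group of \<open>M\<close>, the quotient group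
  \<open>E\<^sub>i / E\<^bsub>i+1\<^esub>\<close>; it is written multiplicatively, as is usual for \<^const>\<open>A_FactGroup\<close>,
  with neutral element \<open>E\<^bsub>i+1\<^esub>\<close>. Elements of the associated graded object are the finitely
  supported families of cosets, i.e. elements of the \<^const>\<open>sum_group\<close> of these quotients.
\<close>

definition gr_piece :: "('b, 'n) ring_scheme \<Rightarrow> (nat \<Rightarrow> 'b set) \<Rightarrow> nat \<Rightarrow> 'b set monoid" where
  "gr_piece M E i = (M\<lparr>carrier := E i\<rparr>) A_Mod (E (Suc i))"

abbreviation gr_group :: "('b, 'n) ring_scheme \<Rightarrow> (nat \<Rightarrow> 'b set) \<Rightarrow> (nat \<Rightarrow> 'b set) monoid" where
  "gr_group M E \<equiv> sum_group UNIV (gr_piece M E)"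

text \<open>
  The product induced on associated graded objects by a product \<open>r \<cdot> x\<close> with
  \<open>\<mm>\<^sup>i \<cdot> E\<^sub>j \<subseteq> E\<^bsub>i+j\<^esub>\<close>: the cosets of \<open>r\<close> (degree \<open>i\<close>) and \<open>x\<close> (degree \<open>j\<close>) are sent to
  \<open>r \<cdot> x + E\<^bsub>i+j+1\<^esub>\<close>, extended biadditively. The union over representatives is the idiom of
  \<^const>\<open>rcoset_mult\<close>; all its members are the same coset.
\<close>

definition gr_mult ::
    "('a \<Rightarrow> 'b \<Rightarrow> 'b) \<Rightarrow> ('b, 'n) ring_scheme \<Rightarrow> (nat \<Rightarrow> 'b set) \<Rightarrow>
     (nat \<Rightarrow> 'a set) \<Rightarrow> (nat \<Rightarrow> 'b set) \<Rightarrow> (nat \<Rightarrow> 'b set)" where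
  "gr_mult pr M E \<alpha> \<xi> =
     (\<lambda>n. \<Otimes>\<^bsub>gr_piece M E n\<^esub>i \<in> {..n}.
        (\<Union>r \<in> \<alpha> i. \<Union>x \<in> \<xi> (n - i). E (Suc n) +>\<^bsub>M\<^esub> pr r x))"

definition assoc_graded_ring :: "('a, 'm) ring_scheme \<Rightarrow> 'a set \<Rightarrow> (nat \<Rightarrow> 'a set) ring" where
  "assoc_graded_ring R \<mm> =
     (let E = ideal_power R \<mm> in
      \<lparr> carrier = carrier (gr_group R E),
        monoid.mult = gr_mult (monoid.mult R) R E,
        monoid.one = (\<lambda>i. if i = 0 then E (Suc 0) +>\<^bsub>R\<^esub> \<one>\<^bsub>R\<^esub> else E (Suc i)),
        ring.zero = monoid.one (gr_group R E),
        ring.add = monoid.mult (gr_group R E) \<rparr>)"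

text \<open>The fields \<open>mult\<close> and \<open>one\<close> of a module record have no meaning.\<close>

definition assoc_graded_module ::
    "('a, 'm) ring_scheme \<Rightarrow> 'a set \<Rightarrow> ('a, 'b, 'n) module_scheme \<Rightarrow>
     (nat \<Rightarrow> 'a set, nat \<Rightarrow> 'b set) graded_module" where
  "assoc_graded_module R \<mm> L =
     (let E = adic_filtration R \<mm> L in
      \<lparr> carrier = carrier (gr_group L E),
        monoid.mult = undefined,
        monoid.one = undefined,
        ring.zero = monoid.one (gr_group L E),
        ring.add = monoid.mult (gr_group L E),
        module.smult = gr_mult (module.smult L) L E,
        graded_part = (\<lambda>d. {\<xi> \<in> carrier (gr_group L E).
                              \<forall>i. int i \<noteq> d \<longrightarrow> \<xi> i = \<one>\<^bsub>gr_piece L E i\<^esub>}) \<rparr>)"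

section \<open>Orders, initial forms and standard bases\<close>

definition elem_order ::
    "('a, 'm) ring_scheme \<Rightarrow> 'a set \<Rightarrow> ('a, 'b, 'n) module_scheme \<Rightarrow> 'b \<Rightarrow> nat" where
  "elem_order R \<mm> F x =
     (THE i. x \<in> adic_filtration R \<mm> F i - adic_filtration R \<mm> F (Suc i))"

definition submodule_order ::
    "('a, 'm) ring_scheme \<Rightarrow> 'a set \<Rightarrow> ('a, 'b, 'n) module_scheme \<Rightarrow> 'b set \<Rightarrow> nat" where
  "submodule_order R \<mm> F N =
     (LEAST i. i \<in> elem_order R \<mm> F ` (N - {\<zero>\<^bsub>F\<^esub>}))"

definition initial_form ::
    "('a, 'm) ring_scheme \<Rightarrow> 'a set \<Rightarrow> ('a, 'b, 'n) module_scheme \<Rightarrow> 'b \<Rightarrow> (nat \<Rightarrow> 'b set)" where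
  "initial_form R \<mm> F x =
     (\<lambda>i. if i = elem_order R \<mm> F x then adic_filtration R \<mm> F (Suc i) +>\<^bsub>F\<^esub> x
          else adic_filtration R \<mm> F (Suc i))"

definition initial_form_span ::
    "('a, 'm) ring_scheme \<Rightarrow> 'a set \<Rightarrow> ('a, 'b, 'n) module_scheme \<Rightarrow> 'b set \<Rightarrow> (nat \<Rightarrow> 'b set) set"
  where
  "initial_form_span R \<mm> F S =
     module_span (assoc_graded_ring R \<mm>) (assoc_graded_module R \<mm> F)
       (initial_form R \<mm> F ` (S - {\<zero>\<^bsub>F\<^esub>}))"

text \<open>\<open>N\<^sup>*\<close> as a graded module.\<close>

definition initial_module ::
    "('a, 'm) ring_scheme \<Rightarrow> 'a set \<Rightarrow> ('a, 'b, 'n) module_scheme \<Rightarrow> 'b set \<Rightarrow>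
     (nat \<Rightarrow> 'a set, nat \<Rightarrow> 'b set) graded_module" where
  "initial_module R \<mm> F N =
     graded_submodule (assoc_graded_module R \<mm> F) (initial_form_span R \<mm> F N)"

definition standard_basis ::
    "('a, 'm) ring_scheme \<Rightarrow> 'a set \<Rightarrow> ('a, 'b, 'n) module_scheme \<Rightarrow> 'b set \<Rightarrow> 'b set \<Rightarrow> bool" where
  "standard_basis R \<mm> F N Y \<longleftrightarrow>
     finite Y \<and> Y \<subseteq> N \<and> initial_form_span R \<mm> F Y = initial_form_span R \<mm> F N"

definition all_equivalent :: "bool list \<Rightarrow> bool" where
  "all_equivalent Ps \<longleftrightarrow> (\<forall>P \<in> set Ps. \<forall>Q \<in> set Ps. P \<longleftrightarrow> Q)"

end

theory Submission
  imports Defs "HOL-Library.Multiset_Order"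
begin

text \<open>
  The component of degree \<open>i\<close> of \<open>N\<^sup>*\<close> is the image of \<open>N \<inter> \<mm>\<^sup>iF\<close> in \<open>\<mm>\<^sup>iF / \<mm>\<^bsup>i+1\<^esup>F\<close>, and it vanishes for \<open>i < s\<close>.
  Hence \<open>N\<^sup>*\<close> is generated in degree \<open>s\<close> iff \<open>N \<inter> \<mm>\<^sup>iF \<subseteq> \<mm>\<^bsup>i-s\<^esup>N + \<mm>\<^bsup>i+1\<^esup>F\<close> for all \<open>i \<ge> s\<close>; iterating this
  and using Artin--Rees (\<open>N \<inter> \<mm>\<^bsup>c+j\<^esup>F \<subseteq> \<mm>\<^sup>jN\<close>) gives (iii), which in turn identifies the two graded
  modules of (ii) through \<open>\<xi>\<^sub>i \<mapsto> \<xi>\<^bsub>i+s\<^esub> \<inter> N\<close>. The conditions on numbers of generators and on standard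
  bases follow from Nakayama's lemma, since \<open>N \<inter> \<mm>\<^bsup>s+1\<^esup>F = \<mm>N\<close> makes \<open>N / \<mm>N\<close> the component of \<open>N\<^sup>*\<close>
  in degree \<open>s\<close>. For (iv) one also needs that \<open>N\<^sup>*\<close> is finitely generated. This is the strong form of
  Artin--Rees, \<open>N \<inter> \<mm>\<^bsup>j+1\<^esup>F = \<mm>(N \<inter> \<mm>\<^sup>jF)\<close> for large \<open>j\<close>, which is proved by a leading-term argument
  with Dickson's lemma instead of the Rees algebra.
\<close>

section \<open>Submodules and spans\<close>

text \<open>Submodules of the associated graded module are compared through families: if \<mm>^i
  \<open>D j\<close> \<subseteq> \<open>D (i + j)\<close>, then \<open>D\<close> gives the submodule
  \<open>gr_image D\<close>. One chooses \<open>D\<close> so that the known generators fall into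
  \<open>gr_image D\<close>, and then reads off a single degree. The iteration for (iii) needs no
  limit: once N \<inter> \<mm>^(c+j) F \<subseteq> \<mm>^j N, finitely many steps push the error
  into \<mm>^(i-s) N. In Artin--Rees the coefficients of the monomials in generators of \<mm> do not
  come from a field, so a monomial ideal cannot record leading terms. Each monomial carries instead
  a module of possible leading coefficients, which grows along divisibility. Dickson's lemma and the
  chain condition leave finitely many monomials whose module exceeds that of every immediate
  divisor; c is the largest degree of one of them. Artin--Rees with Nakayama also yields Krull's
  intersection theorem, which guarantees that nonzero elements have an order at all. Finite
  generation of N* is needed in (iv) because the minimal number of generators is a
  \<open>LEAST\<close>, which says nothing when no finite generating set exists.\<close>

lemma submodule_iff:
  "submodule H R M \<longleftrightarrow>
     subgroup H (add_monoid M) \<and> (\<forall>a\<in>carrier R. \<forall>x\<in>H. a \<odot>\<^bsub>M\<^esub> x \<in> H)"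
  by (auto simp: submodule_def submodule_axioms_def)

lemma submodule_Inter:
  "\<lbrakk>\<And>H. H \<in> T \<Longrightarrow> submodule H R M; T \<noteq> {}\<rbrakk> \<Longrightarrow> submodule (\<Inter>T) R M"
  by (auto simp: submodule_iff intro!: subgroup_Inter)

lemma submodule_Int: "\<lbrakk>submodule U R M; submodule V R M\<rbrakk> \<Longrightarrow> submodule (U \<inter> V) R M"
  using submodule_Inter[of "{U, V}"] by auto

lemma submodule_subset: "submodule H R M \<Longrightarrow> H \<subseteq> carrier M"
  using subgroup.subset by (fastforce simp: submodule_iff)

lemma submodule_zero: "submodule H R M \<Longrightarrow> \<zero>\<^bsub>M\<^esub> \<in> H"
  using subgroup.one_closed by (fastforce simp: submodule_iff)

lemma submodule_add: "\<lbrakk>submodule H R M; x \<in> H; y \<in> H\<rbrakk> \<Longrightarrow> x \<oplus>\<^bsub>M\<^esub> y \<in> H"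
  using subgroup.m_closed by (fastforce simp: submodule_iff)

lemma submodule_smult: "\<lbrakk>submodule H R M; a \<in> carrier R; x \<in> H\<rbrakk> \<Longrightarrow> a \<odot>\<^bsub>M\<^esub> x \<in> H"
  by (auto simp: submodule_iff)

lemma submodule_minus: "\<lbrakk>submodule H R M; x \<in> H\<rbrakk> \<Longrightarrow> \<ominus>\<^bsub>M\<^esub> x \<in> H"
  using subgroup.m_inv_closed by (fastforce simp: submodule_iff a_inv_def)

text \<open>Stated for a carrier that is a submodule of itself rather than for
  \<open>module R M\<close>, so that it applies to the associated graded module, of which only the
  additive group and closure under the action are established.\<close>

lemma submodule_module_span:
  "\<lbrakk>submodule (carrier M) R M; S \<subseteq> carrier M\<rbrakk> \<Longrightarrow> submodule (module_span R M S) R M"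
  unfolding module_span_def hull_def by (rule submodule_Inter) auto

lemma module_span_minimal: "\<lbrakk>S \<subseteq> H; submodule H R M\<rbrakk> \<Longrightarrow> module_span R M S \<subseteq> H"
  unfolding module_span_def by (rule hull_minimal)

lemma module_span_inc: "S \<subseteq> module_span R M S"
  unfolding module_span_def by (rule hull_subset)

lemma module_span_mono: "S \<subseteq> T \<Longrightarrow> module_span R M S \<subseteq> module_span R M T"
  unfolding module_span_def by (rule hull_mono)

lemma submodule_restrict_iff:
  assumes "group (add_monoid M)" "submodule N R M"
  shows "submodule H R (M\<lparr>carrier := N\<rparr>) \<longleftrightarrow> submodule H R M \<and> H \<subseteq> N"
proof -
  interpret group "add_monoid M" by fact
  have N: "subgroup N (add_monoid M)" using assms(2) by (simp add: submodule_iff)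
  have "subgroup H ((add_monoid M)\<lparr>carrier := N\<rparr>) \<longleftrightarrow> subgroup H (add_monoid M) \<and> H \<subseteq> N"
    using incl_subgroup[OF N] subgroup_incl[OF _ N] subgroup.subset[of H "(add_monoid M)\<lparr>carrier := N\<rparr>"]
    by auto
  then show ?thesis by (auto simp: submodule_iff)
qed

text \<open>A submodule of \<open>M\<close> containing \<open>S\<close> may be cut down to its
  intersection with \<open>N\<close>, which is a submodule of the restriction; so both hulls
  agree.\<close>

lemma module_span_restrict:
  assumes "group (add_monoid M)" "submodule N R M" "S \<subseteq> N"
  shows "module_span R (M\<lparr>carrier := N\<rparr>) S = module_span R M S"
proof
  show "module_span R (M\<lparr>carrier := N\<rparr>) S \<subseteq> module_span R M S"
  proof
    fix x assume x: "x \<in> module_span R (M\<lparr>carrier := N\<rparr>) S"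
    have "x \<in> H" if "submodule H R M" "S \<subseteq> H" for H
    proof -
      have "submodule (H \<inter> N) R (M\<lparr>carrier := N\<rparr>)"
        using that assms by (simp add: submodule_restrict_iff submodule_Int)
      then show ?thesis using module_span_minimal[of S "H \<inter> N"] that assms x by blast
    qed
    then show "x \<in> module_span R M S" by (auto simp: module_span_def hull_def)
  qed
  show "module_span R M S \<subseteq> module_span R (M\<lparr>carrier := N\<rparr>) S"
    using assms unfolding module_span_def by (auto simp: hull_def submodule_restrict_iff)
qed

context module
begin

lemma group_add: "group (add_monoid M)"
  using M.a_group .

lemma span_submodule: "S \<subseteq> carrier M \<Longrightarrow> submodule (module_span R M S) R M"
  by (rule submodule_module_span[OF carrier_is_submodule])

lemma restrict_module_module: "submodule N R M \<Longrightarrow> module R (M\<lparr>carrier := N\<rparr>)"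
  using submodule.submodule_is_module module_axioms by blast

lemma submodule_carr: "\<lbrakk>submodule H R M; x \<in> H\<rbrakk> \<Longrightarrow> x \<in> carrier M"
  using submodule_subset by blast

lemma submodule_diff: "\<lbrakk>submodule H R M; x \<in> H; y \<in> H\<rbrakk> \<Longrightarrow> x \<ominus>\<^bsub>M\<^esub> y \<in> H"
  by (simp add: a_minus_def submodule_add submodule_minus)

lemma submodule_add_cancel:
  "\<lbrakk>submodule H R M; x \<in> H; y \<in> carrier M; x \<oplus>\<^bsub>M\<^esub> y \<in> H\<rbrakk> \<Longrightarrow> y \<in> H"
  by (metis M.a_comm M.add.inv_solve_right' M.minus_eq submodule_carr submodule_diff)

lemma diff_add_cancel: "\<lbrakk>x \<in> carrier M; y \<in> carrier M\<rbrakk> \<Longrightarrow> x \<ominus>\<^bsub>M\<^esub> y \<oplus>\<^bsub>M\<^esub> y = x"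
  by (simp add: M.minus_eq M.a_assoc M.l_neg)

lemma submodule_zero_set: "submodule {\<zero>\<^bsub>M\<^esub>} R M"
  by (rule submoduleI) auto

lemma submodule_set_add:
  assumes U: "submodule U R M" and V: "submodule V R M"
  shows "submodule (U <+>\<^bsub>M\<^esub> V) R M"
proof -
  note c = submodule_carr[OF U] submodule_carr[OF V]
  show ?thesis
  proof (rule submoduleI)
    show "U <+>\<^bsub>M\<^esub> V \<subseteq> carrier M" using c by (auto simp: set_add_def')
    show "\<zero>\<^bsub>M\<^esub> \<in> U <+>\<^bsub>M\<^esub> V"
      using submodule_zero[OF U] submodule_zero[OF V] by (force simp: set_add_def')
  next
    fix a assume "a \<in> U <+>\<^bsub>M\<^esub> V"
    then obtain u v where uv: "u \<in> U" "v \<in> V" "a = u \<oplus>\<^bsub>M\<^esub> v" by (auto simp: set_add_def')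
    then have "\<ominus>\<^bsub>M\<^esub> a = \<ominus>\<^bsub>M\<^esub> u \<oplus>\<^bsub>M\<^esub> \<ominus>\<^bsub>M\<^esub> v" using c by (simp add: M.minus_add)
    then show "\<ominus>\<^bsub>M\<^esub> a \<in> U <+>\<^bsub>M\<^esub> V"
      using uv submodule_minus[OF U] submodule_minus[OF V] by (auto simp: set_add_def')
    fix b assume "b \<in> U <+>\<^bsub>M\<^esub> V"
    then obtain u' v' where uv': "u' \<in> U" "v' \<in> V" "b = u' \<oplus>\<^bsub>M\<^esub> v'" by (auto simp: set_add_def')
    then have "a \<oplus>\<^bsub>M\<^esub> b = (u \<oplus>\<^bsub>M\<^esub> u') \<oplus>\<^bsub>M\<^esub> (v \<oplus>\<^bsub>M\<^esub> v')"
      using uv c by (simp add: M.a_ac)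
    then show "a \<oplus>\<^bsub>M\<^esub> b \<in> U <+>\<^bsub>M\<^esub> V"
      using uv uv' submodule_add[OF U] submodule_add[OF V]
      unfolding set_add_def' by (metis (no_types, lifting) UN_I singletonI)
  next
    fix r a assume r: "r \<in> carrier R" and "a \<in> U <+>\<^bsub>M\<^esub> V"
    then obtain u v where uv: "u \<in> U" "v \<in> V" "a = u \<oplus>\<^bsub>M\<^esub> v" by (auto simp: set_add_def')
    then have "r \<odot>\<^bsub>M\<^esub> a = r \<odot>\<^bsub>M\<^esub> u \<oplus>\<^bsub>M\<^esub> r \<odot>\<^bsub>M\<^esub> v" using c r by (simp add: smult_r_distr)
    then show "r \<odot>\<^bsub>M\<^esub> a \<in> U <+>\<^bsub>M\<^esub> V"
      using uv r submodule_smult[OF U] submodule_smult[OF V]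
      unfolding set_add_def' by (metis (no_types, lifting) UN_I singletonI)
  qed
qed

lemma set_add_upper:
  assumes "submodule U R M" "submodule V R M"
  shows "U \<subseteq> U <+>\<^bsub>M\<^esub> V" "V \<subseteq> U <+>\<^bsub>M\<^esub> V"
proof -
  show "U \<subseteq> U <+>\<^bsub>M\<^esub> V"
  proof
    fix u assume "u \<in> U"
    moreover have "u = u \<oplus>\<^bsub>M\<^esub> \<zero>\<^bsub>M\<^esub>" using \<open>u \<in> U\<close> submodule_carr[OF assms(1)] by simp
    ultimately show "u \<in> U <+>\<^bsub>M\<^esub> V" using submodule_zero[OF assms(2)] by (auto simp: set_add_def')
  qed
  show "V \<subseteq> U <+>\<^bsub>M\<^esub> V"
  proof
    fix u assume "u \<in> V"
    moreover have "u = \<zero>\<^bsub>M\<^esub> \<oplus>\<^bsub>M\<^esub> u" using \<open>u \<in> V\<close> submodule_carr[OF assms(2)] by simp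
    ultimately show "u \<in> U <+>\<^bsub>M\<^esub> V" using submodule_zero[OF assms(1)] by (auto simp: set_add_def')
  qed
qed

lemma set_add_minimal:
  assumes "submodule H R M" "U \<subseteq> H" "V \<subseteq> H"
  shows "U <+>\<^bsub>M\<^esub> V \<subseteq> H"
  using assms submodule_add by (fastforce simp: set_add_def')

text \<open>Lets a membership r x \<in> H be checked on generators x of a span only.\<close>

lemma submodule_smult_vimage:
  assumes "submodule H R M" "r \<in> carrier R"
  shows "submodule {x \<in> carrier M. r \<odot>\<^bsub>M\<^esub> x \<in> H} R M"
proof (rule submoduleI)
  fix a x assume "a \<in> carrier R" and x: "x \<in> {x \<in> carrier M. r \<odot>\<^bsub>M\<^esub> x \<in> H}"
  moreover have "r \<odot>\<^bsub>M\<^esub> (a \<odot>\<^bsub>M\<^esub> x) = a \<odot>\<^bsub>M\<^esub> (r \<odot>\<^bsub>M\<^esub> x)"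
    using calculation assms(2) by (simp flip: smult_assoc1 add: R.m_comm)
  ultimately show "a \<odot>\<^bsub>M\<^esub> x \<in> {x \<in> carrier M. r \<odot>\<^bsub>M\<^esub> x \<in> H}"
    using submodule_smult[OF assms(1)] by auto
qed (use assms in \<open>auto simp: submodule_zero smult_r_minus smult_r_distr submodule_minus submodule_add\<close>)

lemma submodule_ideal_smult_elem:
  assumes "ideal I R" "y \<in> carrier M"
  shows "submodule {a \<odot>\<^bsub>M\<^esub> y | a. a \<in> I} R M"
proof -
  interpret I: ideal I R by fact
  show ?thesis
  proof (rule submoduleI)
    show "\<zero>\<^bsub>M\<^esub> \<in> {a \<odot>\<^bsub>M\<^esub> y | a. a \<in> I}"
      using assms smult_l_null[of y] I.zero_closed by (metis (mono_tags, lifting) mem_Collect_eq)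
  next
    fix a assume "a \<in> {a \<odot>\<^bsub>M\<^esub> y | a. a \<in> I}"
    then obtain r where r: "r \<in> I" "a = r \<odot>\<^bsub>M\<^esub> y" by auto
    then have "\<ominus>\<^bsub>M\<^esub> a = (\<ominus> r) \<odot>\<^bsub>M\<^esub> y" using assms by (simp add: smult_l_minus I.Icarr)
    then show "\<ominus>\<^bsub>M\<^esub> a \<in> {a \<odot>\<^bsub>M\<^esub> y | a. a \<in> I}" using r by auto
    fix b assume "b \<in> {a \<odot>\<^bsub>M\<^esub> y | a. a \<in> I}"
    then obtain q where q: "q \<in> I" "b = q \<odot>\<^bsub>M\<^esub> y" by auto
    then have "a \<oplus>\<^bsub>M\<^esub> b = (r \<oplus> q) \<odot>\<^bsub>M\<^esub> y" using assms r by (simp add: smult_l_distr I.Icarr)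
    then show "a \<oplus>\<^bsub>M\<^esub> b \<in> {a \<odot>\<^bsub>M\<^esub> y | a. a \<in> I}" using q r by auto
  next
    fix b a assume b: "b \<in> carrier R" and "a \<in> {a \<odot>\<^bsub>M\<^esub> y | a. a \<in> I}"
    then obtain r where r: "r \<in> I" "a = r \<odot>\<^bsub>M\<^esub> y" by auto
    then have "b \<odot>\<^bsub>M\<^esub> a = (b \<otimes> r) \<odot>\<^bsub>M\<^esub> y" using assms b by (simp add: smult_assoc1 I.Icarr)
    then show "b \<odot>\<^bsub>M\<^esub> a \<in> {a \<odot>\<^bsub>M\<^esub> y | a. a \<in> I}" using r b I.I_l_closed by auto
  qed (use assms I.Icarr in auto)
qed

lemma module_span_Un:
  assumes "S \<subseteq> carrier M" "T \<subseteq> carrier M"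
  shows "module_span R M (S \<union> T) = module_span R M S <+>\<^bsub>M\<^esub> module_span R M T" (is "?L = ?R")
proof
  note sm = span_submodule[OF assms(1)] span_submodule[OF assms(2)]
  show "?L \<subseteq> ?R"
    using set_add_upper[OF sm] module_span_inc[of S R M] module_span_inc[of T R M]
    by (intro module_span_minimal submodule_set_add sm) auto
  show "?R \<subseteq> ?L"
    using assms by (intro set_add_minimal span_submodule module_span_mono) auto
qed

lemma module_span_singleton:
  assumes "y \<in> carrier M" shows "module_span R M {y} = {a \<odot>\<^bsub>M\<^esub> y | a. a \<in> carrier R}"
proof
  have "y = \<one> \<odot>\<^bsub>M\<^esub> y" using assms by simp
  then show "module_span R M {y} \<subseteq> {a \<odot>\<^bsub>M\<^esub> y | a. a \<in> carrier R}"
    by (intro module_span_minimal submodule_ideal_smult_elem R.oneideal assms) auto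
  show "{a \<odot>\<^bsub>M\<^esub> y | a. a \<in> carrier R} \<subseteq> module_span R M {y}"
    using module_span_inc[of "{y}" R M] submodule_smult[OF span_submodule[of "{y}"]] assms by auto
qed

lemma module_span_empty: "module_span R M {} = {\<zero>\<^bsub>M\<^esub>}"
proof
  show "module_span R M {} \<subseteq> {\<zero>\<^bsub>M\<^esub>}" by (intro module_span_minimal submodule_zero_set) auto
  show "{\<zero>\<^bsub>M\<^esub>} \<subseteq> module_span R M {}" using submodule_zero[OF span_submodule[of "{}"]] by auto
qed

lemma module_span_insertE:
  assumes "x \<in> module_span R M (insert y S)" "y \<in> carrier M" "S \<subseteq> carrier M"
  obtains r w where "r \<in> carrier R" "w \<in> module_span R M S" "x = r \<odot>\<^bsub>M\<^esub> y \<oplus>\<^bsub>M\<^esub> w"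
proof -
  have "x \<in> module_span R M {y} <+>\<^bsub>M\<^esub> module_span R M S"
    using assms module_span_Un[of "{y}" S] by simp
  then show ?thesis
    using that assms by (auto simp: set_add_def' module_span_singleton)
qed

text \<open>The form that \<^const>\<open>ideal_smult\<close> takes for submodules of \<open>M\<close>.\<close>

definition set_smult :: "'a set \<Rightarrow> 'c set \<Rightarrow> 'c set" where
  "set_smult I N = module_span R M {a \<odot>\<^bsub>M\<^esub> x | a x. a \<in> I \<and> x \<in> N}"

lemma ideal_smult_restrict:
  assumes "I \<subseteq> carrier R" "submodule N R M"
  shows "ideal_smult R I (M\<lparr>carrier := N\<rparr>) = set_smult I N"
proof -
  have "{a \<odot>\<^bsub>M\<^esub> x | a x. a \<in> I \<and> x \<in> N} \<subseteq> N" using assms submodule_smult[OF assms(2)] by blast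
  from module_span_restrict[OF group_add assms(2) this] show ?thesis
    by (simp add: ideal_smult_def set_smult_def)
qed

lemma ideal_smult_eq: "ideal_smult R I M = set_smult I (carrier M)"
  by (simp add: ideal_smult_def set_smult_def)

lemma set_smult_submodule:
  "\<lbrakk>I \<subseteq> carrier R; N \<subseteq> carrier M\<rbrakk> \<Longrightarrow> submodule (set_smult I N) R M"
  unfolding set_smult_def by (rule span_submodule) auto

lemma set_smultI: "\<lbrakk>a \<in> I; x \<in> N\<rbrakk> \<Longrightarrow> a \<odot>\<^bsub>M\<^esub> x \<in> set_smult I N"
  unfolding set_smult_def using module_span_inc by fast

lemma set_smult_least:
  "\<lbrakk>\<And>a x. a \<in> I \<Longrightarrow> x \<in> N \<Longrightarrow> a \<odot>\<^bsub>M\<^esub> x \<in> H; submodule H R M\<rbrakk> \<Longrightarrow> set_smult I N \<subseteq> H"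
  unfolding set_smult_def by (rule module_span_minimal) auto

lemma set_smult_subset: "\<lbrakk>I \<subseteq> carrier R; submodule N R M\<rbrakk> \<Longrightarrow> set_smult I N \<subseteq> N"
  by (rule set_smult_least) (auto intro: submodule_smult)

lemma set_smult_mono: "\<lbrakk>I \<subseteq> J; N \<subseteq> N'\<rbrakk> \<Longrightarrow> set_smult I N \<subseteq> set_smult J N'"
  unfolding set_smult_def by (rule module_span_mono) auto

end

section \<open>Nakayama's lemma and finite generation\<close>

context module
begin

lemma set_addI: "\<lbrakk>u \<in> U; v \<in> V\<rbrakk> \<Longrightarrow> u \<oplus>\<^bsub>M\<^esub> v \<in> U <+>\<^bsub>M\<^esub> V"
  by (auto simp: set_add_def')

lemma set_addE:
  assumes "x \<in> U <+>\<^bsub>M\<^esub> V" obtains u v where "u \<in> U" "v \<in> V" "x = u \<oplus>\<^bsub>M\<^esub> v"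
  using assms by (auto simp: set_add_def')

lemma finsum_submodule:
  assumes "submodule H R M" "finite I" "\<And>i. i \<in> I \<Longrightarrow> f i \<in> H"
  shows "(\<Oplus>\<^bsub>M\<^esub>i\<in>I. f i) \<in> H"
  using assms(2,3)
proof (induction I rule: finite_induct)
  case (insert i I)
  then show ?case
    using submodule_add[OF assms(1)] submodule_carr[OF assms(1)] by (subst M.finsum_insert) auto
qed (simp add: submodule_zero[OF assms(1)])

text \<open>The colon ideal (D : b). It carries a membership r b \<in> D from generators r of an
  ideal to the whole ideal.\<close>

lemma ideal_transporter:
  assumes D: "submodule D R M" and b: "b \<in> carrier M"
  shows "ideal {r \<in> carrier R. r \<odot>\<^bsub>M\<^esub> b \<in> D} R" (is "ideal ?J R")
proof (rule idealI)
  show "ring R" by (rule R.ring_axioms)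
  show "subgroup ?J (add_monoid R)"
  proof (rule R.add.subgroupI)
    have "\<zero> \<in> ?J" using submodule_zero[OF D] b by simp
    then show "?J \<noteq> {}" by blast
  qed (use b submodule_minus[OF D] submodule_add[OF D] in \<open>auto simp: smult_l_minus smult_l_distr\<close>)
  fix a x assume a: "a \<in> ?J" and x: "x \<in> carrier R"
  then show "x \<otimes> a \<in> ?J" using b submodule_smult[OF D x] by (simp add: smult_assoc1)
  then show "a \<otimes> x \<in> ?J" using a x R.m_comm by simp
qed

end

section \<open>Units and powers of the maximal ideal\<close>

context noetherian_local_ring
begin

lemma ideal_max: "ideal \<mm> R"
  using maximal by (simp add: maximalideal_def)

lemma max_subset: "\<mm> \<subseteq> carrier R"
  using ideal.Icarr[OF ideal_max] by auto

text \<open>Zorn's lemma on the ideals that contain \<open>I\<close> but not 1. Over a Noetherian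
  ring a nonempty chain of ideals contains its own union, which serves as upper bound; a maximal
  element is a maximal ideal, hence \<mm> by uniqueness.\<close>

lemma proper_ideal_subset_max:
  assumes "ideal I R" and "carrier R \<noteq> I"
  shows "I \<subseteq> \<mm>"
proof -
  define P where "P = {J. ideal J R \<and> I \<subseteq> J \<and> \<one> \<notin> J}"
  have IP: "I \<in> P" using assms ideal.one_imp_carrier by (fastforce simp: P_def)
  have "\<exists>U\<in>P. \<forall>Q\<in>C. Q \<subseteq> U" if C: "subset.chain P C" for C
  proof (cases "C = {}")
    case True then show ?thesis using IP by auto
  next
    case False
    have "subset.chain {J. ideal J R} C" using C by (auto simp: pred_on.chain_def P_def)
    then have "\<Union>C \<in> C" by (rule ideal_chain_is_trivial[OF False])
    then show ?thesis using C by (auto simp: pred_on.chain_def)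
  qed
  from subset_Zorn[OF this] obtain J where J: "J \<in> P" "\<And>Q. Q \<in> P \<Longrightarrow> J \<subseteq> Q \<Longrightarrow> Q = J"
    by blast
  have "maximalideal J R"
  proof (rule maximalidealI)
    show "ideal J R" "carrier R \<noteq> J" using J(1) one_closed by (auto simp: P_def)
    show "Q = J \<or> Q = carrier R" if Q: "ideal Q R" "J \<subseteq> Q" for Q
      using J Q ideal.one_imp_carrier[OF Q(1)] by (fastforce simp: P_def)
  qed
  then show ?thesis using unique_maximal J(1) by (auto simp: P_def)
qed

text \<open>Otherwise 1 - a would generate a proper ideal, hence lie in \<mm>, and 1 = (1 - a) + a
  would lie there too.\<close>

lemma one_minus_max_Units:
  assumes "a \<in> \<mm>" shows "\<one> \<ominus> a \<in> Units R"
proof -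
  interpret m: ideal \<mm> R by (rule ideal_max)
  have a: "a \<in> carrier R" using assms max_subset by auto
  let ?u = "\<one> \<ominus> a"
  have u: "?u \<in> carrier R" using a by simp
  have "PIdl ?u = carrier R"
  proof (rule ccontr)
    assume "PIdl ?u \<noteq> carrier R"
    then have "?u \<in> \<mm>" using proper_ideal_subset_max[OF cgenideal_ideal[OF u]] cgenideal_self[OF u] by auto
    then have "?u \<oplus> a \<in> \<mm>" using assms by simp
    moreover have "?u \<oplus> a = \<one>" using a by (simp add: minus_eq a_assoc l_neg)
    ultimately have "\<mm> = carrier R" using m.one_imp_carrier by simp
    then show False using maximal by (simp add: maximalideal_def maximalideal_axioms_def)
  qed
  then obtain b where "b \<in> carrier R" "\<one> = b \<otimes> ?u" using one_closed by (auto simp: cgenideal_def)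
  then show ?thesis using u m_comm by (auto simp: Units_def intro!: bexI[of _ b])
qed

abbreviation max_pow :: "nat \<Rightarrow> 'a set" where "max_pow \<equiv> ideal_power R \<mm>"

lemma max_pow_ideal: "ideal (max_pow i) R"
  using ideal_max oneideal ideal_prod_is_ideal
  by (induction i) (auto simp: ideal_power_def ideals_set_def)

lemma max_pow_subset: "max_pow i \<subseteq> carrier R"
  using ideal.Icarr[OF max_pow_ideal] by auto

lemma max_pow_0: "max_pow 0 = carrier R"
  by (simp add: ideal_power_def ideals_set_def)

lemma max_pow_Suc: "max_pow (Suc i) = ideal_prod R (max_pow i) \<mm>"
  by (simp add: ideal_power_def ideals_set_def)

lemma max_pow_1: "max_pow (Suc 0) = \<mm>"
  using ideal_prod_one[OF ideal_max] ideal_prod_commute[OF ideal_max oneideal]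
  by (simp add: max_pow_Suc max_pow_0)

lemma max_pow_add: "max_pow (i + j) = ideal_prod R (max_pow i) (max_pow j)"
proof -
  interpret I: comm_monoid "ideals_set R" by (rule ideals_set_is_comm_monoid)
  have "\<mm> \<in> carrier (ideals_set R)" using ideal_max by (simp add: ideals_set_def)
  from I.nat_pow_mult[OF this, of i j] show ?thesis
    by (simp add: ideal_power_def) (simp add: ideals_set_def)
qed

lemma max_pow_mult: "\<lbrakk>a \<in> max_pow i; b \<in> max_pow j\<rbrakk> \<Longrightarrow> a \<otimes> b \<in> max_pow (i + j)"
  unfolding max_pow_add by (rule ideal_prod.prod)

lemma max_pow_Suc_subset: "max_pow (Suc i) \<subseteq> max_pow i"
  using ideal_prod_inter[OF max_pow_ideal ideal_max] by (auto simp: max_pow_Suc)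

end

locale local_module = noetherian_local_ring R \<mm> + module R M
  for R (structure) and \<mm> and M (structure)

definition fin_gen :: "('a, 'm) ring_scheme \<Rightarrow> ('a, 'b, 'n) module_scheme \<Rightarrow> 'b set \<Rightarrow> bool" where
  "fin_gen R M N \<longleftrightarrow> (\<exists>Y \<subseteq> carrier M. finite Y \<and> module_span R M Y = N)"

context local_module
begin

text \<open>No quotient N / W is formed: \<open>Y\<close> generates \<open>N\<close> relative to
  \<open>W\<close>, and its elements are discarded one at a time. With U the part generated without
  y, the hypothesis gives y = u + a y with u in U and a in \<mm>; as 1 - a is a unit, y is
  redundant.\<close>

lemma Nakayama_aux:
  assumes "finite Y" "Y \<subseteq> carrier M" "submodule W R M"
    and "N = W <+>\<^bsub>M\<^esub> module_span R M Y" "N \<subseteq> W <+>\<^bsub>M\<^esub> set_smult \<mm> N"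
  shows "N = W"
  using assms
proof (induction Y arbitrary: N rule: finite_induct)
  case empty
  then show ?case
    using set_add_minimal[of W W "{\<zero>\<^bsub>M\<^esub>}"] set_add_upper[OF empty(2) submodule_zero_set]
    by (auto simp: module_span_empty submodule_zero)
next
  case (insert y Y)
  note W = \<open>submodule W R M\<close>
  have y: "y \<in> carrier M" and Y: "Y \<subseteq> carrier M" using insert.prems by auto
  let ?U = "W <+>\<^bsub>M\<^esub> module_span R M Y"
  note sY = span_submodule[OF Y]
  have U: "submodule ?U R M" by (intro submodule_set_add W sY)
  have spY: "module_span R M (insert y Y) = module_span R M {y} <+>\<^bsub>M\<^esub> module_span R M Y"
    using module_span_Un[of "{y}" Y] y Y by simp
  have sy: "submodule (module_span R M {y}) R M" using y by (intro span_submodule) auto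
  have sp: "submodule (module_span R M (insert y Y)) R M" using y Y by (intro span_submodule) auto
  have N: "submodule N R M" unfolding insert.prems by (intro submodule_set_add W sp)
  have UN: "?U \<subseteq> N"
    unfolding insert.prems
    using set_add_upper[OF W sp] set_add_upper[OF sy sY]
    by (intro set_add_minimal submodule_set_add W sp) (auto simp: spY)
  let ?D = "?U <+>\<^bsub>M\<^esub> {a \<odot>\<^bsub>M\<^esub> y | a. a \<in> \<mm>}"
  note my = submodule_ideal_smult_elem[OF ideal_max y]
  note DU = set_add_upper[OF U my]
  have D: "submodule ?D R M" by (intro submodule_set_add U my)
  have yN: "y \<in> N"
    using set_add_upper[OF W sp] module_span_inc[of "insert y Y" R M] insert.prems by auto
  \<comment> \<open>All contributions except that of \<open>y\<close> are absorbed into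
    \<open>?U\<close>; only the coefficient of \<open>y\<close> has to stay in \<mm>.\<close>
  have "set_smult \<mm> N \<subseteq> ?D"
  proof (rule set_smult_least[OF _ D])
    fix a x assume a: "a \<in> \<mm>" and "x \<in> N"
    then obtain w v where wv: "w \<in> W" "v \<in> module_span R M (insert y Y)" "x = w \<oplus>\<^bsub>M\<^esub> v"
      using insert.prems by (auto simp: set_add_def')
    obtain r u where ru: "r \<in> carrier R" "u \<in> module_span R M Y" "v = r \<odot>\<^bsub>M\<^esub> y \<oplus>\<^bsub>M\<^esub> u"
      using module_span_insertE[OF wv(2) y Y] by metis
    have ac: "a \<in> carrier R" using a max_subset by auto
    have wc: "w \<in> carrier M" and uc: "u \<in> carrier M"
      using submodule_carr[OF W wv(1)] submodule_carr[OF sY ru(2)] by auto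
    have 1: "a \<odot>\<^bsub>M\<^esub> x = (a \<odot>\<^bsub>M\<^esub> (w \<oplus>\<^bsub>M\<^esub> u)) \<oplus>\<^bsub>M\<^esub> (a \<otimes> r) \<odot>\<^bsub>M\<^esub> y"
      using ac wc uc y wv(3) ru(1,3) by (simp add: smult_r_distr smult_assoc1 M.a_ac)
    have "w \<oplus>\<^bsub>M\<^esub> u \<in> ?U" using wv(1) ru(2) by (auto simp: set_add_def')
    then have "a \<odot>\<^bsub>M\<^esub> (w \<oplus>\<^bsub>M\<^esub> u) \<in> ?D" using submodule_smult[OF U ac] DU by blast
    moreover have "(a \<otimes> r) \<odot>\<^bsub>M\<^esub> y \<in> ?D"
      using ideal.I_r_closed[OF ideal_max a ru(1)] DU by blast
    ultimately show "a \<odot>\<^bsub>M\<^esub> x \<in> ?D" unfolding 1 by (rule submodule_add[OF D])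
  qed
  moreover have "W \<subseteq> ?D" using set_add_upper[OF W sY] DU by blast
  ultimately have "N \<subseteq> ?D" using insert.prems(4) set_add_minimal[OF D] by blast
  then have "y \<in> ?D" using yN by blast
  then obtain u v where uv: "u \<in> ?U" "v \<in> {a \<odot>\<^bsub>M\<^esub> y | a. a \<in> \<mm>}" "y = u \<oplus>\<^bsub>M\<^esub> v"
    by (rule set_addE)
  then obtain a where ua: "u \<in> ?U" "a \<in> \<mm>" "y = u \<oplus>\<^bsub>M\<^esub> a \<odot>\<^bsub>M\<^esub> y" by auto
  have ac: "a \<in> carrier R" using ua(2) max_subset by auto
  have uc: "u \<in> carrier M" using submodule_carr[OF U ua(1)] .
  let ?e = "\<one> \<ominus> a"
  have eu: "?e \<odot>\<^bsub>M\<^esub> y = u"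
  proof -
    have "?e \<odot>\<^bsub>M\<^esub> y = y \<oplus>\<^bsub>M\<^esub> \<ominus>\<^bsub>M\<^esub> (a \<odot>\<^bsub>M\<^esub> y)"
      using ac y by (simp add: a_minus_def smult_l_distr smult_l_minus)
    also have "\<dots> = (u \<oplus>\<^bsub>M\<^esub> a \<odot>\<^bsub>M\<^esub> y) \<oplus>\<^bsub>M\<^esub> \<ominus>\<^bsub>M\<^esub> (a \<odot>\<^bsub>M\<^esub> y)" using ua(3) by simp
    also have "\<dots> = u" using uc ac y by (simp add: M.a_assoc M.r_neg)
    finally show ?thesis .
  qed
  obtain b where b: "b \<in> carrier R" "b \<otimes> ?e = \<one>"
    using one_minus_max_Units[OF ua(2)] by (auto simp: Units_def)
  have "y = (b \<otimes> ?e) \<odot>\<^bsub>M\<^esub> y" using b y by simp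
  also have "\<dots> = b \<odot>\<^bsub>M\<^esub> u" using b(1) ac y eu by (simp add: smult_assoc1)
  finally have "y \<in> ?U" using submodule_smult[OF U b(1) ua(1)] by simp
  then have "insert y Y \<subseteq> ?U"
    using set_add_upper[OF W sY] module_span_inc[of Y R M] by auto
  then have "module_span R M (insert y Y) \<subseteq> ?U" by (rule module_span_minimal[OF _ U])
  then have "N \<subseteq> ?U"
    unfolding insert.prems by (intro set_add_minimal[OF U] set_add_upper[OF W sY])
  then have "N = ?U" using UN by auto
  then show ?case using insert.IH[OF Y W _ insert.prems(4)] by simp
qed

lemma Nakayama:
  assumes "submodule N R M" "fin_gen R M N" "submodule W R M" "W \<subseteq> N"
    and "N \<subseteq> W <+>\<^bsub>M\<^esub> set_smult \<mm> N"
  shows "N = W"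
proof -
  obtain Y where Y: "Y \<subseteq> carrier M" "finite Y" "module_span R M Y = N"
    using assms by (auto simp: fin_gen_def)
  have "N = W <+>\<^bsub>M\<^esub> N"
    using assms set_add_upper[of W N] set_add_minimal[of N W N] by blast
  then show ?thesis using Nakayama_aux[of Y W N] Y assms by simp
qed

text \<open>Induction on the generators of the ambient module. The coefficients of \<open>b\<close>
  that occur in \<open>N\<close> modulo the span of \<open>B\<close> form an ideal, which is
  finitely generated; lifts of its generators to \<open>N\<close>, together with generators of N
  \<inter> span \<open>B\<close>, generate \<open>N\<close>.\<close>

lemma fin_gen_submodule_aux:
  assumes "finite B" "B \<subseteq> carrier M" "submodule N R M" "N \<subseteq> module_span R M B"
  shows "fin_gen R M N"
  using assms
proof (induction B arbitrary: N rule: finite_induct)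
  case empty
  then have "N = {\<zero>\<^bsub>M\<^esub>}" using submodule_zero[of N] by (auto simp: module_span_empty)
  then show ?case by (auto simp: fin_gen_def module_span_empty intro!: exI[of _ "{}"])
next
  case (insert b B)
  note N = \<open>submodule N R M\<close>
  have b: "b \<in> carrier M" and B: "B \<subseteq> carrier M" using insert.prems by auto
  note sB = span_submodule[OF B]
  define I where "I = {r \<in> carrier R. r \<odot>\<^bsub>M\<^esub> b \<in> N <+>\<^bsub>M\<^esub> module_span R M B}"
  have I: "ideal I R"
    unfolding I_def by (intro ideal_transporter submodule_set_add N sB b)
  obtain A where A: "A \<subseteq> carrier R" "finite A" "I = Idl A" using finetely_gen[OF I] by auto
  have "\<exists>n\<in>N. \<exists>w\<in>module_span R M B. a \<odot>\<^bsub>M\<^esub> b = n \<oplus>\<^bsub>M\<^esub> w" if "a \<in> A" for a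
  proof -
    have "a \<in> I" using genideal_self[OF A(1)] that A(3) by auto
    then have "a \<odot>\<^bsub>M\<^esub> b \<in> N <+>\<^bsub>M\<^esub> module_span R M B" by (simp add: I_def)
    then show ?thesis by (rule set_addE) blast
  qed
  then obtain f g where fg: "\<And>a. a \<in> A \<Longrightarrow> f a \<in> N"
    "\<And>a. a \<in> A \<Longrightarrow> g a \<in> module_span R M B"  "\<And>a. a \<in> A \<Longrightarrow> a \<odot>\<^bsub>M\<^esub> b = f a \<oplus>\<^bsub>M\<^esub> g a"
    by metis
  have "submodule (N \<inter> module_span R M B) R M" by (intro submodule_Int N sB)
  from insert.IH[OF B this] obtain Y where Y: "Y \<subseteq> carrier M" "finite Y"
    "module_span R M Y = N \<inter> module_span R M B" by (auto simp: fin_gen_def)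
  have fA: "f ` A \<subseteq> N" using fg by auto
  have YN: "Y \<subseteq> N" using module_span_inc[of Y R M] Y by auto
  have fAY: "f ` A \<union> Y \<subseteq> carrier M" using fA Y submodule_carr[OF N] by auto
  let ?S = "module_span R M (f ` A \<union> Y)"
  have S: "submodule ?S R M" using fAY by (rule span_submodule)
  have YS: "N \<inter> module_span R M B \<subseteq> ?S"
    using module_span_mono[of Y "f ` A \<union> Y" R M] Y(3) by auto
  \<comment> \<open>The coefficients of \<open>b\<close> that the lifted generators already supply;
    containing \<open>A\<close>, this ideal contains \<open>I\<close>.\<close>
  let ?J = "{r \<in> carrier R. r \<odot>\<^bsub>M\<^esub> b \<in> ?S <+>\<^bsub>M\<^esub> module_span R M B}"
  have "A \<subseteq> ?J"
  proof
    fix a assume a: "a \<in> A"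
    have "f a \<in> ?S" using module_span_inc[of "f ` A \<union> Y" R M] a by auto
    then show "a \<in> ?J" using A a fg by (auto intro: set_addI)
  qed
  then have IJ: "I \<subseteq> ?J"
    unfolding A(3) by (intro genideal_minimal ideal_transporter submodule_set_add S sB b)
  have "?S = N"
  proof
    show SN: "?S \<subseteq> N" using fA YN by (intro module_span_minimal N) auto
    show "N \<subseteq> ?S"
    proof
      fix n assume n: "n \<in> N"
      obtain r w where rw: "r \<in> carrier R" "w \<in> module_span R M B" "n = r \<odot>\<^bsub>M\<^esub> b \<oplus>\<^bsub>M\<^esub> w"
        using module_span_insertE[OF _ b B] n insert.prems(3) by (metis subsetD)
      have nc: "n \<in> carrier M" "w \<in> carrier M" using n rw submodule_carr[OF N] submodule_carr[OF sB] by auto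
      have "r \<odot>\<^bsub>M\<^esub> b = n \<oplus>\<^bsub>M\<^esub> \<ominus>\<^bsub>M\<^esub> w"
        using rw nc b by (simp add: M.a_assoc M.r_neg)
      then have "r \<in> I"
        using rw(1) set_addI[OF n submodule_minus[OF sB rw(2)]] by (simp add: I_def)
      then have "r \<odot>\<^bsub>M\<^esub> b \<in> ?S <+>\<^bsub>M\<^esub> module_span R M B" using IJ by auto
      then obtain n' w' where n': "n' \<in> ?S" "w' \<in> module_span R M B" "r \<odot>\<^bsub>M\<^esub> b = n' \<oplus>\<^bsub>M\<^esub> w'"
        by (rule set_addE)
      have c': "n' \<in> carrier M" "w' \<in> carrier M"
        using n' submodule_carr[OF S] submodule_carr[OF sB] by auto
      \<comment> \<open>The \<open>b\<close> components of \<open>n\<close> and \<open>n'\<close>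
        agree, so their difference involves only \<open>B\<close> and is covered by the induction
        hypothesis.\<close>
      have d: "n \<ominus>\<^bsub>M\<^esub> n' = w' \<oplus>\<^bsub>M\<^esub> w"
      proof -
        have "n \<ominus>\<^bsub>M\<^esub> n' = (n' \<oplus>\<^bsub>M\<^esub> \<ominus>\<^bsub>M\<^esub> n') \<oplus>\<^bsub>M\<^esub> (w' \<oplus>\<^bsub>M\<^esub> w)"
          unfolding rw(3) n'(3) M.minus_eq using nc c' by (simp add: M.a_ac)
        then show ?thesis using nc c' by (simp add: M.r_neg)
      qed
      have "n \<ominus>\<^bsub>M\<^esub> n' \<in> N" using submodule_diff[OF N n] n'(1) SN by auto
      moreover have "n \<ominus>\<^bsub>M\<^esub> n' \<in> module_span R M B" unfolding d by (rule submodule_add[OF sB n'(2) rw(2)])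
      ultimately have "n \<ominus>\<^bsub>M\<^esub> n' \<in> ?S" using YS by auto
      from submodule_add[OF S this n'(1)] show "n \<in> ?S"
        using diff_add_cancel submodule_carr[OF N n] submodule_carr[OF S n'(1)] by simp
    qed
  qed
  then show ?case using A(2) Y(2) fAY by (auto simp: fin_gen_def intro!: exI[of _ "f ` A \<union> Y"])
qed

end

locale fg_local_module = local_module +
  assumes fg: "fin_gen R M (carrier M)"
begin

lemma fin_gen_submodule: "submodule N R M \<Longrightarrow> fin_gen R M N"
  using fg fin_gen_submodule_aux submodule_subset by (metis fin_gen_def)

text \<open>The union of the chain is finitely generated, so finitely many generators already lie in
  one member. A single stationary step is all that \<open>finite_essential\<close> asks for.\<close>

lemma submodule_chain_stable:
  fixes V :: "nat \<Rightarrow> 'c set"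
  assumes "\<And>i. submodule (V i) R M" "\<And>i. V i \<subseteq> V (Suc i)"
  shows "\<exists>i. V (Suc i) = V i"
proof -
  have mono: "i \<le> j \<Longrightarrow> V i \<subseteq> V j" for i j using lift_Suc_mono_le[of V] assms by auto
  have U: "submodule (\<Union>i. V i) R M"
  proof (rule submoduleI)
    show "(\<Union>i. V i) \<subseteq> carrier M" using submodule_subset[OF assms(1)] by blast
    show "\<zero>\<^bsub>M\<^esub> \<in> (\<Union>i. V i)" using submodule_zero[OF assms(1)] by blast
    show "\<ominus>\<^bsub>M\<^esub> a \<in> (\<Union>i. V i)" if "a \<in> (\<Union>i. V i)" for a
      using that submodule_minus[OF assms(1)] by blast
    show "r \<odot>\<^bsub>M\<^esub> a \<in> (\<Union>i. V i)" if "r \<in> carrier R" "a \<in> (\<Union>i. V i)" for r a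
      using that submodule_smult[OF assms(1)] by blast
  next
    fix a b assume "a \<in> (\<Union>i. V i)" "b \<in> (\<Union>i. V i)"
    then obtain i j where "a \<in> V i" "b \<in> V j" by auto
    then have "a \<in> V (max i j)" "b \<in> V (max i j)" using mono[of i "max i j"] mono[of j "max i j"] by auto
    then show "a \<oplus>\<^bsub>M\<^esub> b \<in> (\<Union>i. V i)" using submodule_add[OF assms(1)] by blast
  qed
  obtain Y where Y: "finite Y" "module_span R M Y = (\<Union>i. V i)"
    using fin_gen_submodule[OF U] by (auto simp: fin_gen_def)
  have "\<exists>i. Y' \<subseteq> V i" if "finite Y'" "Y' \<subseteq> (\<Union>i. V i)" for Y'
    using that
  proof (induction Y')
    case (insert y Y')
    then obtain i j where "y \<in> V i" "Y' \<subseteq> V j" by auto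
    then show ?case using mono[of i "max i j"] mono[of j "max i j"] by (intro exI[of _ "max i j"]) auto
  qed auto
  then obtain i where "Y \<subseteq> V i" using Y module_span_inc[of Y R M] by metis
  then have "(\<Union>i. V i) \<subseteq> V i" using Y module_span_minimal[OF _ assms(1)] by metis
  then show ?thesis using assms(2) by blast
qed

end

section \<open>The Artin--Rees lemma\<close>

text \<open>Take a monotone subsequence; if it decreases, it is constant from the point where it
  attains its minimum, and dropping the earlier terms makes it weakly increasing.\<close>

lemma nat_seq_incseq_subseq:
  fixes s :: "nat \<Rightarrow> nat"
  shows "\<exists>h::nat \<Rightarrow> nat. strict_mono h \<and> incseq (\<lambda>n. s (h n))"
proof -
  obtain f where f: "strict_mono f" "monoseq (\<lambda>n. s (f n))" using seq_monosub by blast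
  show ?thesis
  proof (cases "incseq (\<lambda>n. s (f n))")
    case True then show ?thesis using f by blast
  next
    case False
    then have dec: "\<And>m n. m \<le> n \<Longrightarrow> s (f n) \<le> s (f m)"
      using f(2) by (auto simp: monoseq_def incseq_def)
    obtain k where k: "\<And>n. s (f k) \<le> s (f n)"
      using ex_has_least_nat[of "\<lambda>_. True" 0 "\<lambda>n. s (f n)"] by auto
    have "s (f (n + k)) = s (f k)" for n using dec[of k "n + k"] k[of "n + k"] by auto
    moreover have "strict_mono (\<lambda>n. f (n + k))" using f(1) by (simp add: strict_mono_def)
    ultimately show ?thesis by (auto simp: incseq_def)
  qed
qed

text \<open>Dickson's lemma in subsequence form, by thinning out for one coordinate at a time;
  coordinates already treated stay increasing along a further subsequence.\<close>

lemma Dickson_subseq: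
  fixes f :: "nat \<Rightarrow> nat \<Rightarrow> nat"
  shows "\<exists>g::nat \<Rightarrow> nat. strict_mono g \<and> (\<forall>i<r. incseq (\<lambda>n. f (g n) i))"
proof (induction r)
  case 0 then show ?case by (auto intro!: exI[of _ id] strict_monoI)
next
  case (Suc r)
  then obtain g :: "nat \<Rightarrow> nat" where g: "strict_mono g" "\<forall>i<r. incseq (\<lambda>n. f (g n) i)" by blast
  obtain h :: "nat \<Rightarrow> nat" where h: "strict_mono h" "incseq (\<lambda>n. f (g (h n)) r)"
    using nat_seq_incseq_subseq[of "\<lambda>n. f (g n) r"] by blast
  have "incseq (\<lambda>n. f (g (h n)) i)" if "i < Suc r" for i
    using that g(2) h strict_mono_leD[OF h(1)] by (cases "i = r") (auto simp: incseq_def)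
  moreover have "strict_mono (\<lambda>n. g (h n))" using g(1) h(1) by (simp add: strict_mono_def)
  ultimately show ?case by (intro exI[of _ "\<lambda>n. g (h n)"]) auto
qed

context module
begin

lemma set_smult_set_smult:
  assumes "\<And>a b. \<lbrakk>a \<in> I; b \<in> J\<rbrakk> \<Longrightarrow> a \<otimes> b \<in> K" "I \<subseteq> carrier R" "J \<subseteq> carrier R" "K \<subseteq> carrier R"
    and "N \<subseteq> carrier M"
  shows "set_smult I (set_smult J N) \<subseteq> set_smult K N"
proof (rule set_smult_least)
  show K: "submodule (set_smult K N) R M" using assms by (intro set_smult_submodule) auto
  fix a x assume a: "a \<in> I" and x: "x \<in> set_smult J N"
  have "set_smult J N \<subseteq> {x \<in> carrier M. a \<odot>\<^bsub>M\<^esub> x \<in> set_smult K N}"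
  proof (rule set_smult_least)
    show "submodule {x \<in> carrier M. a \<odot>\<^bsub>M\<^esub> x \<in> set_smult K N} R M"
      using a assms by (intro submodule_smult_vimage K) auto
    fix b y assume b: "b \<in> J" and y: "y \<in> N"
    have "a \<odot>\<^bsub>M\<^esub> (b \<odot>\<^bsub>M\<^esub> y) = (a \<otimes> b) \<odot>\<^bsub>M\<^esub> y" using a b y assms by (subst smult_assoc1) auto
    also have "\<dots> \<in> set_smult K N" using a b y assms by (intro set_smultI) auto
    finally show "b \<odot>\<^bsub>M\<^esub> y \<in> {x \<in> carrier M. a \<odot>\<^bsub>M\<^esub> x \<in> set_smult K N}" using b y assms by auto
  qed
  then show "a \<odot>\<^bsub>M\<^esub> x \<in> set_smult K N" using x by auto
qed

end

context local_module
begin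

abbreviation filt :: "nat \<Rightarrow> 'c set" where "filt \<equiv> adic_filtration R \<mm> M"

lemma filt_eq: "filt i = set_smult (max_pow i) (carrier M)"
  by (simp add: adic_filtration_def ideal_smult_eq)

lemma filt_submodule: "submodule (filt i) R M"
  unfolding filt_eq using max_pow_subset by (intro set_smult_submodule) auto

lemma filt_0: "filt 0 = carrier M"
proof
  show "filt 0 \<subseteq> carrier M" by (rule submodule_subset[OF filt_submodule])
  have "x \<in> filt 0" if "x \<in> carrier M" for x
    using set_smultI[of \<one> "carrier R" x "carrier M"] that by (simp add: filt_eq max_pow_0)
  then show "carrier M \<subseteq> filt 0" by auto
qed

lemma filt_Suc_subset: "filt (Suc i) \<subseteq> filt i"
  unfolding filt_eq by (intro set_smult_mono max_pow_Suc_subset) auto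

lemma filt_antimono: "i \<le> j \<Longrightarrow> filt j \<subseteq> filt i"
  using lift_Suc_antimono_le[of filt i j] filt_Suc_subset by auto

lemma set_smult_max_pow:
  "N \<subseteq> carrier M \<Longrightarrow> set_smult (max_pow i) (set_smult (max_pow j) N) \<subseteq> set_smult (max_pow (i + j)) N"
  using max_pow_subset max_pow_mult by (intro set_smult_set_smult) auto

lemma smult_filt: "\<lbrakk>a \<in> max_pow i; x \<in> filt j\<rbrakk> \<Longrightarrow> a \<odot>\<^bsub>M\<^esub> x \<in> filt (i + j)"
  using set_smult_max_pow[of "carrier M" i j] set_smultI[of a "max_pow i" x "filt j"]
  unfolding filt_eq by blast

end

section \<open>Monomials in generators of the maximal ideal\<close>

locale monomial_module = fg_local_module +
  fixes x :: "nat \<Rightarrow> 'a" and r :: nat and N :: "'c set"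
  assumes gens_closed: "\<And>i. i < r \<Longrightarrow> x i \<in> carrier R"
    and gens: "\<mm> = Idl (x ` {..<r})"
    and N: "submodule N R M"
begin

text \<open>Exponent vectors are multisets: sum is multiplication of monomials, \<open>size\<close>
  is the degree, inclusion is divisibility. The multiset order over the naturals is total,
  well-founded and compatible with sums, so it is a monomial order.\<close>

definition mon :: "nat multiset \<Rightarrow> 'a" where
  "mon \<beta> = (\<Otimes>\<^bsub>R\<^esub>i\<in>{..<r}. x i [^]\<^bsub>R\<^esub> count \<beta> i)"

lemma mon_closed [simp]: "mon \<beta> \<in> carrier R"
  unfolding mon_def using gens_closed by (intro finprod_closed) auto

lemma mon_add: "mon (\<beta> + \<gamma>) = mon \<beta> \<otimes> mon \<gamma>"
proof -
  have "mon \<beta> \<otimes> mon \<gamma> = (\<Otimes>\<^bsub>R\<^esub>i\<in>{..<r}. x i [^]\<^bsub>R\<^esub> count \<beta> i \<otimes> x i [^]\<^bsub>R\<^esub> count \<gamma> i)"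
    unfolding mon_def using gens_closed by (intro finprod_multf[symmetric]) auto
  also have "\<dots> = mon (\<beta> + \<gamma>)"
    unfolding mon_def using gens_closed by (intro finprod_cong') (auto simp: nat_pow_mult)
  finally show ?thesis by simp
qed

lemma mon_empty: "mon {#} = \<one>"
  unfolding mon_def using gens_closed by (intro finprod_one_eqI) auto

lemma mon_single:
  assumes "i < r" shows "mon {#i#} = x i"
proof -
  have "mon {#i#} = (\<Otimes>\<^bsub>R\<^esub>j\<in>{..<r}. if i = j then x j else \<one>)"
    unfolding mon_def using gens_closed by (intro finprod_cong') auto
  also have "\<dots> = x i" using assms gens_closed by (intro finprod_singleton) auto
  finally show ?thesis .
qed

lemma mon_max_pow: "set_mset \<beta> \<subseteq> {..<r} \<Longrightarrow> mon \<beta> \<in> max_pow (size \<beta>)"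
proof (induction \<beta>)
  case empty then show ?case by (simp add: mon_empty max_pow_0)
next
  case (add i \<beta>)
  have "x i \<in> \<mm>" using add.prems gens_closed genideal_self[of "x ` {..<r}"] by (auto simp: gens)
  then have "mon \<beta> \<otimes> x i \<in> max_pow (size \<beta> + 1)"
    using add max_pow_mult[of "mon \<beta>" "size \<beta>" "x i" 1] by (simp add: max_pow_1)
  moreover have "mon (add_mset i \<beta>) = mon \<beta> \<otimes> x i"
    using mon_add[of \<beta> "{#i#}"] mon_single[of i] add.prems by simp
  ultimately show ?case by simp
qed

abbreviation mons :: "nat \<Rightarrow> nat multiset set" where "mons \<equiv> multisets_of_size {..<r}"

lemma finite_mons: "finite (mons d)" by (rule finite_multisets_of_size) simp

definition mon_span :: "nat multiset set \<Rightarrow> 'c set" where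
  "mon_span S = module_span R M {mon \<beta> \<odot>\<^bsub>M\<^esub> a | \<beta> a. \<beta> \<in> S \<and> a \<in> carrier M}"

lemma mon_span_submodule: "submodule (mon_span S) R M"
  unfolding mon_span_def by (rule span_submodule) auto

lemma mon_spanI: "\<lbrakk>\<beta> \<in> S; a \<in> carrier M\<rbrakk> \<Longrightarrow> mon \<beta> \<odot>\<^bsub>M\<^esub> a \<in> mon_span S"
  unfolding mon_span_def using module_span_inc by fast

lemma mon_span_least:
  "\<lbrakk>\<And>\<beta> a. \<lbrakk>\<beta> \<in> S; a \<in> carrier M\<rbrakk> \<Longrightarrow> mon \<beta> \<odot>\<^bsub>M\<^esub> a \<in> H; submodule H R M\<rbrakk> \<Longrightarrow> mon_span S \<subseteq> H"
  unfolding mon_span_def by (rule module_span_minimal) auto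

lemma mon_span_mono: "S \<subseteq> T \<Longrightarrow> mon_span S \<subseteq> mon_span T"
  unfolding mon_span_def by (rule module_span_mono) auto

lemma mon_span_empty: "mon_span {} = {\<zero>\<^bsub>M\<^esub>}"
  by (simp add: mon_span_def module_span_empty)

lemma mon_smult_mon_span:
  assumes "\<And>\<beta>. \<beta> \<in> S \<Longrightarrow> \<beta> + \<gamma> \<in> T" "y \<in> mon_span S"
  shows "mon \<gamma> \<odot>\<^bsub>M\<^esub> y \<in> mon_span T"
proof -
  have "mon_span S \<subseteq> {y \<in> carrier M. mon \<gamma> \<odot>\<^bsub>M\<^esub> y \<in> mon_span T}"
  proof (rule mon_span_least)
    show "submodule {y \<in> carrier M. mon \<gamma> \<odot>\<^bsub>M\<^esub> y \<in> mon_span T} R M"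
      by (intro submodule_smult_vimage mon_span_submodule) simp
    fix \<beta> a assume \<beta>: "\<beta> \<in> S" and a: "a \<in> carrier M"
    have "mon \<gamma> \<odot>\<^bsub>M\<^esub> (mon \<beta> \<odot>\<^bsub>M\<^esub> a) = mon (\<beta> + \<gamma>) \<odot>\<^bsub>M\<^esub> a"
      using a by (simp add: mon_add m_comm flip: smult_assoc1)
    also have "\<dots> \<in> mon_span T" using assms(1)[OF \<beta>] a by (rule mon_spanI)
    finally show "mon \<beta> \<odot>\<^bsub>M\<^esub> a \<in> {y \<in> carrier M. mon \<gamma> \<odot>\<^bsub>M\<^esub> y \<in> mon_span T}" using a by simp
  qed
  then show ?thesis using assms(2) by auto
qed

lemma max_smult_mon_span:
  assumes q: "q \<in> \<mm>" and y: "y \<in> mon_span (mons d)"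
  shows "q \<odot>\<^bsub>M\<^esub> y \<in> mon_span (mons (Suc d))"
proof -
  let ?J = "{q \<in> carrier R. q \<odot>\<^bsub>M\<^esub> y \<in> mon_span (mons (Suc d))}"
  have yc: "y \<in> carrier M" using submodule_carr[OF mon_span_submodule y] .
  have "x i \<odot>\<^bsub>M\<^esub> y \<in> mon_span (mons (Suc d))" if "i < r" for i
    using mon_smult_mon_span[of "mons d" "{#i#}" "mons (Suc d)" y] that y
    by (auto simp: mon_single multisets_of_size_def)
  then have "x ` {..<r} \<subseteq> ?J" using gens_closed by auto
  then have "\<mm> \<subseteq> ?J"
    unfolding gens by (intro genideal_minimal ideal_transporter mon_span_submodule yc)
  then show ?thesis using q by auto
qed

text \<open>The power \<mm>^d is generated by the monomials of degree d; this is its form inside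
  \<open>M\<close>, proved without describing the ideal itself. Each further factor from \<mm> is
  expanded in the \<open>x i\<close> by \<open>max_smult_mon_span\<close>.\<close>

lemma mon_span_mons: "mon_span (mons d) = filt d"
proof
  show "mon_span (mons d) \<subseteq> filt d"
    using mon_max_pow set_smultI unfolding filt_eq
    by (intro mon_span_least set_smult_submodule max_pow_subset) (auto simp: multisets_of_size_def)
  show "filt d \<subseteq> mon_span (mons d)"
  proof (induction d)
    case 0
    have "y \<in> mon_span (mons 0)" if "y \<in> carrier M" for y
      using mon_spanI[of "{#}" "mons 0" y] that by (simp add: mon_empty multisets_of_size_def)
    then show ?case by (auto simp: filt_0)
  next
    case (Suc d)
    show ?case unfolding filt_eq
    proof (rule set_smult_least[OF _ mon_span_submodule])
      fix a y assume a: "a \<in> max_pow (Suc d)" and y: "y \<in> carrier M"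
      let ?J = "{q \<in> carrier R. q \<odot>\<^bsub>M\<^esub> y \<in> mon_span (mons (Suc d))}"
      have J: "ideal ?J R" by (intro ideal_transporter mon_span_submodule y)
      have "max_pow (Suc d) \<subseteq> ?J"
      proof
        fix a assume "a \<in> max_pow (Suc d)"
        then have "a \<in> ideal_prod R (max_pow d) \<mm>" by (simp add: max_pow_Suc)
        \<comment> \<open>Induction over the sums of products that make up \<mm>^d \<mm>: the outer
          hypothesis treats the factor in \<mm>^d.\<close>
        then show "a \<in> ?J"
        proof (induction a rule: ideal_prod.induct)
          case (prod p q)
          have c: "p \<in> carrier R" "q \<in> carrier R" using prod max_pow_subset max_subset by auto
          have "p \<odot>\<^bsub>M\<^esub> y \<in> mon_span (mons d)"
            using Suc set_smultI[OF prod(1) y] by (auto simp: filt_eq)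
          from max_smult_mon_span[OF prod(2) this] show ?case
            using c y by (simp add: smult_assoc1 m_comm[of p q])
        next
          case (sum s1 s2) then show ?case
            using additive_subgroup.a_closed[OF ideal.axioms(1)[OF J]] by blast
        qed
      qed
      then show "a \<odot>\<^bsub>M\<^esub> y \<in> mon_span (mons (Suc d))" using a by auto
    qed
  qed
qed

section \<open>Leading-coefficient modules and essential monomials\<close>

definition below :: "nat multiset \<Rightarrow> nat multiset set" where
  "below \<beta> = {\<gamma> \<in> mons (size \<beta>). \<gamma> < \<beta>}"

text \<open>The possible leading coefficients at the monomial \<open>\<beta>\<close> of expressions of elements of \<open>N\<close>
  as homogeneous polynomials in the generators of the maximal ideal.\<close>

definition lead :: "nat multiset \<Rightarrow> 'c set" where
  "lead \<beta> = {a \<in> carrier M. mon \<beta> \<odot>\<^bsub>M\<^esub> a \<in> N <+>\<^bsub>M\<^esub> mon_span (below \<beta>)}"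

lemma lead_submodule: "submodule (lead \<beta>) R M"
  unfolding lead_def by (intro submodule_smult_vimage submodule_set_add N mon_span_submodule) simp

lemma below_add:
  "\<lbrakk>\<delta> \<in> below \<alpha>; set_mset \<gamma> \<subseteq> {..<r}\<rbrakk> \<Longrightarrow> \<delta> + \<gamma> \<in> below (\<alpha> + \<gamma>)"
  by (auto simp: below_def multisets_of_size_def)

text \<open>Multiplication by the monomial of \<beta> - \<alpha> preserves \<open>N\<close> and, the
  order being compatible with sums, moves terms below \<alpha> to terms below \<beta>.\<close>

lemma lead_mono:
  assumes "\<alpha> \<subseteq># \<beta>" "set_mset \<beta> \<subseteq> {..<r}"
  shows "lead \<alpha> \<subseteq> lead \<beta>"
proof
  fix a assume "a \<in> lead \<alpha>"
  then have a: "a \<in> carrier M" "mon \<alpha> \<odot>\<^bsub>M\<^esub> a \<in> N <+>\<^bsub>M\<^esub> mon_span (below \<alpha>)" by (auto simp: lead_def)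
  obtain \<gamma> where \<gamma>: "\<beta> = \<alpha> + \<gamma>" using assms(1) by (metis mset_subset_eq_exists_conv)
  obtain n w where nw: "n \<in> N" "w \<in> mon_span (below \<alpha>)" "mon \<alpha> \<odot>\<^bsub>M\<^esub> a = n \<oplus>\<^bsub>M\<^esub> w"
    using a(2) by (rule set_addE)
  have c: "n \<in> carrier M" "w \<in> carrier M"
    using nw submodule_carr[OF N] submodule_carr[OF mon_span_submodule] by auto
  have "mon \<beta> \<odot>\<^bsub>M\<^esub> a = mon \<gamma> \<odot>\<^bsub>M\<^esub> (mon \<alpha> \<odot>\<^bsub>M\<^esub> a)"
    using a(1) by (simp add: \<gamma> mon_add m_comm flip: smult_assoc1)
  also have "\<dots> = mon \<gamma> \<odot>\<^bsub>M\<^esub> n \<oplus>\<^bsub>M\<^esub> mon \<gamma> \<odot>\<^bsub>M\<^esub> w" using nw c by (simp add: smult_r_distr)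
  also have "\<dots> \<in> N <+>\<^bsub>M\<^esub> mon_span (below \<beta>)"
  proof (rule set_addI)
    show "mon \<gamma> \<odot>\<^bsub>M\<^esub> n \<in> N" using submodule_smult[OF N _ nw(1)] by simp
    show "mon \<gamma> \<odot>\<^bsub>M\<^esub> w \<in> mon_span (below \<beta>)"
      unfolding \<gamma> by (rule mon_smult_mon_span[OF below_add nw(2)]) (use \<gamma> assms(2) in auto)
  qed
  finally show "a \<in> lead \<beta>" using a(1) by (simp add: lead_def)
qed

text \<open>The analogue of the minimal generators of an initial ideal. By \<open>lead_mono\<close>
  the failing inclusion means that the coefficient module grows strictly on passing from each
  immediate divisor to \<beta>.\<close>

definition essential :: "nat multiset set" where
  "essential = {\<beta>. set_mset \<beta> \<subseteq> {..<r} \<and> (\<forall>i. i \<in># \<beta> \<longrightarrow> \<not> lead \<beta> \<subseteq> lead (\<beta> - {#i#}))}"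

text \<open>Infinitely many essential monomials would contain a sequence ascending for divisibility,
  along which \<open>lead\<close> stabilizes at some step from \<alpha> to \<beta>. Any variable of
  \<beta> - \<alpha> then gives a divisor of \<beta> between the two, with the same coefficient
  module as \<beta>.\<close>

lemma finite_essential: "finite essential"
proof (rule ccontr)
  assume "infinite essential"
  then obtain b :: "nat \<Rightarrow> nat multiset" where b: "inj b" "range b \<subseteq> essential"
    using infinite_countable_subset by blast
  obtain g :: "nat \<Rightarrow> nat" where g: "strict_mono g" "\<And>i. i < r \<Longrightarrow> incseq (\<lambda>n. count (b (g n)) i)"
    using Dickson_subseq[of r "\<lambda>n. count (b n)"] by blast
  have ess: "set_mset (b n) \<subseteq> {..<r}" for n using b(2) by (auto simp: essential_def)
  have sub: "b (g n) \<subseteq># b (g (Suc n))" for n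
  proof (rule mset_subset_eqI)
    fix i show "count (b (g n)) i \<le> count (b (g (Suc n))) i"
    proof (cases "i < r")
      case True then show ?thesis using g(2)[OF True] by (auto simp: incseq_def)
    next
      case False then have "i \<notin># b (g n)" using ess[of "g n"] by auto
      then show ?thesis by (simp add: not_in_iff)
    qed
  qed
  have "\<exists>n. lead (b (g (Suc n))) = lead (b (g n))"
    by (rule submodule_chain_stable[of "\<lambda>n. lead (b (g n))"]) (auto intro: lead_submodule lead_mono[OF sub ess, THEN subsetD])
  then obtain n where n: "lead (b (g (Suc n))) = lead (b (g n))" by blast
  let ?\<alpha> = "b (g n)" and ?\<beta> = "b (g (Suc n))"
  have "?\<alpha> \<noteq> ?\<beta>" using b(1) strict_mono_eq[OF g(1), of n "Suc n"] by (auto simp: inj_eq)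
  with sub[of n] have "?\<beta> - ?\<alpha> \<noteq> {#}" by (metis subset_mset.diff_add add_0)
  then obtain i where i: "i \<in># ?\<beta> - ?\<alpha>" by auto
  then have ib: "i \<in># ?\<beta>" by (meson in_diffD)
  have "?\<alpha> \<subseteq># ?\<beta> - {#i#}"
  proof (rule mset_subset_eqI)
    fix j show "count ?\<alpha> j \<le> count (?\<beta> - {#i#}) j"
      using i mset_subset_eq_count[OF sub[of n], of j] by (cases "j = i") (auto simp: in_diff_count)
  qed
  then have "lead ?\<alpha> \<subseteq> lead (?\<beta> - {#i#})" by (rule lead_mono) (use ess in_diffD in fastforce)
  then have "lead ?\<beta> \<subseteq> lead (?\<beta> - {#i#})" using n by simp
  moreover have "?\<beta> \<in> essential" using b(2) by auto
  ultimately show False using ib by (auto simp: essential_def)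
qed

text \<open>Division by leading terms, by induction on the leading monomial. Since \<beta> is not
  essential, the leading coefficient of \<open>f\<close> already occurs at \<beta> - {i} for some i,
  on an element \<open>n\<close> of N \<inter> \<mm>^j M; subtracting \<open>x i\<close> times
  \<open>n\<close> lowers the leading monomial.\<close>

lemma inessential_reduction:
  assumes ess: "\<And>\<beta>. \<beta> \<in> essential \<Longrightarrow> size \<beta> \<le> j"
    and "\<beta> \<in> mons (Suc j)" "f \<in> N" "f \<in> mon_span (insert \<beta> (below \<beta>))"
  shows "f \<in> set_smult \<mm> (N \<inter> filt j)"
  using assms(2-)
proof (induction \<beta> arbitrary: f rule: less_induct)
  case (less \<beta>)
  let ?J = "set_smult \<mm> (N \<inter> filt j)"
  have J: "submodule ?J R M"
    using max_subset submodule_subset[OF N] by (intro set_smult_submodule) auto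
  have size: "size \<beta> = Suc j" and set: "set_mset \<beta> \<subseteq> {..<r}"
    using less.prems by (auto simp: multisets_of_size_def)
  have "\<beta> \<notin> essential" using ess size by force
  then obtain i where i: "i \<in># \<beta>" "lead \<beta> \<subseteq> lead (\<beta> - {#i#})" using set by (auto simp: essential_def)
  let ?\<alpha> = "\<beta> - {#i#}"
  have ir: "i < r" using i set by auto
  have \<beta>: "\<beta> = ?\<alpha> + {#i#}" using i by simp
  have sa: "size ?\<alpha> = j" using size i by (simp add: size_Diff_singleton)
  have seta: "set_mset ?\<alpha> \<subseteq> {..<r}" using set in_diffD by fastforce
  note spb = mon_span_submodule[of "below \<beta>"]
  note spa = mon_span_submodule[of "below ?\<alpha>"]
  \<comment> \<open>All multiples of \<open>mon \<beta>\<close> are gathered in one summand, whose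
    coefficient \<open>a\<close> is the leading coefficient of \<open>f\<close>.\<close>
  have "mon_span (insert \<beta> (below \<beta>)) \<subseteq> {y. \<exists>a\<in>carrier M. \<exists>w\<in>mon_span (below \<beta>). y = mon \<beta> \<odot>\<^bsub>M\<^esub> a \<oplus>\<^bsub>M\<^esub> w}"
  proof -
    have "submodule {mon \<beta> \<odot>\<^bsub>M\<^esub> a | a. a \<in> carrier M} R M" (is "submodule ?A R M")
    proof (rule submoduleI)
      show "\<zero>\<^bsub>M\<^esub> \<in> ?A" by (auto intro!: exI[of _ "\<zero>\<^bsub>M\<^esub>"])
      show "?A \<subseteq> carrier M" by auto
      show "\<ominus>\<^bsub>M\<^esub> y \<in> ?A" if "y \<in> ?A" for y using that by (auto simp flip: smult_r_minus)
      show "y \<oplus>\<^bsub>M\<^esub> z \<in> ?A" if "y \<in> ?A" "z \<in> ?A" for y z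
        using that by (auto simp flip: smult_r_distr)
      show "q \<odot>\<^bsub>M\<^esub> y \<in> ?A" if q: "q \<in> carrier R" and y: "y \<in> ?A" for q y
      proof -
        obtain a where a: "a \<in> carrier M" "y = mon \<beta> \<odot>\<^bsub>M\<^esub> a" using y by auto
        then have "q \<odot>\<^bsub>M\<^esub> y = mon \<beta> \<odot>\<^bsub>M\<^esub> (q \<odot>\<^bsub>M\<^esub> a)" using q by (simp add: m_comm flip: smult_assoc1)
        then show ?thesis using a q by auto
      qed
    qed
    note A = this
    have "mon_span (insert \<beta> (below \<beta>)) \<subseteq> ?A <+>\<^bsub>M\<^esub> mon_span (below \<beta>)"
      using set_add_upper[OF A spb] by (intro mon_span_least submodule_set_add A spb) (auto intro: mon_spanI)
    then show ?thesis by (force elim!: set_addE)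
  qed
  then obtain a w where aw: "a \<in> carrier M" "w \<in> mon_span (below \<beta>)" "f = mon \<beta> \<odot>\<^bsub>M\<^esub> a \<oplus>\<^bsub>M\<^esub> w"
    using less.prems by blast
  have wc: "w \<in> carrier M" using submodule_carr[OF spb aw(2)] .
  have fc: "f \<in> carrier M" using submodule_carr[OF N] less.prems by auto
  have "mon \<beta> \<odot>\<^bsub>M\<^esub> a = f \<oplus>\<^bsub>M\<^esub> \<ominus>\<^bsub>M\<^esub> w" using aw wc by (simp add: M.a_assoc M.r_neg)
  then have "a \<in> lead \<beta>"
    using aw(1) set_addI[OF less.prems(2) submodule_minus[OF spb aw(2)]] by (simp add: lead_def)
  then have "a \<in> lead ?\<alpha>" using i by auto
  then have "mon ?\<alpha> \<odot>\<^bsub>M\<^esub> a \<in> N <+>\<^bsub>M\<^esub> mon_span (below ?\<alpha>)" by (simp add: lead_def)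
  then obtain n v where nv: "n \<in> N" "v \<in> mon_span (below ?\<alpha>)" "mon ?\<alpha> \<odot>\<^bsub>M\<^esub> a = n \<oplus>\<^bsub>M\<^esub> v"
    by (rule set_addE)
  have nc: "n \<in> carrier M" "v \<in> carrier M" using nv submodule_carr[OF N] submodule_carr[OF spa] by auto
  have "mon_span (below ?\<alpha>) \<subseteq> filt j"
    unfolding mon_span_mons[symmetric] by (rule mon_span_mono) (auto simp: below_def sa)
  then have "v \<in> filt j" using nv by auto
  moreover have "mon ?\<alpha> \<odot>\<^bsub>M\<^esub> a \<in> filt j"
    unfolding mon_span_mons[symmetric] using aw(1) sa seta
    by (intro mon_spanI) (auto simp: multisets_of_size_def)
  moreover have "n = mon ?\<alpha> \<odot>\<^bsub>M\<^esub> a \<ominus>\<^bsub>M\<^esub> v"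
    unfolding nv(3) using nc by (simp add: M.minus_eq M.a_assoc M.r_neg)
  ultimately have "n \<in> filt j" using submodule_diff[OF filt_submodule] by simp
  have xm: "x i \<in> \<mm>" using ir gens_closed genideal_self[of "x ` {..<r}"] by (auto simp: gens)
  have xc: "x i \<in> carrier R" using ir gens_closed by auto
  \<comment> \<open>The element of \<mm>(N \<inter> \<mm>^j M) that cancels the leading term of
    \<open>f\<close>.\<close>
  let ?g = "x i \<odot>\<^bsub>M\<^esub> n"
  have g: "?g \<in> ?J" using xm nv(1) \<open>n \<in> filt j\<close> by (intro set_smultI) auto
  have gN: "?g \<in> N" using submodule_smult[OF N xc nv(1)] .
  have xv: "x i \<odot>\<^bsub>M\<^esub> v \<in> mon_span (below \<beta>)"
  proof -
    have "mon {#i#} \<odot>\<^bsub>M\<^esub> v \<in> mon_span (below (?\<alpha> + {#i#}))"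
      using ir by (intro mon_smult_mon_span[OF below_add nv(2)]) auto
    then show ?thesis using mon_single[OF ir] \<beta>[symmetric] by simp
  qed
  have "mon \<beta> = x i \<otimes> mon ?\<alpha>"
    using mon_add[of ?\<alpha> "{#i#}"] mon_single[OF ir] \<beta>[symmetric] xc by (simp add: m_comm)
  then have "mon \<beta> \<odot>\<^bsub>M\<^esub> a = x i \<odot>\<^bsub>M\<^esub> (n \<oplus>\<^bsub>M\<^esub> v)" using xc aw(1) nv(3) by (simp add: smult_assoc1)
  also have "\<dots> = ?g \<oplus>\<^bsub>M\<^esub> x i \<odot>\<^bsub>M\<^esub> v" using xc nc by (simp add: smult_r_distr)
  finally have f: "f = ?g \<oplus>\<^bsub>M\<^esub> (x i \<odot>\<^bsub>M\<^esub> v \<oplus>\<^bsub>M\<^esub> w)" using aw(3) xc nc wc by (simp add: M.a_assoc)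
  let ?h = "x i \<odot>\<^bsub>M\<^esub> v \<oplus>\<^bsub>M\<^esub> w"
  have h: "?h \<in> mon_span (below \<beta>)" using submodule_add[OF spb xv aw(2)] .
  have hN: "?h \<in> N"
    using submodule_add_cancel[OF N gN submodule_carr[OF spb h]] f less.prems(2) by simp
  have "?h \<in> ?J"
  proof (cases "below \<beta> = {}")
    case True then show ?thesis using h submodule_zero[OF J] by (simp add: mon_span_empty)
  next
    case False
    have fin: "finite (below \<beta>)" using finite_mons by (auto simp: below_def)
    \<comment> \<open>The order is total on the finite set \<open>below \<beta>\<close>, so its
      maximum bounds the leading monomial of the remainder and the induction hypothesis applies
      there.\<close>
    let ?\<delta> = "Max (below \<beta>)"
    have \<delta>: "?\<delta> \<in> below \<beta>" using Max_in[OF fin False] .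
    then have d: "?\<delta> < \<beta>" "?\<delta> \<in> mons (Suc j)" using size by (auto simp: below_def)
    have sd: "size ?\<delta> = size \<beta>" using d size by (auto simp: multisets_of_size_def)
    have "below \<beta> \<subseteq> insert ?\<delta> (below ?\<delta>)"
    proof
      fix \<gamma> assume \<gamma>: "\<gamma> \<in> below \<beta>"
      then have "\<gamma> \<le> ?\<delta>" using fin by simp
      then show "\<gamma> \<in> insert ?\<delta> (below ?\<delta>)" using \<gamma> sd by (auto simp: below_def)
    qed
    then have "?h \<in> mon_span (insert ?\<delta> (below ?\<delta>))" using h mon_span_mono by blast
    then show ?thesis using less.IH[OF d(1) d(2) hN] by simp
  qed
  then show ?case unfolding f by (rule submodule_add[OF J g])
qed

lemma Artin_Rees_mons: "\<exists>c. \<forall>j\<ge>c. N \<inter> filt (Suc j) \<subseteq> set_smult \<mm> (N \<inter> filt j)"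
proof (intro exI allI impI subsetI)
  \<comment> \<open>The bound c is fixed here as the largest degree of an essential monomial; the
    added 0 guards \<open>Max\<close> against an empty set.\<close>
  fix j f assume j: "j \<ge> Max (insert 0 (size ` essential))" and f: "f \<in> N \<inter> filt (Suc j)"
  have ess: "size \<beta> \<le> j" if "\<beta> \<in> essential" for \<beta>
    using that j finite_essential by (simp add: Max_ge_iff)
  have f': "f \<in> mon_span (mons (Suc j))" using f by (simp add: mon_span_mons)
  have J: "submodule (set_smult \<mm> (N \<inter> filt j)) R M"
    using max_subset submodule_subset[OF N] by (intro set_smult_submodule) auto
  show "f \<in> set_smult \<mm> (N \<inter> filt j)"
  proof (cases "mons (Suc j) = {}")
    \<comment> \<open>This happens only when the chosen family of generators of \<mm> is
      empty.\<close>
    case True then show ?thesis using f' submodule_zero[OF J] by (simp add: mon_span_empty)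
  next
    case False
    let ?\<delta> = "Max (mons (Suc j))"
    have d: "?\<delta> \<in> mons (Suc j)" using Max_in[OF finite_mons False] .
    then have sd: "size ?\<delta> = Suc j" by (simp add: multisets_of_size_def)
    have "mons (Suc j) \<subseteq> insert ?\<delta> (below ?\<delta>)"
    proof
      fix \<gamma> assume \<gamma>: "\<gamma> \<in> mons (Suc j)"
      then have "\<gamma> \<le> ?\<delta>" using finite_mons by simp
      then show "\<gamma> \<in> insert ?\<delta> (below ?\<delta>)" using \<gamma> sd by (auto simp: below_def)
    qed
    then have "f \<in> mon_span (insert ?\<delta> (below ?\<delta>))" using f' mon_span_mono by blast
    then show ?thesis using inessential_reduction[OF ess d] f by auto
  qed
qed

end

section \<open>The Artin--Rees lemma and Krull's intersection theorem\<close>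

context fg_local_module
begin

theorem Artin_Rees:
  assumes N: "submodule N R M"
  shows "\<exists>c. \<forall>j\<ge>c. N \<inter> filt (Suc j) \<subseteq> set_smult \<mm> (N \<inter> filt j)"
proof -
  obtain A where A: "A \<subseteq> carrier R" "finite A" "\<mm> = Idl A" using finetely_gen[OF ideal_max] by auto
  obtain r and x :: "nat \<Rightarrow> 'a" where x: "A = x ` {i. i < r}"
    using finite_imp_nat_seg_image_inj_on[OF A(2)] by blast
  interpret monomial_module R \<mm> M x r N
    using A x N
    by (intro monomial_module.intro fg_local_module_axioms monomial_module_axioms.intro)
      (auto simp: lessThan_def)
  show ?thesis by (rule Artin_Rees_mons)
qed

text \<open>Every degree above c yields one factor \<mm>, so the same constant works for all
  j.\<close>

corollary Artin_Rees_weak: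
  assumes N: "submodule N R M"
  shows "\<exists>c. \<forall>j. N \<inter> filt (c + j) \<subseteq> set_smult (max_pow j) N"
proof -
  have NM: "N \<subseteq> carrier M" by (rule submodule_subset[OF N])
  obtain c where c: "\<And>j. j \<ge> c \<Longrightarrow> N \<inter> filt (Suc j) \<subseteq> set_smult \<mm> (N \<inter> filt j)"
    using Artin_Rees[OF N] by blast
  have "N \<inter> filt (c + j) \<subseteq> set_smult (max_pow j) N" for j
  proof (induction j)
    case 0
    have "y \<in> set_smult (carrier R) N" if "y \<in> N" for y
      using set_smultI[of \<one> "carrier R" y N] that NM by auto
    then show ?case by (auto simp: max_pow_0)
  next
    case (Suc j)
    have "N \<inter> filt (c + Suc j) \<subseteq> set_smult \<mm> (N \<inter> filt (c + j))" using c[of "c + j"] by simp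
    also have "\<dots> \<subseteq> set_smult \<mm> (set_smult (max_pow j) N)" using Suc by (intro set_smult_mono) auto
    also have "\<dots> \<subseteq> set_smult (max_pow (1 + j)) N"
      using set_smult_max_pow[OF NM, of 1 j] by (simp add: max_pow_1)
    finally show ?case by simp
  qed
  then show ?thesis by blast
qed

text \<open>The intersection L lies in every \<mm>^i M, so Artin--Rees for L itself with j = 1 gives
  L \<subseteq> \<mm> L, and Nakayama's lemma finishes.\<close>

theorem Krull_intersection: "(\<Inter>i. filt i) = {\<zero>\<^bsub>M\<^esub>}"
proof -
  let ?L = "\<Inter>i. filt i"
  have L: "submodule ?L R M" by (rule submodule_Inter) (auto intro: filt_submodule)
  obtain c where c: "\<And>j. ?L \<inter> filt (c + j) \<subseteq> set_smult (max_pow j) ?L" using Artin_Rees_weak[OF L] by blast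
  have "?L \<subseteq> set_smult \<mm> ?L" using c[of 1] by (auto simp: max_pow_1)
  also have "\<dots> \<subseteq> {\<zero>\<^bsub>M\<^esub>} <+>\<^bsub>M\<^esub> set_smult \<mm> ?L"
    using max_subset submodule_subset[OF L]
    by (intro set_add_upper submodule_zero_set set_smult_submodule) auto
  finally show ?thesis
    using Nakayama[OF L fin_gen_submodule[OF L] submodule_zero_set] submodule_zero[OF L] by blast
qed

end

section \<open>Filtered groups\<close>

text \<open>Common frame for the powers of \<mm> in R, the \<mm>-adic filtration of a module and,
  later, that of \<open>N\<close>.\<close>

locale filtered_group = abelian_group G for G (structure) +
  fixes E :: "nat \<Rightarrow> 'a set"
  assumes filtered_subgroup: "subgroup (E i) (add_monoid G)"
    and filtered_Suc: "E (Suc i) \<subseteq> E i"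
begin

lemma E_subset: "E i \<subseteq> carrier G"
  using subgroup.subset[OF filtered_subgroup] by simp

lemma E_carr: "x \<in> E i \<Longrightarrow> x \<in> carrier G"
  using E_subset by blast

lemma E_add: "\<lbrakk>x \<in> E i; y \<in> E i\<rbrakk> \<Longrightarrow> x \<oplus> y \<in> E i"
  using subgroup.m_closed[OF filtered_subgroup] by simp

lemma E_zero: "\<zero> \<in> E i"
  using subgroup.one_closed[OF filtered_subgroup] by simp

lemma E_minus: "x \<in> E i \<Longrightarrow> \<ominus> x \<in> E i"
  using subgroup.m_inv_closed[OF filtered_subgroup] by (simp add: a_inv_def)

lemma E_abelian_subgroup: "abelian_subgroup (E i) G"
  by (rule abelian_subgroupI3) (auto intro: additive_subgroup.intro filtered_subgroup abelian_group_axioms)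

lemma coset_eq_iff:
  assumes "x \<in> carrier G" "y \<in> carrier G"
  shows "E i +> x = E i +> y \<longleftrightarrow> x \<ominus> y \<in> E i"
proof
  assume "E i +> x = E i +> y"
  then have "E i +> (x \<oplus> \<ominus> y) = E i" using a_coset_add_inv2 assms E_subset by simp
  then show "x \<ominus> y \<in> E i" using a_coset_join1[OF _ _ filtered_subgroup] assms by (simp add: a_minus_def)
next
  assume "x \<ominus> y \<in> E i"
  then have "E i +> (x \<oplus> \<ominus> y) = E i" using a_coset_join2[OF _ filtered_subgroup] assms by (simp add: a_minus_def)
  then show "E i +> x = E i +> y" using a_coset_add_inv1 assms E_subset by simp
qed

lemma coset_eq_self_iff: "x \<in> carrier G \<Longrightarrow> E i +> x = E i \<longleftrightarrow> x \<in> E i"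
  using a_coset_join1[OF _ _ filtered_subgroup] a_coset_join2[OF _ filtered_subgroup] by blast

lemma coset_zero: "E i +> \<zero> = E i"
  using E_subset by simp

lemma carrier_gr_piece: "carrier (gr_piece G E i) = (\<lambda>x. E (Suc i) +> x) ` E i"
  by (auto simp: gr_piece_def A_FactGroup_def' A_RCOSETS_def' a_r_coset_def r_coset_def)

lemma one_gr_piece: "\<one>\<^bsub>gr_piece G E i\<^esub> = E (Suc i)"
  by (simp add: gr_piece_def A_FactGroup_def')

lemma mult_gr_piece_set: "A \<otimes>\<^bsub>gr_piece G E i\<^esub> B = A <+> B"
  by (simp add: gr_piece_def A_FactGroup_def' set_add_def set_mult_def)

lemma mult_gr_piece:
  "\<lbrakk>x \<in> carrier G; y \<in> carrier G\<rbrakk> \<Longrightarrow>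
   (E (Suc i) +> x) \<otimes>\<^bsub>gr_piece G E i\<^esub> (E (Suc i) +> y) = E (Suc i) +> (x \<oplus> y)"
  unfolding mult_gr_piece_set by (rule abelian_subgroup.a_rcos_sum[OF E_abelian_subgroup])

lemma comm_group_gr_piece: "comm_group (gr_piece G E i)"
proof (rule comm_groupI)
  fix x y assume "x \<in> carrier (gr_piece G E i)" "y \<in> carrier (gr_piece G E i)"
  then obtain a b where ab: "a \<in> E i" "b \<in> E i" "x = E (Suc i) +> a" "y = E (Suc i) +> b"
    by (auto simp: carrier_gr_piece)
  then show "x \<otimes>\<^bsub>gr_piece G E i\<^esub> y \<in> carrier (gr_piece G E i)"
    and "x \<otimes>\<^bsub>gr_piece G E i\<^esub> y = y \<otimes>\<^bsub>gr_piece G E i\<^esub> x"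
    by (auto simp: mult_gr_piece E_carr a_comm carrier_gr_piece intro: E_add)
  fix z assume "z \<in> carrier (gr_piece G E i)"
  then obtain c where c: "c \<in> E i" "z = E (Suc i) +> c" by (auto simp: carrier_gr_piece)
  then show "x \<otimes>\<^bsub>gr_piece G E i\<^esub> y \<otimes>\<^bsub>gr_piece G E i\<^esub> z = x \<otimes>\<^bsub>gr_piece G E i\<^esub> (y \<otimes>\<^bsub>gr_piece G E i\<^esub> z)"
    using ab by (simp add: mult_gr_piece E_carr a_assoc)
next
  show "\<one>\<^bsub>gr_piece G E i\<^esub> \<in> carrier (gr_piece G E i)"
    using E_zero coset_zero by (auto simp: carrier_gr_piece one_gr_piece intro!: image_eqI[of _ _ \<zero>])
  fix x assume "x \<in> carrier (gr_piece G E i)"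
  then obtain a where a: "a \<in> E i" "x = E (Suc i) +> a" by (auto simp: carrier_gr_piece)
  have one: "\<one>\<^bsub>gr_piece G E i\<^esub> = E (Suc i) +> \<zero>" by (simp only: one_gr_piece coset_zero)
  show "\<one>\<^bsub>gr_piece G E i\<^esub> \<otimes>\<^bsub>gr_piece G E i\<^esub> x = x"
    unfolding one using a mult_gr_piece[of \<zero> a i] by (simp add: E_carr del: a_coset_add_zero)
  show "\<exists>y\<in>carrier (gr_piece G E i). y \<otimes>\<^bsub>gr_piece G E i\<^esub> x = \<one>\<^bsub>gr_piece G E i\<^esub>"
    unfolding one using a mult_gr_piece[of "\<ominus> a" a i] E_minus[OF a(1)]
    by (intro bexI[of _ "E (Suc i) +> \<ominus> a"]) (auto simp: E_carr l_neg carrier_gr_piece)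
qed

lemma group_gr_piece: "group (gr_piece G E i)"
  using comm_group_gr_piece by (rule comm_group.axioms(2))

lemma finprod_gr_piece:
  assumes "finite I" "f \<in> I \<rightarrow> E i"
  shows "(\<Otimes>\<^bsub>gr_piece G E i\<^esub>k\<in>I. E (Suc i) +> f k) = E (Suc i) +> (\<Oplus>k\<in>I. f k)"
  using assms
proof (induction I rule: finite_induct)
  case empty
  then show ?case using coset_zero by (simp add: comm_monoid.finprod_empty[OF comm_group.axioms(1)[OF comm_group_gr_piece]] one_gr_piece)
next
  case (insert k I)
  interpret P: comm_group "gr_piece G E i" by (rule comm_group_gr_piece)
  have c: "f k \<in> carrier G" "(\<Oplus>k\<in>I. f k) \<in> carrier G"
    using insert.prems E_subset by (auto intro!: finsum_closed)
  have "(\<Otimes>\<^bsub>gr_piece G E i\<^esub>k\<in>insert k I. E (Suc i) +> f k)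
      = (E (Suc i) +> f k) \<otimes>\<^bsub>gr_piece G E i\<^esub> (\<Otimes>\<^bsub>gr_piece G E i\<^esub>k\<in>I. E (Suc i) +> f k)"
    using insert by (intro P.finprod_insert) (auto simp: carrier_gr_piece)
  also have "\<dots> = E (Suc i) +> (f k \<oplus> (\<Oplus>k\<in>I. f k))"
    using insert c by (subst insert.IH) (auto intro!: mult_gr_piece)
  also have "f k \<oplus> (\<Oplus>k\<in>I. f k) = (\<Oplus>k\<in>insert k I. f k)"
    using insert by (intro finsum_insert[symmetric]) (auto intro!: E_carr)
  finally show ?case .
qed

definition gr_class :: "(nat \<Rightarrow> 'a) \<Rightarrow> nat \<Rightarrow> 'a set" where
  "gr_class x = (\<lambda>i. E (Suc i) +> x i)"

text \<open>The family \<open>D\<close> may be smaller than the filtration, which is how graded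
  submodules are described later. Finite support is demanded of the representatives
  themselves.\<close>

definition gr_reps :: "(nat \<Rightarrow> 'a set) \<Rightarrow> (nat \<Rightarrow> 'a) set" where
  "gr_reps D = {x. (\<forall>i. x i \<in> D i) \<and> finite {i. x i \<noteq> \<zero>}}"

lemma gr_repsD: "x \<in> gr_reps D \<Longrightarrow> x i \<in> D i"
  by (auto simp: gr_reps_def)

text \<open>Choosing the representative 0 wherever the coset is trivial turns finite support of the
  cosets into finite support of the representatives.\<close>

lemma carrier_gr_group: "carrier (gr_group G E) = gr_class ` gr_reps E"
proof (intro equalityI subsetI)
  fix \<xi> assume "\<xi> \<in> carrier (gr_group G E)"
  then have \<xi>: "\<And>i. \<xi> i \<in> (\<lambda>x. E (Suc i) +> x) ` E i" "finite {i. \<xi> i \<noteq> E (Suc i)}"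
    by (auto simp: carrier_sum_group[OF group_gr_piece] one_gr_piece carrier_gr_piece PiE_iff)
  have "\<exists>x. x \<in> E i \<and> \<xi> i = E (Suc i) +> x \<and> (\<xi> i = E (Suc i) \<longrightarrow> x = \<zero>)" for i
    using \<xi>(1)[of i] E_zero[of i] coset_zero[of "Suc i"] by (cases "\<xi> i = E (Suc i)") auto
  then obtain x where x: "\<And>i. x i \<in> E i" "\<And>i. \<xi> i = E (Suc i) +> x i" "\<And>i. \<xi> i = E (Suc i) \<Longrightarrow> x i = \<zero>"
    by metis
  have "{i. x i \<noteq> \<zero>} \<subseteq> {i. \<xi> i \<noteq> E (Suc i)}" using x(3) by auto
  then have "x \<in> gr_reps E" using x(1) \<xi>(2) finite_subset by (auto simp: gr_reps_def)
  moreover have "\<xi> = gr_class x" using x(2) by (auto simp: gr_class_def)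
  ultimately show "\<xi> \<in> gr_class ` gr_reps E" by blast
next
  fix \<xi> assume "\<xi> \<in> gr_class ` gr_reps E"
  then obtain x where x: "\<xi> = gr_class x" "\<And>i. x i \<in> E i" "finite {i. x i \<noteq> \<zero>}" by (auto simp: gr_reps_def)
  have "{i. gr_class x i \<noteq> E (Suc i)} \<subseteq> {i. x i \<noteq> \<zero>}" using coset_zero by (auto simp: gr_class_def)
  then have "finite {i. gr_class x i \<noteq> E (Suc i)}" using x(3) finite_subset by blast
  then show "\<xi> \<in> carrier (gr_group G E)"
    using x by (auto simp: carrier_sum_group[OF group_gr_piece] one_gr_piece carrier_gr_piece PiE_iff gr_class_def)
qed

lemma gr_class_eq_iff:
  "\<lbrakk>\<And>i. x i \<in> carrier G; \<And>i. y i \<in> carrier G\<rbrakk> \<Longrightarrow>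
   gr_class x = gr_class y \<longleftrightarrow> (\<forall>i. x i \<ominus> y i \<in> E (Suc i))"
  by (simp add: gr_class_def fun_eq_iff coset_eq_iff)

lemma group_gr_group: "group (gr_group G E)"
  by (simp add: group_gr_piece)

lemma mult_gr_group:
  "\<lbrakk>\<And>i. x i \<in> carrier G; \<And>i. y i \<in> carrier G\<rbrakk> \<Longrightarrow>
   gr_class x \<otimes>\<^bsub>gr_group G E\<^esub> gr_class y = gr_class (\<lambda>i. x i \<oplus> y i)"
  by (auto simp: gr_class_def mult_gr_piece fun_eq_iff)

lemma one_gr_group: "\<one>\<^bsub>gr_group G E\<^esub> = gr_class (\<lambda>_. \<zero>)"
  using coset_zero by (auto simp: gr_class_def one_gr_piece)

lemma gr_reps_zero: "(\<And>i. \<zero> \<in> D i) \<Longrightarrow> (\<lambda>_. \<zero>) \<in> gr_reps D"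
  by (simp add: gr_reps_def)

lemma gr_reps_add:
  assumes "\<And>i x y. \<lbrakk>x \<in> D i; y \<in> D i\<rbrakk> \<Longrightarrow> x \<oplus> y \<in> D i" "x \<in> gr_reps D" "y \<in> gr_reps D"
  shows "(\<lambda>i. x i \<oplus> y i) \<in> gr_reps D"
proof -
  have "{i. x i \<oplus> y i \<noteq> \<zero>} \<subseteq> {i. x i \<noteq> \<zero>} \<union> {i. y i \<noteq> \<zero>}" by auto
  then show ?thesis using assms finite_subset by (fastforce simp: gr_reps_def)
qed

lemma gr_reps_minus:
  assumes "\<And>i x. x \<in> D i \<Longrightarrow> \<ominus> x \<in> D i" "x \<in> gr_reps D"
  shows "(\<lambda>i. \<ominus> x i) \<in> gr_reps D"
proof -
  have "{i. \<ominus> x i \<noteq> \<zero>} \<subseteq> {i. x i \<noteq> \<zero>}" by auto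
  then show ?thesis using assms finite_subset by (fastforce simp: gr_reps_def)
qed

lemma inv_gr_group:
  assumes "x \<in> gr_reps E" shows "inv\<^bsub>gr_group G E\<^esub> (gr_class x) = gr_class (\<lambda>i. \<ominus> x i)"
proof (rule group.inv_equality[OF group_gr_group])
  have c: "x i \<in> carrier G" for i using assms gr_repsD E_carr by blast
  show "gr_class (\<lambda>i. \<ominus> x i) \<otimes>\<^bsub>gr_group G E\<^esub> gr_class x = \<one>\<^bsub>gr_group G E\<^esub>"
    using c by (simp add: mult_gr_group one_gr_group l_neg del: mult_sum_group one_sum_group)
  show "gr_class x \<in> carrier (gr_group G E)" "gr_class (\<lambda>i. \<ominus> x i) \<in> carrier (gr_group G E)"
    using assms gr_reps_minus[OF E_minus] by (auto simp: carrier_gr_group)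
qed

definition gr_single :: "nat \<Rightarrow> 'a \<Rightarrow> nat \<Rightarrow> 'a" where
  "gr_single i x = (\<lambda>j. if j = i then x else \<zero>)"

lemma gr_single_reps: "\<lbrakk>x \<in> D i; \<And>j. \<zero> \<in> D j\<rbrakk> \<Longrightarrow> gr_single i x \<in> gr_reps D"
  by (auto simp: gr_reps_def gr_single_def intro: finite_subset[of _ "{i}"])

end

section \<open>The associated graded module\<close>

sublocale noetherian_local_ring \<subseteq> Rf: filtered_group R max_pow
  using max_pow_Suc_subset additive_subgroup.a_subgroup[OF ideal.axioms(1)[OF max_pow_ideal]]
  by (intro filtered_group.intro filtered_group_axioms.intro is_abelian_group)

sublocale local_module \<subseteq> Mf: filtered_group M filt
  using filt_Suc_subset filt_submodule
  by (intro filtered_group.intro filtered_group_axioms.intro M.abelian_group_axioms)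
    (auto simp: submodule_iff)

context local_module
begin

abbreviation gr_ring :: "(nat \<Rightarrow> 'a set) ring" where
  "gr_ring \<equiv> assoc_graded_ring R \<mm>"

abbreviation gr_module :: "(nat \<Rightarrow> 'a set, nat \<Rightarrow> 'c set) graded_module" where
  "gr_module \<equiv> assoc_graded_module R \<mm> M"

lemma carrier_gr_ring: "carrier gr_ring = Rf.gr_class ` Rf.gr_reps max_pow"
  by (simp add: assoc_graded_ring_def Let_def Rf.carrier_gr_group)

lemma subgroup_gr_module: "subgroup H (add_monoid gr_module) \<longleftrightarrow> subgroup H (gr_group M filt)"
  by (simp add: subgroup_def m_inv_def assoc_graded_module_def Let_def)

lemma group_gr_module: "group (add_monoid gr_module)"
proof -
  interpret Gr: group "gr_group M filt" by (rule Mf.group_gr_group)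
  have eq: "carrier (add_monoid gr_module) = carrier (gr_group M filt)"
    "monoid.mult (add_monoid gr_module) = monoid.mult (gr_group M filt)"
    "\<one>\<^bsub>add_monoid gr_module\<^esub> = \<one>\<^bsub>gr_group M filt\<^esub>"
    by (simp_all add: assoc_graded_module_def Let_def)
  show ?thesis
    by (rule groupI; unfold eq)
      (auto simp del: mult_sum_group one_sum_group intro: Gr.m_assoc Gr.l_inv_ex)
qed

lemma carrier_gr_module: "carrier gr_module = Mf.gr_class ` Mf.gr_reps filt"
  by (simp add: assoc_graded_module_def Let_def Mf.carrier_gr_group)

lemma add_gr_module:
  assumes "\<And>i. x i \<in> carrier M" "\<And>i. y i \<in> carrier M"
  shows "Mf.gr_class x \<oplus>\<^bsub>gr_module\<^esub> Mf.gr_class y = Mf.gr_class (\<lambda>i. x i \<oplus>\<^bsub>M\<^esub> y i)"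
proof -
  have "Mf.gr_class x \<oplus>\<^bsub>gr_module\<^esub> Mf.gr_class y = Mf.gr_class x \<otimes>\<^bsub>gr_group M filt\<^esub> Mf.gr_class y"
    by (simp add: assoc_graded_module_def Let_def)
  then show ?thesis using Mf.mult_gr_group[of x y] assms by simp
qed

lemma zero_gr_module: "\<zero>\<^bsub>gr_module\<^esub> = Mf.gr_class (\<lambda>_. \<zero>\<^bsub>M\<^esub>)"
proof -
  have "\<zero>\<^bsub>gr_module\<^esub> = \<one>\<^bsub>gr_group M filt\<^esub>" by (simp add: assoc_graded_module_def Let_def)
  then show ?thesis using Mf.one_gr_group by simp
qed

lemma graded_part_gr_module:
  "graded_part gr_module d = {\<xi> \<in> carrier gr_module. \<forall>i. int i \<noteq> d \<longrightarrow> \<xi> i = filt (Suc i)}"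
  by (simp add: assoc_graded_module_def Let_def Mf.one_gr_piece)

text \<open>Well-definedness of the graded product: (a + p)(x + q) - a x = p q + p x + a q has all
  its terms in degree at least i + j + 1, so the union over representatives collapses to one
  coset.\<close>

lemma coset_product:
  assumes a: "a \<in> max_pow i" and x: "x \<in> filt j"
  shows "(\<Union>r\<in>max_pow (Suc i) +>\<^bsub>R\<^esub> a. \<Union>y\<in>filt (Suc j) +>\<^bsub>M\<^esub> x. filt (Suc (i + j)) +>\<^bsub>M\<^esub> r \<odot>\<^bsub>M\<^esub> y)
    = filt (Suc (i + j)) +>\<^bsub>M\<^esub> a \<odot>\<^bsub>M\<^esub> x"
proof -
  have ac: "a \<in> carrier R" using a max_pow_subset by auto
  have xc: "x \<in> carrier M" using x Mf.E_carr by auto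
  have "filt (Suc (i + j)) +>\<^bsub>M\<^esub> r \<odot>\<^bsub>M\<^esub> y = filt (Suc (i + j)) +>\<^bsub>M\<^esub> a \<odot>\<^bsub>M\<^esub> x"
    if r: "r \<in> max_pow (Suc i) +>\<^bsub>R\<^esub> a" and y: "y \<in> filt (Suc j) +>\<^bsub>M\<^esub> x" for r y
  proof -
    obtain p where p: "p \<in> max_pow (Suc i)" "r = p \<oplus> a" using r by (auto simp: a_r_coset_def')
    obtain q where q: "q \<in> filt (Suc j)" "y = q \<oplus>\<^bsub>M\<^esub> x" using y by (auto simp: a_r_coset_def')
    have c: "p \<in> carrier R" "q \<in> carrier M" using p q max_pow_subset Mf.E_carr by auto
    have "r \<odot>\<^bsub>M\<^esub> y \<ominus>\<^bsub>M\<^esub> a \<odot>\<^bsub>M\<^esub> x = (p \<odot>\<^bsub>M\<^esub> q \<oplus>\<^bsub>M\<^esub> p \<odot>\<^bsub>M\<^esub> x) \<oplus>\<^bsub>M\<^esub> a \<odot>\<^bsub>M\<^esub> q"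
    proof -
      have "r \<odot>\<^bsub>M\<^esub> y = ((p \<odot>\<^bsub>M\<^esub> q \<oplus>\<^bsub>M\<^esub> p \<odot>\<^bsub>M\<^esub> x) \<oplus>\<^bsub>M\<^esub> a \<odot>\<^bsub>M\<^esub> q) \<oplus>\<^bsub>M\<^esub> a \<odot>\<^bsub>M\<^esub> x"
        using c ac xc p(2) q(2) by (simp add: smult_l_distr smult_r_distr M.a_ac)
      then show ?thesis using c ac xc by (simp add: M.minus_eq M.a_assoc M.r_neg)
    qed
    also have "\<dots> \<in> filt (Suc (i + j))"
    proof -
      have "p \<odot>\<^bsub>M\<^esub> q \<in> filt (Suc (i + j))"
        using smult_filt[OF p(1) q(1)] filt_Suc_subset by auto
      moreover have "p \<odot>\<^bsub>M\<^esub> x \<in> filt (Suc (i + j))" using smult_filt[OF p(1) x] by simp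
      moreover have "a \<odot>\<^bsub>M\<^esub> q \<in> filt (Suc (i + j))" using smult_filt[OF a q(1)] by simp
      ultimately show ?thesis by (intro Mf.E_add)
    qed
    finally show ?thesis
      using Mf.coset_eq_iff[of "r \<odot>\<^bsub>M\<^esub> y" "a \<odot>\<^bsub>M\<^esub> x"] c ac xc p(2) q(2) by simp
  qed
  moreover have "a \<in> max_pow (Suc i) +>\<^bsub>R\<^esub> a"
    using Rf.E_zero ac by (auto simp: a_r_coset_def' intro!: bexI[of _ \<zero>])
  moreover have "x \<in> filt (Suc j) +>\<^bsub>M\<^esub> x"
    using Mf.E_zero xc by (auto simp: a_r_coset_def' intro!: bexI[of _ "\<zero>\<^bsub>M\<^esub>"])
  ultimately show ?thesis by blast
qed

text \<open>Reduces the graded action to convolution of representatives; later arguments need not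
  look at unions of cosets again.\<close>

lemma smult_gr_module:
  assumes a: "a \<in> Rf.gr_reps max_pow" and x: "x \<in> Mf.gr_reps filt"
  shows "Rf.gr_class a \<odot>\<^bsub>gr_module\<^esub> Mf.gr_class x =
    Mf.gr_class (\<lambda>n. \<Oplus>\<^bsub>M\<^esub>i\<in>{..n}. a i \<odot>\<^bsub>M\<^esub> x (n - i))"
proof
  fix n
  interpret P: comm_group "gr_piece M filt n" by (rule Mf.comm_group_gr_piece)
  have t: "a i \<odot>\<^bsub>M\<^esub> x (n - i) \<in> filt n" if "i \<le> n" for i
    using smult_filt[of "a i" i "x (n - i)" "n - i"] a x that by (auto dest: Rf.gr_repsD Mf.gr_repsD)
  have "(Rf.gr_class a \<odot>\<^bsub>gr_module\<^esub> Mf.gr_class x) n =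
    (\<Otimes>\<^bsub>gr_piece M filt n\<^esub>i\<in>{..n}. \<Union>r\<in>max_pow (Suc i) +>\<^bsub>R\<^esub> a i. \<Union>y\<in>filt (Suc (n - i)) +>\<^bsub>M\<^esub> x (n - i).
       filt (Suc n) +>\<^bsub>M\<^esub> r \<odot>\<^bsub>M\<^esub> y)"
    by (simp add: assoc_graded_module_def Let_def gr_mult_def Rf.gr_class_def Mf.gr_class_def)
  also have "\<dots> = (\<Otimes>\<^bsub>gr_piece M filt n\<^esub>i\<in>{..n}. filt (Suc n) +>\<^bsub>M\<^esub> a i \<odot>\<^bsub>M\<^esub> x (n - i))"
  proof (rule P.finprod_cong')
    fix i assume "i \<in> {..n}"
    then show "(\<Union>r\<in>max_pow (Suc i) +>\<^bsub>R\<^esub> a i. \<Union>y\<in>filt (Suc (n - i)) +>\<^bsub>M\<^esub> x (n - i).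
       filt (Suc n) +>\<^bsub>M\<^esub> r \<odot>\<^bsub>M\<^esub> y) = filt (Suc n) +>\<^bsub>M\<^esub> a i \<odot>\<^bsub>M\<^esub> x (n - i)"
      using coset_product[of "a i" i "x (n - i)" "n - i"] a x by (auto dest: Rf.gr_repsD Mf.gr_repsD)
  qed (use t in \<open>auto simp: Mf.carrier_gr_piece\<close>)
  also have "\<dots> = filt (Suc n) +>\<^bsub>M\<^esub> (\<Oplus>\<^bsub>M\<^esub>i\<in>{..n}. a i \<odot>\<^bsub>M\<^esub> x (n - i))"
    using t by (intro Mf.finprod_gr_piece) auto
  finally show "(Rf.gr_class a \<odot>\<^bsub>gr_module\<^esub> Mf.gr_class x) n =
    Mf.gr_class (\<lambda>n. \<Oplus>\<^bsub>M\<^esub>i\<in>{..n}. a i \<odot>\<^bsub>M\<^esub> x (n - i)) n" by (simp add: Mf.gr_class_def)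
qed

text \<open>A family \<open>D\<close> of submodules compatible with the filtration determines the graded submodule
  of the associated graded module whose component of degree \<open>i\<close> is the image of \<open>D i\<close>.\<close>

definition compatible :: "(nat \<Rightarrow> 'c set) \<Rightarrow> bool" where
  "compatible D \<longleftrightarrow> (\<forall>i. submodule (D i) R M \<and> D i \<subseteq> filt i) \<and>
     (\<forall>i j a x. a \<in> max_pow i \<longrightarrow> x \<in> D j \<longrightarrow> a \<odot>\<^bsub>M\<^esub> x \<in> D (i + j))"

lemma compatibleI:
  assumes "\<And>i. submodule (D i) R M" "\<And>i. D i \<subseteq> filt i"
    and "\<And>i j a x. \<lbrakk>a \<in> max_pow i; x \<in> D j\<rbrakk> \<Longrightarrow> a \<odot>\<^bsub>M\<^esub> x \<in> D (i + j)"
  shows "compatible D"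
  using assms by (auto simp: compatible_def)

lemma compatible_submodule: "compatible D \<Longrightarrow> submodule (D i) R M"
  by (simp add: compatible_def)

lemma compatible_subset: "compatible D \<Longrightarrow> D i \<subseteq> filt i"
  by (simp add: compatible_def)

lemma compatible_filt: "compatible filt"
  by (rule compatibleI) (auto intro: filt_submodule smult_filt)

definition gr_image :: "(nat \<Rightarrow> 'c set) \<Rightarrow> (nat \<Rightarrow> 'c set) set" where
  "gr_image D = Mf.gr_class ` Mf.gr_reps D"

lemma compatible_reps: "\<lbrakk>compatible D; x \<in> Mf.gr_reps D\<rbrakk> \<Longrightarrow> x \<in> Mf.gr_reps filt"
  using compatible_subset by (auto simp: Mf.gr_reps_def)

lemma reps_carr: "\<lbrakk>compatible D; x \<in> Mf.gr_reps D\<rbrakk> \<Longrightarrow> x i \<in> carrier M"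
  using Mf.gr_repsD submodule_carr[OF compatible_submodule] by blast

lemma convolution_reps:
  assumes D: "compatible D" and a: "a \<in> Rf.gr_reps max_pow" and x: "x \<in> Mf.gr_reps D"
  shows "(\<lambda>n. \<Oplus>\<^bsub>M\<^esub>i\<in>{..n}. a i \<odot>\<^bsub>M\<^esub> x (n - i)) \<in> Mf.gr_reps D"
proof -
  note sm = compatible_submodule[OF D]
  have c: "a i \<in> carrier R" "x i \<in> carrier M" for i
    using Rf.E_carr[OF Rf.gr_repsD[OF a]] reps_carr[OF D x] by auto
  have "a i \<odot>\<^bsub>M\<^esub> x (n - i) \<in> D n" if "i \<le> n" for i n
  proof -
    have "a i \<odot>\<^bsub>M\<^esub> x (n - i) \<in> D (i + (n - i))"
      using D a x Rf.gr_repsD Mf.gr_repsD unfolding compatible_def by blast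
    then show ?thesis using that by simp
  qed
  then have 1: "(\<Oplus>\<^bsub>M\<^esub>i\<in>{..n}. a i \<odot>\<^bsub>M\<^esub> x (n - i)) \<in> D n" for n
    by (intro finsum_submodule sm) auto
  have "{n. (\<Oplus>\<^bsub>M\<^esub>i\<in>{..n}. a i \<odot>\<^bsub>M\<^esub> x (n - i)) \<noteq> \<zero>\<^bsub>M\<^esub>}
      \<subseteq> (\<lambda>(i, j). i + j) ` ({i. a i \<noteq> \<zero>} \<times> {i. x i \<noteq> \<zero>\<^bsub>M\<^esub>})" (is "?L \<subseteq> ?R")
  proof
    fix n assume n: "n \<in> ?L"
    show "n \<in> ?R"
    proof (rule ccontr)
      assume no: "n \<notin> ?R"
      have "a i \<odot>\<^bsub>M\<^esub> x (n - i) = \<zero>\<^bsub>M\<^esub>" if i: "i \<le> n" for i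
      proof (cases "a i = \<zero> \<or> x (n - i) = \<zero>\<^bsub>M\<^esub>")
        case True then show ?thesis using c by auto
      next
        case False
        then have "n \<in> ?R" using i by (intro image_eqI[of _ _ "(i, n - i)"]) auto
        then show ?thesis using no by simp
      qed
      then have "(\<Oplus>\<^bsub>M\<^esub>i\<in>{..n}. a i \<odot>\<^bsub>M\<^esub> x (n - i)) = \<zero>\<^bsub>M\<^esub>"
        by (intro finsum_submodule[OF submodule_zero_set, THEN singletonD]) auto
      then show False using n by simp
    qed
  qed
  moreover have "finite ?R" using a x by (auto simp: Rf.gr_reps_def Mf.gr_reps_def)
  ultimately have "finite ?L" using finite_subset by blast
  then show ?thesis using 1 by (simp add: Mf.gr_reps_def)
qed

text \<open>The source of test submodules: a span in the associated graded module is bounded by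
  finding a compatible \<open>D\<close> whose image contains the generators.\<close>

lemma gr_image_submodule:
  assumes D: "compatible D" shows "submodule (gr_image D) gr_ring gr_module"
proof -
  note sm = compatible_submodule[OF D]
  have "subgroup (gr_image D) (gr_group M filt)"
  proof (rule group.subgroupI[OF Mf.group_gr_group])
    show "gr_image D \<subseteq> carrier (gr_group M filt)"
      using compatible_reps[OF D] by (auto simp: gr_image_def Mf.carrier_gr_group)
    show "gr_image D \<noteq> {}" using Mf.gr_reps_zero[of D] submodule_zero[OF sm] by (auto simp: gr_image_def)
  next
    fix \<xi> assume "\<xi> \<in> gr_image D"
    then obtain x where x: "x \<in> Mf.gr_reps D" "\<xi> = Mf.gr_class x" by (auto simp: gr_image_def)
    show "inv\<^bsub>gr_group M filt\<^esub> \<xi> \<in> gr_image D"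
      unfolding x(2) Mf.inv_gr_group[OF compatible_reps[OF D x(1)]] gr_image_def
      by (rule imageI, rule Mf.gr_reps_minus[OF submodule_minus[OF sm] x(1)])
    fix \<eta> assume "\<eta> \<in> gr_image D"
    then obtain y where y: "y \<in> Mf.gr_reps D" "\<eta> = Mf.gr_class y" by (auto simp: gr_image_def)
    show "\<xi> \<otimes>\<^bsub>gr_group M filt\<^esub> \<eta> \<in> gr_image D"
      unfolding x(2) y(2) Mf.mult_gr_group[OF reps_carr[OF D x(1)] reps_carr[OF D y(1)]] gr_image_def
      by (rule imageI, rule Mf.gr_reps_add[OF submodule_add[OF sm] x(1) y(1)])
  qed
  moreover have "\<alpha> \<odot>\<^bsub>gr_module\<^esub> \<xi> \<in> gr_image D" if \<alpha>: "\<alpha> \<in> carrier gr_ring" and \<xi>: "\<xi> \<in> gr_image D" for \<alpha> \<xi>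
  proof -
    obtain a where a: "a \<in> Rf.gr_reps max_pow" "\<alpha> = Rf.gr_class a" using \<alpha> by (auto simp: carrier_gr_ring)
    obtain x where x: "x \<in> Mf.gr_reps D" "\<xi> = Mf.gr_class x" using \<xi> by (auto simp: gr_image_def)
    show ?thesis
      unfolding a(2) x(2) smult_gr_module[OF a(1) compatible_reps[OF D x(1)]] gr_image_def
      by (rule imageI, rule convolution_reps[OF D a(1) x(1)])
  qed
  ultimately show ?thesis by (simp add: submodule_iff subgroup_gr_module)
qed

lemma gr_image_filt: "gr_image filt = carrier gr_module"
  by (simp add: gr_image_def carrier_gr_module)

lemma gr_module_carrier_submodule: "submodule (carrier gr_module) gr_ring gr_module"
  using gr_image_submodule[OF compatible_filt] by (simp add: gr_image_filt)

text \<open>The degree is prescribed instead of being the order of x. On \<mm>^i M the class is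
  therefore additive in x, and it vanishes on \<mm>^(i+1) M; at the order of x it is the initial
  form.\<close>

definition hom_class :: "nat \<Rightarrow> 'c \<Rightarrow> nat \<Rightarrow> 'c set" where
  "hom_class i x = Mf.gr_class (Mf.gr_single i x)"

lemma hom_class_apply: "hom_class i x j = (if j = i then filt (Suc i) +>\<^bsub>M\<^esub> x else filt (Suc j))"
  using Mf.coset_zero by (simp add: hom_class_def Mf.gr_class_def Mf.gr_single_def)

lemma hom_class_gr_image:
  "\<lbrakk>compatible D; x \<in> D i\<rbrakk> \<Longrightarrow> hom_class i x \<in> gr_image D"
  unfolding hom_class_def gr_image_def
  by (intro imageI Mf.gr_single_reps) (auto intro: submodule_zero compatible_submodule)

text \<open>Converse of \<open>hom_class_gr_image\<close>; a class determines its representative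
  only modulo the next filtration step.\<close>

lemma hom_class_gr_imageD:
  assumes D: "compatible D" and x: "x \<in> carrier M" and "hom_class i x \<in> gr_image D"
  shows "\<exists>d\<in>D i. x \<ominus>\<^bsub>M\<^esub> d \<in> filt (Suc i)"
proof -
  obtain d where d: "d \<in> Mf.gr_reps D" "hom_class i x = Mf.gr_class d" using assms by (auto simp: gr_image_def)
  have "filt (Suc i) +>\<^bsub>M\<^esub> x = filt (Suc i) +>\<^bsub>M\<^esub> d i"
    using fun_cong[OF d(2), of i] by (simp add: hom_class_apply Mf.gr_class_def)
  then have "x \<ominus>\<^bsub>M\<^esub> d i \<in> filt (Suc i)" using Mf.coset_eq_iff[OF x reps_carr[OF D d(1)]] by simp
  then show ?thesis using Mf.gr_repsD[OF d(1)] by blast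
qed

lemma hom_class_add:
  assumes "x \<in> carrier M" "y \<in> carrier M"
  shows "hom_class i x \<oplus>\<^bsub>gr_module\<^esub> hom_class i y = hom_class i (x \<oplus>\<^bsub>M\<^esub> y)"
proof -
  have "hom_class i x \<oplus>\<^bsub>gr_module\<^esub> hom_class i y
      = Mf.gr_class (\<lambda>j. Mf.gr_single i x j \<oplus>\<^bsub>M\<^esub> Mf.gr_single i y j)"
    unfolding hom_class_def using assms by (intro add_gr_module) (auto simp: Mf.gr_single_def)
  also have "(\<lambda>j. Mf.gr_single i x j \<oplus>\<^bsub>M\<^esub> Mf.gr_single i y j) = Mf.gr_single i (x \<oplus>\<^bsub>M\<^esub> y)"
    by (auto simp: Mf.gr_single_def)
  finally show ?thesis by (simp add: hom_class_def)
qed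

lemma hom_class_smult:
  assumes a: "a \<in> max_pow i" and x: "x \<in> filt j"
  shows "Rf.gr_class (Rf.gr_single i a) \<odot>\<^bsub>gr_module\<^esub> hom_class j x = hom_class (i + j) (a \<odot>\<^bsub>M\<^esub> x)"
proof -
  have ac: "a \<in> carrier R" using a max_pow_subset by auto
  have xc: "x \<in> carrier M" using x Mf.E_carr by auto
  have "Rf.gr_class (Rf.gr_single i a) \<odot>\<^bsub>gr_module\<^esub> hom_class j x =
    Mf.gr_class (\<lambda>n. \<Oplus>\<^bsub>M\<^esub>k\<in>{..n}. Rf.gr_single i a k \<odot>\<^bsub>M\<^esub> Mf.gr_single j x (n - k))"
    unfolding hom_class_def using a x Rf.E_zero Mf.E_zero
    by (intro smult_gr_module Rf.gr_single_reps Mf.gr_single_reps)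
  also have "(\<lambda>n. \<Oplus>\<^bsub>M\<^esub>k\<in>{..n}. Rf.gr_single i a k \<odot>\<^bsub>M\<^esub> Mf.gr_single j x (n - k))
     = Mf.gr_single (i + j) (a \<odot>\<^bsub>M\<^esub> x)"
  proof
    fix n
    have t: "Rf.gr_single i a k \<odot>\<^bsub>M\<^esub> Mf.gr_single j x (n - k) =
      (if i = k then if n - i = j then a \<odot>\<^bsub>M\<^esub> x else \<zero>\<^bsub>M\<^esub> else \<zero>\<^bsub>M\<^esub>)" for k
      using ac xc by (simp add: Rf.gr_single_def Mf.gr_single_def eq_commute[of k i])
    show "(\<Oplus>\<^bsub>M\<^esub>k\<in>{..n}. Rf.gr_single i a k \<odot>\<^bsub>M\<^esub> Mf.gr_single j x (n - k)) = Mf.gr_single (i + j) (a \<odot>\<^bsub>M\<^esub> x) n"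
    proof (cases "i \<le> n")
      case True
      have "(\<Oplus>\<^bsub>M\<^esub>k\<in>{..n}. if i = k then if n - i = j then a \<odot>\<^bsub>M\<^esub> x else \<zero>\<^bsub>M\<^esub> else \<zero>\<^bsub>M\<^esub>)
        = (if n - i = j then a \<odot>\<^bsub>M\<^esub> x else \<zero>\<^bsub>M\<^esub>)"
        using True ac xc by (intro M.finsum_singleton) auto
      then show ?thesis using True unfolding t by (auto simp: Mf.gr_single_def)
    next
      case False
      have "(\<Oplus>\<^bsub>M\<^esub>k\<in>{..n}. Rf.gr_single i a k \<odot>\<^bsub>M\<^esub> Mf.gr_single j x (n - k)) = \<zero>\<^bsub>M\<^esub>"
        using False by (intro finsum_submodule[OF submodule_zero_set, THEN singletonD]) (auto simp: t)
      then show ?thesis using False by (auto simp: Mf.gr_single_def)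
    qed
  qed
  finally show ?thesis by (simp add: hom_class_def)
qed

lemma gr_single_ring: "a \<in> max_pow i \<Longrightarrow> Rf.gr_class (Rf.gr_single i a) \<in> carrier gr_ring"
  unfolding carrier_gr_ring by (intro imageI Rf.gr_single_reps Rf.E_zero)

lemma hom_class_smult_closed:
  assumes "submodule H gr_ring gr_module" "a \<in> max_pow i" "x \<in> filt j" "hom_class j x \<in> H"
  shows "hom_class (i + j) (a \<odot>\<^bsub>M\<^esub> x) \<in> H"
  using submodule_smult[OF assms(1) gr_single_ring[OF assms(2)] assms(4)] hom_class_smult[OF assms(2,3)]
  by simp

lemma hom_class_zero: "hom_class i \<zero>\<^bsub>M\<^esub> = \<zero>\<^bsub>gr_module\<^esub>"
  unfolding zero_gr_module hom_class_def by (rule arg_cong[of _ _ Mf.gr_class]) (auto simp: Mf.gr_single_def)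

lemma hom_class_filt_Suc: "x \<in> filt (Suc i) \<Longrightarrow> hom_class i x = \<zero>\<^bsub>gr_module\<^esub>"
  unfolding hom_class_zero[of i, symmetric]
  using Mf.coset_eq_self_iff[of x "Suc i"] Mf.E_carr[of x "Suc i"] Mf.coset_zero[of "Suc i"]
  by (auto simp: hom_class_apply fun_eq_iff)

text \<open>Lets membership of classes in \<open>H\<close> be checked on R-module generators of
  \<open>D\<close>.\<close>

lemma hom_class_preimage_submodule:
  assumes H: "submodule H gr_ring gr_module" and D: "submodule D R M" "D \<subseteq> filt i"
  shows "submodule {x \<in> D. hom_class i x \<in> H} R M"
proof -
  have sm: "hom_class i (a \<odot>\<^bsub>M\<^esub> x) \<in> H" if "a \<in> carrier R" "x \<in> D" "hom_class i x \<in> H" for a x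
    using hom_class_smult_closed[OF H, of a 0 x i] that D by (auto simp: max_pow_0)
  show ?thesis
  proof (rule submoduleI)
    show "\<zero>\<^bsub>M\<^esub> \<in> {x \<in> D. hom_class i x \<in> H}"
      using submodule_zero[OF D(1)] submodule_zero[OF H] by (simp add: hom_class_zero)
    show "{x \<in> D. hom_class i x \<in> H} \<subseteq> carrier M" using submodule_subset[OF D(1)] by auto
  next
    fix x assume x: "x \<in> {x \<in> D. hom_class i x \<in> H}"
    then have xc: "x \<in> carrier M" using submodule_carr[OF D(1)] by auto
    \<comment> \<open>Negation is routed through the scalar -1, since \<open>hom_class\<close> is
      known to respect sums and scalars.\<close>
    have "\<ominus>\<^bsub>M\<^esub> x = (\<ominus> \<one>) \<odot>\<^bsub>M\<^esub> x" using xc by (simp add: smult_l_minus)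
    moreover have "hom_class i ((\<ominus> \<one>) \<odot>\<^bsub>M\<^esub> x) \<in> H" using x by (intro sm) auto
    ultimately have "hom_class i (\<ominus>\<^bsub>M\<^esub> x) \<in> H" by simp
    then show "\<ominus>\<^bsub>M\<^esub> x \<in> {x \<in> D. hom_class i x \<in> H}" using x submodule_minus[OF D(1)] by simp
    fix y assume y: "y \<in> {x \<in> D. hom_class i x \<in> H}"
    then have yc: "y \<in> carrier M" using submodule_carr[OF D(1)] by auto
    show "x \<oplus>\<^bsub>M\<^esub> y \<in> {x \<in> D. hom_class i x \<in> H}"
      using x y submodule_add[OF D(1)] submodule_add[OF H] hom_class_add[OF xc yc, of i] by fastforce
  next
    fix a x assume "a \<in> carrier R" "x \<in> {x \<in> D. hom_class i x \<in> H}"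
    then show "a \<odot>\<^bsub>M\<^esub> x \<in> {x \<in> D. hom_class i x \<in> H}" using sm submodule_smult[OF D(1)] by simp
  qed
qed

text \<open>The image of \<open>D\<close> is generated by its homogeneous classes: one component is
  split off at a time, by induction on a finite set containing the support.\<close>

lemma gr_image_subset:
  assumes H: "submodule H gr_ring gr_module" and D: "compatible D"
    and hom: "\<And>i x. x \<in> D i \<Longrightarrow> hom_class i x \<in> H"
  shows "gr_image D \<subseteq> H"
proof -
  note sm = compatible_submodule[OF D]
  have "Mf.gr_class x \<in> H" if "finite S" "\<And>i. x i \<in> D i" "{i. x i \<noteq> \<zero>\<^bsub>M\<^esub>} \<subseteq> S" for S x
    using that
  proof (induction S arbitrary: x rule: finite_induct)
    case empty
    then have "x = (\<lambda>_. \<zero>\<^bsub>M\<^esub>)" by auto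
    then show ?case using submodule_zero[OF H] by (simp add: zero_gr_module)
  next
    case (insert i S)
    let ?y = "x(i := \<zero>\<^bsub>M\<^esub>)"
    have xc: "x j \<in> carrier M" for j using insert.prems(1) submodule_carr[OF sm] by blast
    have "Mf.gr_class ?y \<in> H"
      using insert.prems submodule_zero[OF sm] by (intro insert.IH) auto
    moreover have "hom_class i (x i) \<in> H" using hom insert.prems by auto
    moreover have "Mf.gr_class x = hom_class i (x i) \<oplus>\<^bsub>gr_module\<^esub> Mf.gr_class ?y"
    proof -
      have "hom_class i (x i) \<oplus>\<^bsub>gr_module\<^esub> Mf.gr_class ?y =
        Mf.gr_class (\<lambda>j. Mf.gr_single i (x i) j \<oplus>\<^bsub>M\<^esub> ?y j)"
        unfolding hom_class_def using xc by (intro add_gr_module) (auto simp: Mf.gr_single_def)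
      also have "(\<lambda>j. Mf.gr_single i (x i) j \<oplus>\<^bsub>M\<^esub> ?y j) = x"
        using xc by (auto simp: Mf.gr_single_def)
      finally show ?thesis by (rule sym)
    qed
    ultimately show ?case using submodule_add[OF H] by simp
  qed
  then show ?thesis by (auto simp: gr_image_def Mf.gr_reps_def)
qed

text \<open>The products a x with a in \<mm>^i and x in \<open>K\<close> have classes in
  \<open>H\<close> because \<open>H\<close> is closed under the classes of such a; sums follow since
  the good elements form a submodule.\<close>

lemma hom_class_set_smult:
  assumes H: "submodule H gr_ring gr_module" and K: "submodule K R M" "K \<subseteq> filt s"
    and "\<And>x. x \<in> K \<Longrightarrow> hom_class s x \<in> H" and x: "x \<in> set_smult (max_pow i) K"
  shows "hom_class (i + s) x \<in> H"
proof -
  have KM: "K \<subseteq> carrier M" by (rule submodule_subset[OF K(1)])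
  have "set_smult (max_pow i) K \<subseteq> set_smult (max_pow i) (filt s)" using K by (intro set_smult_mono) auto
  also have "\<dots> \<subseteq> filt (i + s)" unfolding filt_eq by (rule set_smult_max_pow) simp
  finally have sub: "set_smult (max_pow i) K \<subseteq> filt (i + s)" .
  have P: "submodule {x \<in> set_smult (max_pow i) K. hom_class (i + s) x \<in> H} R M"
    using sub KM by (intro hom_class_preimage_submodule H set_smult_submodule max_pow_subset)
  have "set_smult (max_pow i) K \<subseteq> {x \<in> set_smult (max_pow i) K. hom_class (i + s) x \<in> H}"
    using assms hom_class_smult_closed[OF H] by (intro set_smult_least[OF _ P]) (auto intro: set_smultI)
  then show ?thesis using x by auto
qed

end

section \<open>Initial modules\<close>

text \<open>Spans depend on the carrier and the operations, so the altered graded parts are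
  invisible to them.\<close>

lemma graded_submodule_span:
  "module_span A (graded_submodule G H) Y = module_span A (G\<lparr>carrier := H\<rparr>) Y"
proof -
  have "submodule K A (graded_submodule G H) \<longleftrightarrow> submodule K A (G\<lparr>carrier := H\<rparr>)" for K
    by (simp add: submodule_iff graded_submodule_def subgroup_def m_inv_def)
  then show ?thesis by (simp add: module_span_def)
qed

context local_module
begin

lemma gr_image_part:
  assumes D: "compatible D"
  shows "{\<xi> \<in> gr_image D. \<forall>j. int j \<noteq> int i \<longrightarrow> \<xi> j = filt (Suc j)} = hom_class i ` D i"
proof (intro equalityI subsetI)
  fix \<xi> assume "\<xi> \<in> {\<xi> \<in> gr_image D. \<forall>j. int j \<noteq> int i \<longrightarrow> \<xi> j = filt (Suc j)}"
  then obtain x where x: "x \<in> Mf.gr_reps D" "\<xi> = Mf.gr_class x" "\<And>j. j \<noteq> i \<Longrightarrow> \<xi> j = filt (Suc j)"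
    by (auto simp: gr_image_def)
  then have "\<xi> = hom_class i (x i)" by (intro ext) (auto simp: hom_class_apply Mf.gr_class_def)
  then show "\<xi> \<in> hom_class i ` D i" using Mf.gr_repsD[OF x(1)] by blast
qed (use hom_class_gr_image[OF D] in \<open>auto simp: hom_class_apply\<close>)

text \<open>Degrees are integers but cosets are indexed by naturals, so in negative degree every
  coset is trivial.\<close>

lemma gr_image_part_neg:
  assumes "d < 0" "\<xi> \<in> gr_image D" "\<forall>j. int j \<noteq> d \<longrightarrow> \<xi> j = filt (Suc j)"
  shows "\<xi> = \<zero>\<^bsub>gr_module\<^esub>"
  using assms Mf.coset_zero by (auto simp: zero_gr_module Mf.gr_class_def)

end

context fg_local_module
begin

abbreviation ord :: "'c \<Rightarrow> nat" where "ord \<equiv> elem_order R \<mm> M"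

lemma elem_order_eq:
  assumes "x \<in> filt i" "x \<notin> filt (Suc i)" shows "ord x = i"
  unfolding elem_order_def
proof (rule the_equality)
  fix j assume j: "x \<in> filt j - filt (Suc j)"
  show "j = i"
  proof (rule linorder_cases[of i j])
    assume "i < j" then show ?thesis using filt_antimono[of "Suc i" j] j assms by auto
  next
    assume "j < i" then show ?thesis using filt_antimono[of "Suc j" i] j assms by auto
  qed simp
qed (use assms in auto)

text \<open>Krull's intersection theorem supplies the existence behind the \<open>THE\<close> in the
  order; uniqueness comes from the filtration being descending.\<close>

lemma elem_order_props:
  assumes "x \<in> carrier M" "x \<noteq> \<zero>\<^bsub>M\<^esub>"
  shows "x \<in> filt (ord x)" "x \<notin> filt (Suc (ord x))"
proof -
  have "\<exists>i. x \<notin> filt i" using Krull_intersection assms by auto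
  then obtain i where i: "x \<notin> filt i" "\<And>j. j < i \<Longrightarrow> x \<in> filt j"
    using exists_least_iff[of "\<lambda>i. x \<notin> filt i"] by auto
  then obtain j where "i = Suc j" using assms filt_0 by (cases i) auto
  then have j: "x \<in> filt j" "x \<notin> filt (Suc j)" using i by auto
  then have "ord x = j" by (rule elem_order_eq)
  then show "x \<in> filt (ord x)" "x \<notin> filt (Suc (ord x))" using j by auto
qed

lemma initial_form_eq: "initial_form R \<mm> M x = hom_class (ord x) x"
  by (rule ext) (simp add: initial_form_def hom_class_apply)

end

locale initial_setting = fg_local_module +
  fixes N :: "'c set" and s :: nat
  assumes N: "submodule N R M"
    and N_nonzero: "N \<noteq> {\<zero>\<^bsub>M\<^esub>}"
    and s: "s = submodule_order R \<mm> M N"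
begin

lemma N_carr: "x \<in> N \<Longrightarrow> x \<in> carrier M"
  using submodule_carr[OF N] .

lemma N_subset: "N \<subseteq> filt s"
proof
  fix x assume x: "x \<in> N"
  show "x \<in> filt s"
  proof (cases "x = \<zero>\<^bsub>M\<^esub>")
    case True then show ?thesis using Mf.E_zero by simp
  next
    case False
    then have "s \<le> ord x" unfolding s submodule_order_def using x by (intro Least_le) auto
    then show ?thesis using elem_order_props(1)[OF N_carr[OF x] False] filt_antimono by blast
  qed
qed

lemma order_attained: "\<exists>x\<in>N. x \<notin> filt (Suc s)"
proof -
  have "\<exists>i. i \<in> ord ` (N - {\<zero>\<^bsub>M\<^esub>})" using N_nonzero submodule_zero[OF N] by auto
  then have "s \<in> ord ` (N - {\<zero>\<^bsub>M\<^esub>})" unfolding s submodule_order_def by (rule LeastI_ex)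
  then show ?thesis using elem_order_props(2) N_carr by auto
qed

definition N_filt :: "nat \<Rightarrow> 'c set" where "N_filt i = N \<inter> filt i"

lemma N_filt_compatible: "compatible N_filt"
proof (rule compatibleI)
  show "submodule (N_filt i) R M" for i unfolding N_filt_def by (intro submodule_Int N filt_submodule)
  show "a \<odot>\<^bsub>M\<^esub> x \<in> N_filt (i + j)" if "a \<in> max_pow i" "x \<in> N_filt j" for a x i j
    using that submodule_smult[OF N subsetD[OF max_pow_subset that(1)]] smult_filt[OF that(1)]
    by (simp add: N_filt_def)
qed (auto simp: N_filt_def)

lemma N_filt_low: "i \<le> s \<Longrightarrow> N_filt i = N"
  using N_subset filt_antimono[of i s] by (auto simp: N_filt_def)

abbreviation N_star :: "(nat \<Rightarrow> 'c set) set" where "N_star \<equiv> gr_image N_filt"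

abbreviation N_star_module :: "(nat \<Rightarrow> 'a set, nat \<Rightarrow> 'c set) graded_module" where
  "N_star_module \<equiv> initial_module R \<mm> M N"

lemma hom_class_N_star: "x \<in> N \<Longrightarrow> x \<in> filt i \<Longrightarrow> hom_class i x \<in> N_star"
  by (rule hom_class_gr_image[OF N_filt_compatible]) (auto simp: N_filt_def)

lemma N_star_submodule: "submodule N_star gr_ring gr_module"
  by (rule gr_image_submodule[OF N_filt_compatible])

lemma N_star_carrier: "N_star \<subseteq> carrier gr_module"
  by (rule submodule_subset[OF N_star_submodule])

lemma initial_forms_subset: "initial_form R \<mm> M ` (N - {\<zero>\<^bsub>M\<^esub>}) \<subseteq> N_star"
  using elem_order_props(1) N_carr hom_class_N_star by (auto simp: initial_form_eq)

lemma gr_span_submodule: "Y \<subseteq> N_star \<Longrightarrow> submodule (module_span gr_ring gr_module Y) gr_ring gr_module"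
  using N_star_carrier by (intro submodule_module_span gr_module_carrier_submodule) auto

text \<open>An element of N \<inter> \<mm>^i M has order i, and then its class in degree i is its
  initial form, or lies in \<mm>^(i+1) M, and then the class is zero.\<close>

lemma initial_form_span_eq: "initial_form_span R \<mm> M N = N_star"
proof
  show "initial_form_span R \<mm> M N \<subseteq> N_star"
    unfolding initial_form_span_def by (intro module_span_minimal initial_forms_subset N_star_submodule)
  have H: "submodule (initial_form_span R \<mm> M N) gr_ring gr_module"
    unfolding initial_form_span_def by (rule gr_span_submodule[OF initial_forms_subset])
  show "N_star \<subseteq> initial_form_span R \<mm> M N"
  proof (rule gr_image_subset[OF H N_filt_compatible])
    fix i x assume x: "x \<in> N_filt i"
    show "hom_class i x \<in> initial_form_span R \<mm> M N"
    proof (cases "x \<in> filt (Suc i)")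
      case True then show ?thesis using hom_class_filt_Suc submodule_zero[OF H] by simp
    next
      case False
      then have x': "ord x = i" "x \<in> N - {\<zero>\<^bsub>M\<^esub>}"
        using elem_order_eq[of x i] x Mf.E_zero[of "Suc i"] by (auto simp: N_filt_def)
      have "initial_form R \<mm> M x \<in> initial_form_span R \<mm> M N"
        unfolding initial_form_span_def using x'(2) by (intro subsetD[OF module_span_inc] imageI)
      then show ?thesis using x'(1) by (simp add: initial_form_eq)
    qed
  qed
qed

lemma carrier_N_star_module: "carrier N_star_module = N_star"
  by (simp add: initial_module_def graded_submodule_def initial_form_span_eq)

lemma span_N_star_module:
  assumes "Y \<subseteq> N_star"
  shows "module_span gr_ring N_star_module Y = module_span gr_ring gr_module Y"
  unfolding initial_module_def graded_submodule_span initial_form_span_eq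
  by (rule module_span_restrict[OF group_gr_module N_star_submodule assms])

lemma part_N_star_module:
  "graded_part N_star_module d = {\<xi> \<in> N_star. \<forall>i. int i \<noteq> d \<longrightarrow> \<xi> i = filt (Suc i)}"
  using N_star_carrier
  by (auto simp: initial_module_def graded_submodule_def initial_form_span_eq graded_part_gr_module)

lemma part_N_star_nat: "graded_part N_star_module (int i) = hom_class i ` N_filt i"
  unfolding part_N_star_module by (rule gr_image_part[OF N_filt_compatible])

lemma part_N_star_subset: "graded_part N_star_module d \<subseteq> N_star"
  by (auto simp: part_N_star_module)

lemma part_N_starE:
  assumes "\<xi> \<in> graded_part N_star_module d"
  obtains (zero) "d < 0" "\<xi> = \<zero>\<^bsub>gr_module\<^esub>"
    | (hom) i x where "d = int i" "x \<in> N_filt i" "\<xi> = hom_class i x"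
proof (cases "d < 0")
  case True
  then show ?thesis using zero gr_image_part_neg[OF True, of \<xi> N_filt] assms by (auto simp: part_N_star_module)
next
  case False
  then obtain i where "d = int i" by (metis nonneg_int_cases not_less)
  then show ?thesis using hom assms part_N_star_nat by auto
qed

section \<open>Equigeneration in degree s and condition (iii)\<close>

definition strict_filtration :: bool where
  "strict_filtration \<longleftrightarrow> (\<forall>i\<ge>s. N_filt i = set_smult (max_pow (i - s)) N)"

abbreviation equigen_s :: bool where
  "equigen_s \<equiv> equigenerated_in gr_ring N_star_module (int s)"

lemma equigen_s_iff:
  "equigen_s \<longleftrightarrow> (\<exists>Y \<subseteq> hom_class s ` N. module_span gr_ring gr_module Y = N_star)"
proof -
  have "graded_part N_star_module (int s) = hom_class s ` N"
    by (simp add: part_N_star_nat N_filt_low)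
  moreover have "hom_class s ` N \<subseteq> N_star" using hom_class_N_star N_subset by auto
  moreover from this have "module_span gr_ring N_star_module Y = module_span gr_ring gr_module Y"
    if "Y \<subseteq> hom_class s ` N" for Y
    using that by (intro span_N_star_module) blast
  ultimately show ?thesis by (auto simp: equigenerated_in_def carrier_N_star_module)
qed

text \<open>The image of this family is the truncation of N* to degrees at least i: in lower degrees
  its members are too deep in the filtration to leave a nonzero class.\<close>

lemma compatible_N_max: "compatible (\<lambda>j. N \<inter> filt (max j i))"
proof (rule compatibleI)
  show "submodule (N \<inter> filt (max j i)) R M" for j by (intro submodule_Int N filt_submodule)
  show "N \<inter> filt (max j i) \<subseteq> filt j" for j using filt_antimono[of j "max j i"] by auto
  show "a \<odot>\<^bsub>M\<^esub> x \<in> N \<inter> filt (max (p + j) i)" if a: "a \<in> max_pow p" and x: "x \<in> N \<inter> filt (max j i)" for a x p j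
  proof -
    have "a \<odot>\<^bsub>M\<^esub> x \<in> filt (p + max j i)" using smult_filt a x by auto
    moreover have "filt (p + max j i) \<subseteq> filt (max (p + j) i)" by (rule filt_antimono) auto
    moreover have "a \<odot>\<^bsub>M\<^esub> x \<in> N" using submodule_smult[OF N] a x max_pow_subset by auto
    ultimately show ?thesis by auto
  qed
qed

text \<open>The generating degree is forced. Generators of degree below s vanish, and those of
  degree above s lie in the truncation of N* to degrees above s, which has no component in degree s,
  whereas some element of \<open>N\<close> has order s.\<close>

lemma equigenerated_imp_s:
  assumes "equigenerated gr_ring N_star_module" shows equigen_s
proof -
  obtain n where n: "equigenerated_in gr_ring N_star_module n"
    using assms by (auto simp: equigenerated_def)
  then obtain Y where Y: "Y \<subseteq> graded_part N_star_module n" "module_span gr_ring N_star_module Y = N_star"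
    by (auto simp: equigenerated_in_def carrier_N_star_module)
  have "n = int s"
  proof (rule ccontr)
    assume ns: "n \<noteq> int s"
    let ?D = "\<lambda>j. N \<inter> filt (max j (Suc s))"
    note D = compatible_N_max[of "Suc s"]
    note H = gr_image_submodule[OF D]
    have "Y \<subseteq> gr_image ?D"
    proof
      fix \<xi> assume "\<xi> \<in> Y"
      then have "\<xi> \<in> graded_part N_star_module n" using Y by auto
      then show "\<xi> \<in> gr_image ?D"
      proof (cases rule: part_N_starE)
        case zero then show ?thesis using submodule_zero[OF H] by simp
      next
        case (hom i x)
        show ?thesis
        proof (cases "i < s")
          case True
          then have "x \<in> filt (Suc i)" using hom(2) N_subset filt_antimono[of "Suc i" s] by (auto simp: N_filt_def)
          then show ?thesis using hom(3) hom_class_filt_Suc submodule_zero[OF H] by simp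
        next
          case False
          then have "max i (Suc s) = i" using ns hom(1) by auto
          then show ?thesis using hom hom_class_gr_image[OF D, of x i] by (simp add: N_filt_def)
        qed
      qed
    qed
    moreover have "Y \<subseteq> N_star" using Y(1) part_N_star_subset by blast
    ultimately have "N_star \<subseteq> gr_image ?D" using Y(2) module_span_minimal[OF _ H] by (metis span_N_star_module)
    moreover obtain x where x: "x \<in> N" "x \<notin> filt (Suc s)" using order_attained by auto
    ultimately have "hom_class s x \<in> gr_image ?D" using hom_class_N_star[OF x(1)] N_subset by blast
    then obtain d where d: "d \<in> filt (Suc s)" "x \<ominus>\<^bsub>M\<^esub> d \<in> filt (Suc s)"
      using hom_class_gr_imageD[OF D N_carr[OF x(1)]] by fastforce
    then have "x \<ominus>\<^bsub>M\<^esub> d \<oplus>\<^bsub>M\<^esub> d \<in> filt (Suc s)" by (intro Mf.E_add)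
    then show False using x d diff_add_cancel N_carr Mf.E_carr by simp
  qed
  then show ?thesis using n by simp
qed

text \<open>The image of this family is the submodule of N* generated by its component of degree
  s.\<close>

definition shifted :: "nat \<Rightarrow> 'c set" where
  "shifted i = (if i < s then {\<zero>\<^bsub>M\<^esub>} else set_smult (max_pow (i - s)) N)"

lemma set_smult_N_subset: "set_smult (max_pow j) N \<subseteq> filt (j + s)"
proof -
  have "set_smult (max_pow j) N \<subseteq> set_smult (max_pow j) (filt s)" using N_subset by (intro set_smult_mono) auto
  also have "\<dots> \<subseteq> filt (j + s)" unfolding filt_eq by (rule set_smult_max_pow) simp
  finally show ?thesis .
qed

lemma set_smult_max_pow_0: "set_smult (max_pow 0) N = N"
proof
  show "set_smult (max_pow 0) N \<subseteq> N" by (rule set_smult_subset[OF max_pow_subset N])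
  have "x \<in> set_smult (carrier R) N" if "x \<in> N" for x
    using set_smultI[of \<one> "carrier R" x N] that N_carr by simp
  then show "N \<subseteq> set_smult (max_pow 0) N" by (auto simp: max_pow_0)
qed

lemma shifted_compatible: "compatible shifted"
proof (rule compatibleI)
  have NM: "N \<subseteq> carrier M" using N_carr by auto
  show "submodule (shifted i) R M" for i
    unfolding shifted_def using submodule_zero_set set_smult_submodule[OF max_pow_subset NM] by simp
  show "shifted i \<subseteq> filt i" for i
    using set_smult_N_subset[of "i - s"] Mf.E_zero[of i] by (auto simp: shifted_def)
  show "a \<odot>\<^bsub>M\<^esub> x \<in> shifted (i + j)" if a: "a \<in> max_pow i" and x: "x \<in> shifted j" for a x i j
  proof (cases "j < s")
    case True
    then have "a \<odot>\<^bsub>M\<^esub> x = \<zero>\<^bsub>M\<^esub>"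
      using x smult_r_null[OF subsetD[OF max_pow_subset a]] by (simp add: shifted_def)
    moreover have "submodule (shifted (i + j)) R M"
      unfolding shifted_def using submodule_zero_set set_smult_submodule[OF max_pow_subset NM] by simp
    ultimately show ?thesis using submodule_zero by metis
  next
    case False
    then have "a \<odot>\<^bsub>M\<^esub> x \<in> set_smult (max_pow i) (set_smult (max_pow (j - s)) N)"
      using a x by (auto simp: shifted_def intro: set_smultI)
    then have "a \<odot>\<^bsub>M\<^esub> x \<in> set_smult (max_pow (i + (j - s))) N" using set_smult_max_pow[OF NM] by blast
    then show ?thesis using False by (simp add: shifted_def)
  qed
qed

lemma shifted_subset_N: "shifted i \<subseteq> N"
  using set_smult_subset[OF max_pow_subset N] submodule_zero[OF N] by (auto simp: shifted_def)

text \<open>The bound s \<le> i matters: below s the family is zero and need not contain later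
  members.\<close>

lemma shifted_antimono: "\<lbrakk>s \<le> i; i \<le> j\<rbrakk> \<Longrightarrow> shifted j \<subseteq> shifted i"
  using lift_Suc_antimono_le[of max_pow "i - s" "j - s"] max_pow_Suc_subset
    set_smult_mono[of "max_pow (j - s)" "max_pow (i - s)" N N]
  by (simp add: shifted_def)

lemma strict_filtrationI:
  assumes "\<And>i. i \<ge> s \<Longrightarrow> N_filt i \<subseteq> set_smult (max_pow (i - s)) N"
  shows strict_filtration
  unfolding strict_filtration_def
proof (intro allI impI equalityI)
  fix i assume i: "i \<ge> s"
  show "N_filt i \<subseteq> set_smult (max_pow (i - s)) N" using assms i .
  show "set_smult (max_pow (i - s)) N \<subseteq> N_filt i"
    using set_smult_N_subset[of "i - s"] set_smult_subset[OF max_pow_subset N] i by (auto simp: N_filt_def)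
qed

lemma equigen_s_imp_strict:
  assumes equigen_s shows strict_filtration
proof (rule strict_filtrationI)
  fix i assume i: "i \<ge> s"
  obtain Y where Y: "Y \<subseteq> hom_class s ` N" "module_span gr_ring gr_module Y = N_star"
    using assms by (auto simp: equigen_s_iff)
  note D = shifted_compatible
  have "hom_class s ` N \<subseteq> gr_image shifted"
    using hom_class_gr_image[OF D, of _ s] set_smult_max_pow_0 by (auto simp: shifted_def)
  then have sub: "N_star \<subseteq> gr_image shifted"
    using Y module_span_minimal[OF _ gr_image_submodule[OF D], of Y] by auto
  \<comment> \<open>Equality of classes in degree j leaves an error in \<mm>^(j+1) M, which stays in
    \<open>N\<close> because the approximating element does.\<close>
  have step: "N_filt j \<subseteq> shifted j <+>\<^bsub>M\<^esub> N_filt (Suc j)" for j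
  proof
    fix x assume x: "x \<in> N_filt j"
    have xc: "x \<in> carrier M" using x N_carr by (auto simp: N_filt_def)
    have "hom_class j x \<in> gr_image shifted" using sub hom_class_gr_image[OF N_filt_compatible x] by auto
    then obtain d where d: "d \<in> shifted j" "x \<ominus>\<^bsub>M\<^esub> d \<in> filt (Suc j)"
      using hom_class_gr_imageD[OF D xc] by auto
    have dN: "d \<in> N" using d shifted_subset_N by auto
    have "x \<ominus>\<^bsub>M\<^esub> d \<in> N_filt (Suc j)"
      using d(2) submodule_diff[OF N _ dN] x by (auto simp: N_filt_def)
    then have "d \<oplus>\<^bsub>M\<^esub> (x \<ominus>\<^bsub>M\<^esub> d) \<in> shifted j <+>\<^bsub>M\<^esub> N_filt (Suc j)" by (rule set_addI[OF d(1)])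
    moreover have "d \<oplus>\<^bsub>M\<^esub> (x \<ominus>\<^bsub>M\<^esub> d) = x"
      using diff_add_cancel[OF xc N_carr[OF dN]] xc N_carr[OF dN] by (simp add: M.a_comm)
    ultimately show "x \<in> shifted j <+>\<^bsub>M\<^esub> N_filt (Suc j)" by simp
  qed
  note sm = compatible_submodule[OF D] compatible_submodule[OF N_filt_compatible]
  have iter: "N_filt i \<subseteq> shifted i <+>\<^bsub>M\<^esub> N_filt (i + k)" for k
  proof (induction k)
    case 0 then show ?case using set_add_upper(2)[OF sm] by simp
  next
    case (Suc k)
    have "shifted (i + k) \<subseteq> shifted i" using i by (intro shifted_antimono) auto
    then have 1: "shifted (i + k) \<subseteq> shifted i <+>\<^bsub>M\<^esub> N_filt (i + Suc k)"
      using set_add_upper(1)[OF sm] by blast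
    have 2: "shifted i \<subseteq> shifted i <+>\<^bsub>M\<^esub> N_filt (i + Suc k)"
      "N_filt (i + Suc k) \<subseteq> shifted i <+>\<^bsub>M\<^esub> N_filt (i + Suc k)"
      by (rule set_add_upper[OF sm])+
    have S: "submodule (shifted i <+>\<^bsub>M\<^esub> N_filt (i + Suc k)) R M" by (intro submodule_set_add sm)
    have "N_filt (i + k) \<subseteq> shifted i <+>\<^bsub>M\<^esub> N_filt (i + Suc k)"
      using step[of "i + k"] set_add_minimal[OF S 1] 2(2) by auto
    then show ?case using Suc set_add_minimal[OF S 2(1)] by blast
  qed
  \<comment> \<open>With the Artin--Rees constant c, going c degrees further suffices: N \<inter>
    \<mm>^(i+c) M already lies in \<mm>^(i-s) N, so the error term is absorbed.\<close>
  obtain c where c: "\<And>j. N \<inter> filt (c + j) \<subseteq> set_smult (max_pow j) N" using Artin_Rees_weak[OF N] by blast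
  have "N_filt (i + c) \<subseteq> N \<inter> filt (c + (i - s))"
    using filt_antimono[of "c + (i - s)" "i + c"] i unfolding N_filt_def by force
  also have "\<dots> \<subseteq> shifted i" using c[of "i - s"] i by (simp only: shifted_def not_less[symmetric] if_False)
  finally have "shifted i <+>\<^bsub>M\<^esub> N_filt (i + c) \<subseteq> shifted i" by (intro set_add_minimal sm) auto
  then show "N_filt i \<subseteq> set_smult (max_pow (i - s)) N" using iter[of c] i by (auto simp: shifted_def)
qed

section \<open>Minimal generating sets and standard bases\<close>

definition generates :: "'c set \<Rightarrow> bool" where
  "generates Y \<longleftrightarrow> Y \<subseteq> N \<and> module_span R M Y = N"

definition rank :: nat where
  "rank = min_number_generators R (M\<lparr>carrier := N\<rparr>)"

lemma generates_iff:
  "generates Y \<longleftrightarrow> Y \<subseteq> carrier (M\<lparr>carrier := N\<rparr>) \<and>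
     module_span R (M\<lparr>carrier := N\<rparr>) Y = carrier (M\<lparr>carrier := N\<rparr>)"
  using module_span_restrict[OF group_add N, of Y] by (auto simp: generates_def)

lemma rank_eq: "rank = (LEAST n. \<exists>Y. generates Y \<and> finite Y \<and> card Y = n)"
  unfolding rank_def min_number_generators_def generates_iff
  by (rule arg_cong[of _ _ Least]) auto

lemma rank_le: "\<lbrakk>generates Y; finite Y\<rbrakk> \<Longrightarrow> rank \<le> card Y"
  unfolding rank_eq by (intro Least_le) auto

lemma rank_attained: "\<exists>Y. generates Y \<and> finite Y \<and> card Y = rank"
proof -
  obtain Y where "finite Y" "module_span R M Y = N"
    using fin_gen_submodule[OF N] by (auto simp: fin_gen_def)
  then have "\<exists>n Y. generates Y \<and> finite Y \<and> card Y = n"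
    using module_span_inc[of Y R M] by (auto simp: generates_def)
  then show ?thesis unfolding rank_eq by (rule LeastI_ex)
qed

text \<open>Infinite sets have \<open>card\<close> 0, so a positive rank makes a set with
  \<open>card Y = rank\<close> finite.\<close>

lemma rank_pos: "rank > 0"
  using rank_attained N_nonzero by (auto simp: generates_def module_span_empty)

lemma minimal_generating_iff:
  "minimal_generating_set R (M\<lparr>carrier := N\<rparr>) Y \<longleftrightarrow> generates Y \<and> (\<forall>Z. Z \<subset> Y \<longrightarrow> \<not> generates Z)"
  unfolding minimal_generating_set_def generates_iff by (meson order_trans psubset_imp_subset)

lemma standard_basis_iff:
  "standard_basis R \<mm> M N Y \<longleftrightarrow> finite Y \<and> Y \<subseteq> N \<and>
     module_span gr_ring gr_module (initial_form R \<mm> M ` (Y - {\<zero>\<^bsub>M\<^esub>})) = N_star"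
  by (simp add: standard_basis_def initial_form_span_eq initial_form_span_def[of R \<mm> M Y])

text \<open>By strictness, elements of N \<inter> \<mm>^i M lie in \<mm>^(i-s) N, so their classes
  are generated by classes of degree s; degrees below s contribute zero.\<close>

lemma span_hom_class_generators:
  assumes strict: strict_filtration and H: "submodule H gr_ring gr_module"
    and Y: "generates Y" "\<And>y. y \<in> Y \<Longrightarrow> hom_class s y \<in> H"
  shows "N_star \<subseteq> H"
proof (rule gr_image_subset[OF H N_filt_compatible])
  have P: "submodule {x \<in> N. hom_class s x \<in> H} R M"
    by (rule hom_class_preimage_submodule[OF H N N_subset])
  have "N \<subseteq> {x \<in> N. hom_class s x \<in> H}"
    using module_span_minimal[OF _ P, of Y] Y by (auto simp: generates_def)
  then have sH: "x \<in> N \<Longrightarrow> hom_class s x \<in> H" for x by auto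
  fix i x assume x: "x \<in> N_filt i"
  show "hom_class i x \<in> H"
  proof (cases "i < s")
    case True
    then have "x \<in> filt (Suc i)" using x N_subset filt_antimono[of "Suc i" s] by (auto simp: N_filt_def)
    then show ?thesis using hom_class_filt_Suc submodule_zero[OF H] by simp
  next
    case False
    then have "x \<in> set_smult (max_pow (i - s)) N" using strict x by (auto simp: strict_filtration_def)
    from hom_class_set_smult[OF H N N_subset sH this] show ?thesis using False by simp
  qed
qed

text \<open>If y were in \<mm> N, the remaining generators would generate \<open>N\<close> modulo
  \<mm> N, hence generate \<open>N\<close> by Nakayama's lemma.\<close>

lemma minimal_generator_notin:
  assumes "generates Y" "\<And>Z. Z \<subset> Y \<Longrightarrow> \<not> generates Z" "y \<in> Y"
  shows "y \<notin> set_smult \<mm> N"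
proof
  assume y: "y \<in> set_smult \<mm> N"
  have YN: "Y \<subseteq> N" and sY: "module_span R M Y = N" using assms by (auto simp: generates_def)
  let ?W = "module_span R M (Y - {y})"
  have W: "submodule ?W R M" using YN N_carr by (intro span_submodule) auto
  have WN: "?W \<subseteq> N" using YN by (intro module_span_minimal N) auto
  have mN: "submodule (set_smult \<mm> N) R M" using max_subset N_carr by (intro set_smult_submodule) auto
  note up = set_add_upper[OF W mN]
  have "Y \<subseteq> ?W <+>\<^bsub>M\<^esub> set_smult \<mm> N"
    using y up module_span_inc[of "Y - {y}" R M] by blast
  then have "N \<subseteq> ?W <+>\<^bsub>M\<^esub> set_smult \<mm> N"
    using sY module_span_minimal[OF _ submodule_set_add[OF W mN], of Y] by simp
  then have "N = ?W" by (rule Nakayama[OF N fin_gen_submodule[OF N] W WN])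
  then have "generates (Y - {y})" using YN unfolding generates_def by blast
  moreover have "Y - {y} \<subset> Y" using assms(3) by auto
  ultimately show False using assms(2) by blast
qed

text \<open>Strictness at s + 1 says N \<inter> \<mm>^(s+1) M = \<mm> N, which contains no minimal
  generator; so all of them have order exactly s and their initial forms are the classes of degree
  s.\<close>

lemma strict_imp_standard_basis:
  assumes strict: strict_filtration
    and Y: "minimal_generating_set R (M\<lparr>carrier := N\<rparr>) Y" "card Y = rank"
  shows "standard_basis R \<mm> M N Y \<and> (\<forall>y\<in>Y. ord y = s)"
proof -
  have gen: "generates Y" and min: "\<And>Z. Z \<subset> Y \<Longrightarrow> \<not> generates Z"
    using Y(1) by (auto simp: minimal_generating_iff)
  have YN: "Y \<subseteq> N" using gen by (simp add: generates_def)
  have fin: "finite Y" using rank_pos Y(2) by (intro card_ge_0_finite) simp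
  have ord: "ord y = s" and nz: "y \<noteq> \<zero>\<^bsub>M\<^esub>" if y: "y \<in> Y" for y
  proof -
    have "N_filt (Suc s) = set_smult \<mm> N"
      using strict by (simp add: strict_filtration_def max_pow_1)
    then have "y \<notin> filt (Suc s)"
      using minimal_generator_notin[OF gen min y] y YN by (auto simp: N_filt_def)
    moreover have "y \<in> filt s" using y YN N_subset by auto
    ultimately show "ord y = s" "y \<noteq> \<zero>\<^bsub>M\<^esub>" using elem_order_eq Mf.E_zero by auto
  qed
  let ?H = "module_span gr_ring gr_module (initial_form R \<mm> M ` (Y - {\<zero>\<^bsub>M\<^esub>}))"
  have iY: "initial_form R \<mm> M ` (Y - {\<zero>\<^bsub>M\<^esub>}) \<subseteq> N_star" using initial_forms_subset YN by blast
  have H: "submodule ?H gr_ring gr_module" by (rule gr_span_submodule[OF iY])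
  have "hom_class s y \<in> ?H" if "y \<in> Y" for y
  proof -
    have "initial_form R \<mm> M y \<in> ?H"
      using that nz[OF that] by (intro subsetD[OF module_span_inc] imageI) simp
    then show ?thesis using ord[OF that] initial_form_eq[of y] by simp
  qed
  then have "N_star \<subseteq> ?H" by (rule span_hom_class_generators[OF strict H gen])
  moreover have "?H \<subseteq> N_star" by (rule module_span_minimal[OF iY N_star_submodule])
  ultimately show ?thesis using fin YN ord by (auto simp: standard_basis_iff)
qed

lemma minimal_generating_exists:
  "\<exists>Y. minimal_generating_set R (M\<lparr>carrier := N\<rparr>) Y \<and> card Y = rank"
proof -
  obtain Y where Y: "generates Y" "finite Y" "card Y = rank" using rank_attained by blast
  have "\<not> generates Z" if "Z \<subset> Y" for Z
    using rank_le[of Z] psubset_card_mono[OF Y(2) that] Y(2,3) that finite_subset[of Z Y] by auto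
  then show ?thesis using Y by (auto simp: minimal_generating_iff)
qed

lemma standard_basis_imp_equigen_s:
  assumes "standard_basis R \<mm> M N Y" "\<forall>y\<in>Y. ord y = s"
  shows equigen_s
proof -
  have "initial_form R \<mm> M ` (Y - {\<zero>\<^bsub>M\<^esub>}) \<subseteq> hom_class s ` N"
    using assms by (auto simp: standard_basis_iff initial_form_eq)
  then show ?thesis using assms(1) by (auto simp: standard_basis_iff equigen_s_iff)
qed

section \<open>Homogeneous generators of the initial module\<close>

abbreviation homogeneous_generators :: "(nat \<Rightarrow> 'c set) set \<Rightarrow> bool" where
  "homogeneous_generators Y \<equiv> Y \<subseteq> (\<Union>j. graded_part N_star_module j) \<and> finite Y \<and>
     module_span gr_ring gr_module Y = N_star"

lemma homogeneous_rank_eq: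
  "min_number_homogeneous_generators gr_ring N_star_module =
     (LEAST n. \<exists>Y. homogeneous_generators Y \<and> card Y = n)"
proof -
  have "(\<exists>Y\<subseteq>\<Union>j. graded_part N_star_module j.
           finite Y \<and> card Y = n \<and> module_span gr_ring N_star_module Y = N_star)
     \<longleftrightarrow> (\<exists>Y. homogeneous_generators Y \<and> card Y = n)" for n
  proof -
    have "module_span gr_ring N_star_module Y = module_span gr_ring gr_module Y"
      if "Y \<subseteq> (\<Union>j. graded_part N_star_module j)" for Y
      using that part_N_star_subset by (intro span_N_star_module) blast
    then show ?thesis by (metis (no_types, lifting))
  qed
  then show ?thesis by (simp add: min_number_homogeneous_generators_def carrier_N_star_module)
qed

text \<open>Lifting the generators of degree \<open>s\<close> gives generators of \<open>N\<close> modulo \<open>\<mm> N\<close>, hence of \<open>N\<close>.\<close>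

lemma rank_le_homogeneous:
  assumes eq: "N_filt (Suc s) = set_smult \<mm> N" and Y: "homogeneous_generators Y"
  shows "rank \<le> card (Y \<inter> graded_part N_star_module (int s))"
proof -
  let ?Ys = "Y \<inter> graded_part N_star_module (int s)"
  have "\<exists>x\<in>N. \<xi> = hom_class s x" if "\<xi> \<in> ?Ys" for \<xi>
    using that by (auto simp: part_N_star_nat N_filt_low)
  then obtain f where f: "\<And>\<xi>. \<xi> \<in> ?Ys \<Longrightarrow> f \<xi> \<in> N" "\<And>\<xi>. \<xi> \<in> ?Ys \<Longrightarrow> \<xi> = hom_class s (f \<xi>)" by metis
  let ?W = "module_span R M (f ` ?Ys)"
  have fN: "f ` ?Ys \<subseteq> N" using f by auto
  have W: "submodule ?W R M" using fN N_carr by (intro span_submodule) auto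
  have WN: "?W \<subseteq> N" by (rule module_span_minimal[OF fN N])
  have mN: "submodule (set_smult \<mm> N) R M" using max_subset N_carr by (intro set_smult_submodule) auto
  let ?V = "?W <+>\<^bsub>M\<^esub> set_smult \<mm> N"
  have V: "submodule ?V R M" by (intro submodule_set_add W mN)
  have VN: "?V \<subseteq> N" using WN set_smult_subset[OF max_subset N] by (intro set_add_minimal N)
  \<comment> \<open>Degree s is limited to the lifted generators modulo \<mm> N, while nothing is
    restricted above s. The image still contains all of \<open>Y\<close>, hence N*, and its degree s
    will show that \<open>?V\<close> is all of \<open>N\<close>.\<close>
  define D where "D = (\<lambda>i. if i \<le> s then ?V else N_filt i)"
  have D: "compatible D"
  proof (rule compatibleI)
    show "submodule (D i) R M" for i
      using V compatible_submodule[OF N_filt_compatible] by (simp add: D_def)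
    show "D i \<subseteq> filt i" for i
      using VN N_filt_low[of i] by (auto simp: D_def N_filt_def)
    fix i j a x assume a: "a \<in> max_pow i" and x: "x \<in> D j"
    have xN: "x \<in> N_filt j" using x VN N_filt_low[of j] by (auto simp: D_def split: if_splits)
    then have "a \<odot>\<^bsub>M\<^esub> x \<in> N_filt (i + j)" using N_filt_compatible a by (auto simp: compatible_def)
    moreover have "a \<odot>\<^bsub>M\<^esub> x \<in> ?V" if "i + j \<le> s"
      using submodule_smult[OF V] a x max_pow_subset that by (auto simp: D_def)
    ultimately show "a \<odot>\<^bsub>M\<^esub> x \<in> D (i + j)" by (auto simp: D_def)
  qed
  note H = gr_image_submodule[OF D]
  have "Y \<subseteq> gr_image D"
  proof
    fix \<xi> assume xi: "\<xi> \<in> Y"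
    then obtain d where d: "\<xi> \<in> graded_part N_star_module d" using Y by auto
    then show "\<xi> \<in> gr_image D"
    proof (cases rule: part_N_starE)
      case zero then show ?thesis using submodule_zero[OF H] by simp
    next
      case (hom i x)
      consider "i < s" | "i = s" | "i > s" by linarith
      then show ?thesis
      proof cases
        case 1
        then have "x \<in> filt (Suc i)" using hom(2) N_subset filt_antimono[of "Suc i" s] by (auto simp: N_filt_def)
        then show ?thesis using hom(3) hom_class_filt_Suc submodule_zero[OF H] by simp
      next
        case 2
        then have xs: "\<xi> \<in> ?Ys" using xi d hom(1) by simp
        then have "f \<xi> \<in> ?W" using module_span_inc[of "f ` ?Ys" R M] by auto
        then have "f \<xi> \<in> D s" using set_add_upper(1)[OF W mN] by (auto simp: D_def)
        then have "hom_class s (f \<xi>) \<in> gr_image D" by (rule hom_class_gr_image[OF D])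
        then show ?thesis using f(2)[OF xs] by simp
      next
        case 3
        then show ?thesis using hom hom_class_gr_image[OF D, of x i] by (simp add: D_def)
      qed
    qed
  qed
  then have sub: "N_star \<subseteq> gr_image D" using Y module_span_minimal[OF _ H, of Y] by simp
  have "N \<subseteq> ?V"
  proof
    fix x assume x: "x \<in> N"
    have "hom_class s x \<in> gr_image D" using sub hom_class_N_star[OF x] N_subset x by blast
    then obtain d where d: "d \<in> ?V" "x \<ominus>\<^bsub>M\<^esub> d \<in> filt (Suc s)"
      using hom_class_gr_imageD[OF D N_carr[OF x], of s] by (auto simp: D_def)
    have dN: "d \<in> N" using d VN by auto
    \<comment> \<open>Here the hypothesis on N \<inter> \<mm>^(s+1) M turns equality of classes in
      degree s into congruence modulo \<mm> N, as Nakayama's lemma requires.\<close>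
    then have "x \<ominus>\<^bsub>M\<^esub> d \<in> set_smult \<mm> N"
      using d(2) submodule_diff[OF N x dN] eq by (auto simp: N_filt_def)
    then have "x \<ominus>\<^bsub>M\<^esub> d \<in> ?V" using set_add_upper(2)[OF W mN] by blast
    then have "x \<ominus>\<^bsub>M\<^esub> d \<oplus>\<^bsub>M\<^esub> d \<in> ?V" using d(1) by (rule submodule_add[OF V])
    then show "x \<in> ?V" using diff_add_cancel N_carr x dN by simp
  qed
  then have "N = ?W" by (rule Nakayama[OF N fin_gen_submodule[OF N] W WN])
  then have "generates (f ` ?Ys)" using fN unfolding generates_def by blast
  moreover have "finite ?Ys" using Y by simp
  ultimately show ?thesis using rank_le[of "f ` ?Ys"] card_image_le[of ?Ys f] by simp
qed

text \<open>The initial forms of a minimal generating set give the upper bound, since passing to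
  initial forms cannot increase the cardinality; \<open>rank_le_homogeneous\<close> gives the lower
  one.\<close>

lemma strict_imp_homogeneous_rank:
  assumes strict: strict_filtration
  shows "min_number_homogeneous_generators gr_ring N_star_module = rank"
proof -
  have eq: "N_filt (Suc s) = set_smult \<mm> N"
    using strict by (simp add: strict_filtration_def max_pow_1)
  obtain Y where Y: "minimal_generating_set R (M\<lparr>carrier := N\<rparr>) Y" "card Y = rank"
    using minimal_generating_exists by blast
  have sb: "standard_basis R \<mm> M N Y" and ord: "\<forall>y\<in>Y. ord y = s"
    using strict_imp_standard_basis[OF strict Y] by auto
  let ?Y = "initial_form R \<mm> M ` (Y - {\<zero>\<^bsub>M\<^esub>})"
  have "?Y \<subseteq> graded_part N_star_module (int s)"
    using sb ord by (auto simp: standard_basis_iff initial_form_eq part_N_star_nat N_filt_low)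
  then have hg: "homogeneous_generators ?Y" using sb by (auto simp: standard_basis_iff)
  have fin: "finite Y" using sb by (simp add: standard_basis_iff)
  have "card ?Y \<le> card (Y - {\<zero>\<^bsub>M\<^esub>})" using fin by (intro card_image_le) simp
  also have "\<dots> \<le> rank" using card_mono[OF fin, of "Y - {\<zero>\<^bsub>M\<^esub>}"] Y(2) by simp
  finally have upp: "card ?Y \<le> rank" .
  have low: "rank \<le> card Z" if "homogeneous_generators Z" for Z
    using rank_le_homogeneous[OF eq that] card_mono[of Z "Z \<inter> graded_part N_star_module (int s)"] that by auto
  have "card ?Y = rank" using upp low[OF hg] by (rule le_antisym)
  then show ?thesis
    unfolding homogeneous_rank_eq using hg low by (intro Least_equality) auto
qed

text \<open>Artin--Rees bounds the degrees in which generators of the initial module are needed.\<close>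

lemma homogeneous_generators_exist: "\<exists>Y. homogeneous_generators Y"
proof -
  obtain c where c: "\<And>j. j \<ge> c \<Longrightarrow> N \<inter> filt (Suc j) \<subseteq> set_smult \<mm> (N \<inter> filt j)"
    using Artin_Rees[OF N] by blast
  note sm = compatible_submodule[OF N_filt_compatible]
  have "\<exists>Z. finite Z \<and> module_span R M Z = N_filt j" for j
    using fin_gen_submodule[OF sm, of j] unfolding fin_gen_def by blast
  then obtain Z where Z: "\<And>j. finite (Z j)" "\<And>j. module_span R M (Z j) = N_filt j" by metis
  have ZN: "Z j \<subseteq> N_filt j" for j using module_span_inc[of "Z j" R M] Z(2) by auto
  \<comment> \<open>Classes of R-module generators of N \<inter> \<mm>^j M for the finitely many
    degrees up to the Artin--Rees constant.\<close>
  let ?Y = "\<Union>j\<le>c. hom_class j ` Z j"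
  have Yp: "?Y \<subseteq> (\<Union>j. graded_part N_star_module j)"
  proof
    fix \<xi> assume "\<xi> \<in> ?Y"
    then obtain j z where "z \<in> Z j" "\<xi> = hom_class j z" by auto
    then have "\<xi> \<in> graded_part N_star_module (int j)" using ZN by (auto simp: part_N_star_nat)
    then show "\<xi> \<in> (\<Union>j. graded_part N_star_module j)" by blast
  qed
  then have YN: "?Y \<subseteq> N_star" using part_N_star_subset by blast
  let ?H = "module_span gr_ring gr_module ?Y"
  have H: "submodule ?H gr_ring gr_module" by (rule gr_span_submodule[OF YN])
  have hom: "hom_class j x \<in> ?H" if "x \<in> N_filt j" for j x
    using that
  proof (induction j arbitrary: x rule: less_induct)
    case (less j)
    show ?case
    proof (cases "j \<le> c")
      case True
      have P: "submodule {x \<in> N_filt j. hom_class j x \<in> ?H} R M"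
        by (rule hom_class_preimage_submodule[OF H sm]) (simp add: N_filt_def)
      have "Z j \<subseteq> {x \<in> N_filt j. hom_class j x \<in> ?H}"
        using ZN[of j] True module_span_inc[of ?Y gr_ring gr_module] by blast
      then show ?thesis using module_span_minimal[OF _ P, of "Z j"] Z(2) less.prems by auto
    next
      \<comment> \<open>Above degree c each element is an \<mm>-combination of elements one degree
        lower.\<close>
      case False
      then obtain i where i: "j = Suc i" "i \<ge> c" by (cases j) auto
      have "x \<in> set_smult (max_pow 1) (N_filt i)"
        using c[OF i(2)] less.prems i(1) by (auto simp: N_filt_def max_pow_1)
      from hom_class_set_smult[OF H sm _ _ this, of i] show ?thesis
        using less.IH[of i] i(1) by (simp add: N_filt_def)
    qed
  qed
  have "N_star \<subseteq> ?H" by (rule gr_image_subset[OF H N_filt_compatible hom])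
  moreover have "?H \<subseteq> N_star" by (rule module_span_minimal[OF YN N_star_submodule])
  ultimately have "?H = N_star" by blast
  then show ?thesis using Yp Z(1) by (intro exI[of _ ?Y]) auto
qed

text \<open>A smallest homogeneous generating set has as many elements as the rank of
  \<open>N\<close>, and at least that many of them must have degree s; so there are no
  others.\<close>

lemma homogeneous_rank_imp_equigen_s:
  assumes eq: "N_filt (Suc s) = set_smult \<mm> N"
    and rank: "min_number_homogeneous_generators gr_ring N_star_module = rank"
  shows equigen_s
proof -
  have "\<exists>n Y. homogeneous_generators Y \<and> card Y = n" using homogeneous_generators_exist by blast
  then have "\<exists>Y. homogeneous_generators Y \<and> card Y = rank"
    unfolding rank[symmetric] homogeneous_rank_eq by (rule LeastI_ex)
  then obtain Y where Y: "homogeneous_generators Y" "card Y = rank" by blast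
  have "card Y \<le> card (Y \<inter> graded_part N_star_module (int s))"
    using rank_le_homogeneous[OF eq Y(1)] Y(2) by simp
  then have "Y \<inter> graded_part N_star_module (int s) = Y"
    using Y(1) by (intro card_seteq) auto
  then have "Y \<subseteq> hom_class s ` N" by (auto simp: part_N_star_nat N_filt_low)
  then show ?thesis using Y(1) by (auto simp: equigen_s_iff)
qed

end

section \<open>The isomorphism with the associated graded module\<close>

text \<open>The theory is instantiated a second time, with \<open>N\<close> as the module, to make
  the associated graded module of \<open>N\<close> available.\<close>

sublocale initial_setting \<subseteq> L: local_module R \<mm> "M\<lparr>carrier := N\<rparr>"
  using noetherian_local_ring_axioms restrict_module_module[OF N]
  by (rule local_module.intro)

context initial_setting
begin

lemma finsum_restrict:
  assumes "finite I" "\<And>i. i \<in> I \<Longrightarrow> f i \<in> N"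
  shows "finsum (M\<lparr>carrier := N\<rparr>) f I = finsum M f I"
  using assms
proof (induction I rule: finite_induct)
  case (insert i I)
  have "finsum (M\<lparr>carrier := N\<rparr>) f (insert i I) = f i \<oplus>\<^bsub>M\<^esub> finsum (M\<lparr>carrier := N\<rparr>) f I"
    using insert by (subst L.M.finsum_insert) auto
  also have "\<dots> = finsum M f (insert i I)"
    using insert N_carr by (subst M.finsum_insert) auto
  finally show ?case .
qed simp

lemma filt_N: "L.filt i = set_smult (max_pow i) N"
  unfolding adic_filtration_def by (rule ideal_smult_restrict[OF max_pow_subset N])

lemma N_coset: "(\<lambda>x. H +>\<^bsub>M\<lparr>carrier := N\<rparr>\<^esub> x) = (\<lambda>x. H +>\<^bsub>M\<^esub> x)"
  by (simp add: a_r_coset_def r_coset_def)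

lemma N_coset_inter:
  assumes "x \<in> N" "submodule H R M"
  shows "(H +>\<^bsub>M\<^esub> x) \<inter> N = (H \<inter> N) +>\<^bsub>M\<^esub> x"
proof -
  have "h \<in> N" if "h \<in> H" "h \<oplus>\<^bsub>M\<^esub> x \<in> N" for h
    using submodule_add_cancel[OF N assms(1), of h] that submodule_carr[OF assms(2)] N_carr[OF assms(1)]
    by (simp add: M.a_comm)
  then show ?thesis using submodule_add[OF N _ assms(1)] by (auto simp: a_r_coset_def')
qed

text \<open>Inverse to the map that the inclusion of \<open>N\<close> induces on cosets: under
  (iii), intersecting a coset of \<mm>^(i+s+1) M with \<open>N\<close> leaves a coset of \<mm>^(i+1)
  N. No representatives have to be chosen.\<close>

definition restrict_shift :: "(nat \<Rightarrow> 'c set) \<Rightarrow> nat \<Rightarrow> 'c set" where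
  "restrict_shift \<xi> = (\<lambda>i. \<xi> (i + s) \<inter> N)"

text \<open>Representatives normalized to 0 in the degrees that the shift forgets. Since N
  \<subseteq> \<mm>^s M, every element of N* has one, and convolutions then lose nothing below
  degree s.\<close>

definition high_reps :: "(nat \<Rightarrow> 'c) set" where
  "high_reps = {x \<in> Mf.gr_reps N_filt. \<forall>i<s. x i = \<zero>\<^bsub>M\<^esub>}"

lemma N_star_high_reps: "N_star = Mf.gr_class ` high_reps"
proof (intro equalityI subsetI)
  fix \<xi> assume "\<xi> \<in> N_star"
  then obtain x where x: "x \<in> Mf.gr_reps N_filt" "\<xi> = Mf.gr_class x" by (auto simp: gr_image_def)
  let ?y = "\<lambda>i. if i < s then \<zero>\<^bsub>M\<^esub> else x i"
  have "{i. ?y i \<noteq> \<zero>\<^bsub>M\<^esub>} \<subseteq> {i. x i \<noteq> \<zero>\<^bsub>M\<^esub>}" by auto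
  then have "finite {i. ?y i \<noteq> \<zero>\<^bsub>M\<^esub>}"
    by (rule finite_subset) (use x(1) in \<open>simp add: Mf.gr_reps_def\<close>)
  then have "?y \<in> high_reps"
    using x(1) submodule_zero[OF compatible_submodule[OF N_filt_compatible]]
    by (auto simp: high_reps_def Mf.gr_reps_def)
  moreover have "Mf.gr_class x = Mf.gr_class ?y"
  proof
    fix i
    have "x i \<in> filt (Suc i)" if "i < s"
      using Mf.gr_repsD[OF x(1), of i] N_subset filt_antimono[of "Suc i" s] that by (auto simp: N_filt_def)
    then show "Mf.gr_class x i = Mf.gr_class ?y i"
      using Mf.coset_eq_self_iff[of "x i" "Suc i"] Mf.coset_zero[of "Suc i"] Mf.E_carr[of "x i" "Suc i"]
      by (simp add: Mf.gr_class_def)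
  qed
  ultimately show "\<xi> \<in> Mf.gr_class ` high_reps" using x(2) by blast
qed (auto simp: gr_image_def high_reps_def)

lemma high_reps_N: "x \<in> high_reps \<Longrightarrow> x i \<in> N"
  using Mf.gr_repsD[of x N_filt] by (auto simp: high_reps_def N_filt_def)

context
  assumes strict: strict_filtration
begin

lemma strict_filt: "L.filt i = N \<inter> filt (i + s)"
  using strict by (simp add: filt_N strict_filtration_def N_filt_def)

lemma restrict_shift_class:
  assumes "\<And>i. x i \<in> N"
  shows "restrict_shift (Mf.gr_class x) = L.Mf.gr_class (\<lambda>i. x (i + s))"
  using N_coset_inter[OF assms filt_submodule]
  by (auto simp: restrict_shift_def Mf.gr_class_def L.Mf.gr_class_def N_coset strict_filt fun_eq_iff Int_commute)

lemma high_reps_shift: "x \<in> high_reps \<Longrightarrow> (\<lambda>i. x (i + s)) \<in> L.Mf.gr_reps L.filt"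
proof -
  assume x: "x \<in> high_reps"
  have "finite ((\<lambda>i. i + s) -` {i. x i \<noteq> \<zero>\<^bsub>M\<^esub>})"
    using x by (intro finite_vimageI) (auto simp: high_reps_def Mf.gr_reps_def inj_def)
  then show ?thesis
    using x Mf.gr_repsD[of x N_filt] by (auto simp: high_reps_def L.Mf.gr_reps_def strict_filt N_filt_def vimage_def)
qed

lemma restrict_shift_image: "restrict_shift ` N_star = carrier L.gr_module"
proof (intro equalityI subsetI)
  fix \<eta> assume "\<eta> \<in> restrict_shift ` N_star"
  then show "\<eta> \<in> carrier L.gr_module"
    using restrict_shift_class high_reps_N high_reps_shift
    by (auto simp: N_star_high_reps L.carrier_gr_module)
next
  fix \<eta> assume "\<eta> \<in> carrier L.gr_module"
  then obtain y where y: "y \<in> L.Mf.gr_reps L.filt" "\<eta> = L.Mf.gr_class y" by (auto simp: L.carrier_gr_module)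
  \<comment> \<open>A preimage is obtained by padding with s zeros in front.\<close>
  let ?x = "\<lambda>i. if i < s then \<zero>\<^bsub>M\<^esub> else y (i - s)"
  have "{i. ?x i \<noteq> \<zero>\<^bsub>M\<^esub>} \<subseteq> (\<lambda>i. i + s) ` {i. y i \<noteq> \<zero>\<^bsub>M\<^esub>}"
    by (auto split: if_splits intro!: image_eqI[of _ _ "_ - s"])
  then have fin: "finite {i. ?x i \<noteq> \<zero>\<^bsub>M\<^esub>}"
    by (rule finite_subset) (use y(1) in \<open>auto simp: L.Mf.gr_reps_def\<close>)
  have yi: "y i \<in> N \<inter> filt (i + s)" for i using L.Mf.gr_repsD[OF y(1)] strict_filt by auto
  have "?x i \<in> N_filt i" for i
    using yi[of "i - s"] submodule_zero[OF N] Mf.E_zero[of i] by (auto simp: N_filt_def)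
  then have "?x \<in> high_reps" using fin by (auto simp: high_reps_def Mf.gr_reps_def)
  moreover from high_reps_N[OF this] have "restrict_shift (Mf.gr_class ?x) = \<eta>"
    using y(2) by (subst restrict_shift_class) simp_all
  ultimately show "\<eta> \<in> restrict_shift ` N_star" unfolding N_star_high_reps by blast
qed

lemma restrict_shift_inj: "inj_on restrict_shift N_star"
proof (rule inj_onI)
  fix \<xi> \<eta> assume "\<xi> \<in> N_star" "\<eta> \<in> N_star" and eq: "restrict_shift \<xi> = restrict_shift \<eta>"
  then obtain x y where x: "x \<in> high_reps" "\<xi> = Mf.gr_class x" and y: "y \<in> high_reps" "\<eta> = Mf.gr_class y"
    by (auto simp: N_star_high_reps)
  have "Mf.gr_class x i = Mf.gr_class y i" for i
  proof (cases "i < s")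
    case True then show ?thesis using x(1) y(1) by (simp add: high_reps_def Mf.gr_class_def)
  next
    case False
    have "L.Mf.gr_class (\<lambda>i. x (i + s)) = L.Mf.gr_class (\<lambda>i. y (i + s))"
      using eq restrict_shift_class high_reps_N x y by simp
    then have "x i \<ominus>\<^bsub>M\<lparr>carrier := N\<rparr>\<^esub> y i \<in> L.filt (Suc (i - s))"
      using L.Mf.gr_class_eq_iff[of "\<lambda>i. x (i + s)" "\<lambda>i. y (i + s)"] high_reps_N x(1) y(1) False
      by (auto dest!: spec[of _ "i - s"])
    \<comment> \<open>The inverse in a record depends on its carrier, so the two subtractions have
      to be identified.\<close>
    moreover have "x i \<ominus>\<^bsub>M\<lparr>carrier := N\<rparr>\<^esub> y i = x i \<ominus>\<^bsub>M\<^esub> y i"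
    proof -
      have "\<ominus>\<^bsub>M\<lparr>carrier := N\<rparr>\<^esub> y i = \<ominus>\<^bsub>M\<^esub> y i"
        using high_reps_N[OF y(1)] N_carr submodule_minus[OF N]
        by (intro L.M.minus_equality) (auto simp: M.l_neg)
      then show ?thesis by (simp add: a_minus_def)
    qed
    ultimately have "x i \<ominus>\<^bsub>M\<^esub> y i \<in> filt (Suc i)" using False by (auto simp: strict_filt)
    then show ?thesis
      using Mf.coset_eq_iff[of "x i" "y i" "Suc i"] high_reps_N N_carr x(1) y(1) by (simp add: Mf.gr_class_def)
  qed
  then show "\<xi> = \<eta>" using x y by auto
qed

lemma restrict_shift_add:
  assumes "\<xi> \<in> N_star" "\<eta> \<in> N_star"
  shows "restrict_shift (\<xi> \<oplus>\<^bsub>gr_module\<^esub> \<eta>) = restrict_shift \<xi> \<oplus>\<^bsub>L.gr_module\<^esub> restrict_shift \<eta>"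
proof -
  obtain x y where x: "x \<in> high_reps" "\<xi> = Mf.gr_class x" and y: "y \<in> high_reps" "\<eta> = Mf.gr_class y"
    using assms by (auto simp: N_star_high_reps)
  have "restrict_shift (\<xi> \<oplus>\<^bsub>gr_module\<^esub> \<eta>) = restrict_shift (Mf.gr_class (\<lambda>i. x i \<oplus>\<^bsub>M\<^esub> y i))"
    unfolding x(2) y(2) using high_reps_N N_carr x(1) y(1) by (subst add_gr_module) auto
  also have "\<dots> = L.Mf.gr_class (\<lambda>i. x (i + s) \<oplus>\<^bsub>M\<^esub> y (i + s))"
    using high_reps_N x(1) y(1) submodule_add[OF N] by (intro restrict_shift_class) auto
  also have "\<dots> = L.Mf.gr_class (\<lambda>i. x (i + s)) \<oplus>\<^bsub>L.gr_module\<^esub> L.Mf.gr_class (\<lambda>i. y (i + s))"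
    using high_reps_N x(1) y(1) by (subst L.add_gr_module) auto
  finally show ?thesis using restrict_shift_class high_reps_N x y by simp
qed

lemma restrict_shift_smult:
  assumes \<alpha>: "\<alpha> \<in> carrier gr_ring" and \<xi>: "\<xi> \<in> N_star"
  shows "restrict_shift (\<alpha> \<odot>\<^bsub>gr_module\<^esub> \<xi>) = \<alpha> \<odot>\<^bsub>L.gr_module\<^esub> restrict_shift \<xi>"
proof -
  obtain x where x: "x \<in> high_reps" "\<xi> = Mf.gr_class x" using \<xi> by (auto simp: N_star_high_reps)
  obtain a where a: "a \<in> Rf.gr_reps max_pow" "\<alpha> = Rf.gr_class a" using \<alpha> by (auto simp: carrier_gr_ring)
  have ac: "a i \<in> carrier R" for i using Rf.E_carr[OF Rf.gr_repsD[OF a(1)]] .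
  have t: "a i \<odot>\<^bsub>M\<^esub> x j \<in> N" for i j using submodule_smult[OF N ac high_reps_N[OF x(1)]] .
  have xr: "x \<in> Mf.gr_reps N_filt" and low: "\<And>i. i < s \<Longrightarrow> x i = \<zero>\<^bsub>M\<^esub>" using x(1) by (auto simp: high_reps_def)
  have "restrict_shift (\<alpha> \<odot>\<^bsub>gr_module\<^esub> \<xi>)
      = restrict_shift (Mf.gr_class (\<lambda>n. \<Oplus>\<^bsub>M\<^esub>i\<in>{..n}. a i \<odot>\<^bsub>M\<^esub> x (n - i)))"
    unfolding a(2) x(2) using smult_gr_module[OF a(1) compatible_reps[OF N_filt_compatible xr]] by simp
  also have "\<dots> = L.Mf.gr_class (\<lambda>n. \<Oplus>\<^bsub>M\<^esub>i\<in>{..n + s}. a i \<odot>\<^bsub>M\<^esub> x (n + s - i))"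
    using t by (intro restrict_shift_class finsum_submodule[OF N]) auto
  also have "(\<lambda>n. \<Oplus>\<^bsub>M\<^esub>i\<in>{..n + s}. a i \<odot>\<^bsub>M\<^esub> x (n + s - i))
      = (\<lambda>n. \<Oplus>\<^bsub>M\<lparr>carrier := N\<rparr>\<^esub>i\<in>{..n}. a i \<odot>\<^bsub>M\<^esub> x (n - i + s))"
  proof
    fix n
    \<comment> \<open>The s additional summands, those with i > n, meet \<open>x\<close> in degrees
      below s, where it vanishes.\<close>
    have "(\<Oplus>\<^bsub>M\<^esub>i\<in>{..n + s}. a i \<odot>\<^bsub>M\<^esub> x (n + s - i)) = (\<Oplus>\<^bsub>M\<^esub>i\<in>{..n}. a i \<odot>\<^bsub>M\<^esub> x (n - i + s))"
    proof (rule M.add.finprod_mono_neutral_cong_right)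
      show "a i \<odot>\<^bsub>M\<^esub> x (n + s - i) = \<zero>\<^bsub>M\<^esub>" if "i \<in> {..n + s} - {..n}" for i
      proof -
        have "n + s - i < s" using that by auto
        then show ?thesis using low ac by simp
      qed
      show "a i \<odot>\<^bsub>M\<^esub> x (n + s - i) = a i \<odot>\<^bsub>M\<^esub> x (n - i + s)" if "i \<in> {..n}" for i
      proof -
        have "n + s - i = n - i + s" using that by auto
        then show ?thesis by (simp only:)
      qed
      show "(\<lambda>i. a i \<odot>\<^bsub>M\<^esub> x (n + s - i)) \<in> {..n + s} \<rightarrow> carrier M" using N_carr[OF t] by simp
    qed simp_all
    also have "\<dots> = (\<Oplus>\<^bsub>M\<lparr>carrier := N\<rparr>\<^esub>i\<in>{..n}. a i \<odot>\<^bsub>M\<^esub> x (n - i + s))"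
      using t by (intro finsum_restrict[symmetric]) auto
    finally show "(\<Oplus>\<^bsub>M\<^esub>i\<in>{..n + s}. a i \<odot>\<^bsub>M\<^esub> x (n + s - i))
      = (\<Oplus>\<^bsub>M\<lparr>carrier := N\<rparr>\<^esub>i\<in>{..n}. a i \<odot>\<^bsub>M\<^esub> x (n - i + s))" .
  qed
  also have "L.Mf.gr_class \<dots> = \<alpha> \<odot>\<^bsub>L.gr_module\<^esub> L.Mf.gr_class (\<lambda>i. x (i + s))"
    unfolding a(2) using L.smult_gr_module[OF a(1) high_reps_shift[OF x(1)]] by simp
  finally show ?thesis using restrict_shift_class high_reps_N x by simp
qed

text \<open>Degree j - s of the associated graded module of \<open>N\<close> is degree j of its
  twist by -s.\<close>

lemma restrict_shift_part:
  "restrict_shift ` graded_part N_star_module j = graded_part L.gr_module (j - int s)"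
proof (intro equalityI subsetI)
  fix \<eta> assume "\<eta> \<in> restrict_shift ` graded_part N_star_module j"
  then obtain \<xi> where \<xi>: "\<xi> \<in> N_star" "\<And>i. int i \<noteq> j \<Longrightarrow> \<xi> i = filt (Suc i)" "\<eta> = restrict_shift \<xi>"
    by (auto simp: part_N_star_module)
  have "\<eta> i = L.filt (Suc i)" if "int i \<noteq> j - int s" for i
    using \<xi>(2)[of "i + s"] \<xi>(3) that by (auto simp: restrict_shift_def strict_filt)
  then show "\<eta> \<in> graded_part L.gr_module (j - int s)"
    using \<xi> restrict_shift_image by (auto simp: L.graded_part_gr_module)
next
  fix \<eta> assume \<eta>: "\<eta> \<in> graded_part L.gr_module (j - int s)"
  then have "\<eta> \<in> restrict_shift ` N_star" unfolding restrict_shift_image by (simp add: L.graded_part_gr_module)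
  then obtain x where x: "x \<in> high_reps" "\<eta> = restrict_shift (Mf.gr_class x)" by (auto simp: N_star_high_reps)
  have "Mf.gr_class x i = filt (Suc i)" if ij: "int i \<noteq> j" for i
  proof -
    have "x i \<in> filt (Suc i)"
    proof (cases "i < s")
      case True then show ?thesis using x(1) Mf.E_zero by (simp add: high_reps_def)
    next
      case False
      then have "\<eta> (i - s) = L.filt (Suc (i - s))" using \<eta> ij by (auto simp: L.graded_part_gr_module)
      then have eq: "Mf.gr_class x i \<inter> N = N \<inter> filt (Suc i)"
        using False by (simp add: x(2) restrict_shift_def strict_filt)
      have xN: "x i \<in> N" by (rule high_reps_N[OF x(1)])
      \<comment> \<open>The representative lies in its own coset and in \<open>N\<close>; as the
        coset meets \<open>N\<close> exactly in N \<inter> \<mm>^(i+1) M, it is trivial.\<close>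
      have "x i \<in> Mf.gr_class x i"
        using Mf.E_zero[of "Suc i"] N_carr[OF xN]
        by (auto simp: Mf.gr_class_def a_r_coset_def' intro!: bexI[of _ "\<zero>\<^bsub>M\<^esub>"])
      then show ?thesis using eq xN by auto
    qed
    then show ?thesis
      using Mf.coset_eq_self_iff[of "x i" "Suc i"] Mf.E_carr by (simp add: Mf.gr_class_def)
  qed
  then show "\<eta> \<in> restrict_shift ` graded_part N_star_module j"
    using x by (auto simp: part_N_star_module N_star_high_reps)
qed

lemma strict_imp_isomorphic:
  "graded_isomorphic gr_ring N_star_module (twist (- int s) L.gr_module)"
proof -
  have "restrict_shift \<in> iso (add_monoid N_star_module) (add_monoid (twist (- int s) L.gr_module))"
  proof (rule isoI)
    show "restrict_shift \<in> hom (add_monoid N_star_module) (add_monoid (twist (- int s) L.gr_module))"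
    proof (rule homI)
      fix \<xi> assume \<xi>: "\<xi> \<in> carrier (add_monoid N_star_module)"
      then have \<xi>: "\<xi> \<in> N_star" by (simp add: carrier_N_star_module)
      then show "restrict_shift \<xi> \<in> carrier (add_monoid (twist (- int s) L.gr_module))"
        using restrict_shift_image by (auto simp: twist_def)
      fix \<eta> assume "\<eta> \<in> carrier (add_monoid N_star_module)"
      then have \<eta>: "\<eta> \<in> N_star" by (simp add: carrier_N_star_module)
      have "\<xi> \<oplus>\<^bsub>N_star_module\<^esub> \<eta> = \<xi> \<oplus>\<^bsub>gr_module\<^esub> \<eta>"
        by (simp add: initial_module_def graded_submodule_def)
      then show "restrict_shift (\<xi> \<otimes>\<^bsub>add_monoid N_star_module\<^esub> \<eta>) =
        restrict_shift \<xi> \<otimes>\<^bsub>add_monoid (twist (- int s) L.gr_module)\<^esub> restrict_shift \<eta>"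
        using restrict_shift_add[OF \<xi> \<eta>] by (simp add: twist_def)
    qed
    show "bij_betw restrict_shift (carrier (add_monoid N_star_module))
        (carrier (add_monoid (twist (- int s) L.gr_module)))"
      using restrict_shift_inj restrict_shift_image
      by (simp add: bij_betw_def carrier_N_star_module twist_def)
  qed
  moreover have "restrict_shift (\<alpha> \<odot>\<^bsub>N_star_module\<^esub> \<xi>) = \<alpha> \<odot>\<^bsub>twist (- int s) L.gr_module\<^esub> restrict_shift \<xi>"
    if "\<alpha> \<in> carrier gr_ring" "\<xi> \<in> carrier N_star_module" for \<alpha> \<xi>
  proof -
    have "\<alpha> \<odot>\<^bsub>N_star_module\<^esub> \<xi> = \<alpha> \<odot>\<^bsub>gr_module\<^esub> \<xi>"
      by (simp add: initial_module_def graded_submodule_def)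
    then show ?thesis using restrict_shift_smult that by (simp add: carrier_N_star_module twist_def)
  qed
  moreover have "restrict_shift ` graded_part N_star_module j = graded_part (twist (- int s) L.gr_module) j" for j
    using restrict_shift_part[of j] by (simp add: twist_def)
  ultimately show ?thesis unfolding graded_isomorphic_def by blast
qed

end

text \<open>The isomorphism is arbitrary, so only its properties can be used. The associated graded
  module of \<open>N\<close> is generated in degree 0; the image of the submodule generated by
  degree s of N* contains that degree, hence is everything, and injectivity returns the conclusion
  to N*.\<close>

lemma isomorphic_imp_equigen_s:
  assumes "graded_isomorphic gr_ring N_star_module (twist (- int s) L.gr_module)"
  shows equigen_s
proof -
  let ?T = "twist (- int s) L.gr_module"
  obtain \<phi> where iso: "\<phi> \<in> iso (add_monoid N_star_module) (add_monoid ?T)"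
    and smult: "\<And>\<alpha> \<xi>. \<lbrakk>\<alpha> \<in> carrier gr_ring; \<xi> \<in> carrier N_star_module\<rbrakk> \<Longrightarrow>
      \<phi> (\<alpha> \<odot>\<^bsub>N_star_module\<^esub> \<xi>) = \<alpha> \<odot>\<^bsub>?T\<^esub> \<phi> \<xi>"
    and part: "\<And>j. \<phi> ` graded_part N_star_module j = graded_part ?T j"
    using assms by (auto simp: graded_isomorphic_def)
  have bij: "bij_betw \<phi> N_star (carrier L.gr_module)"
    using iso by (simp add: iso_def carrier_N_star_module twist_def)
  have add: "\<phi> (\<xi> \<oplus>\<^bsub>gr_module\<^esub> \<eta>) = \<phi> \<xi> \<oplus>\<^bsub>L.gr_module\<^esub> \<phi> \<eta>" if "\<xi> \<in> N_star" "\<eta> \<in> N_star" for \<xi> \<eta>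
  proof -
    have "\<phi> (\<xi> \<otimes>\<^bsub>add_monoid N_star_module\<^esub> \<eta>) = \<phi> \<xi> \<otimes>\<^bsub>add_monoid ?T\<^esub> \<phi> \<eta>"
      using iso that by (intro hom_mult[of _ "add_monoid N_star_module"]) (auto simp: iso_def carrier_N_star_module)
    then show ?thesis by (simp add: initial_module_def graded_submodule_def twist_def)
  qed
  have sm: "\<phi> (\<alpha> \<odot>\<^bsub>gr_module\<^esub> \<xi>) = \<alpha> \<odot>\<^bsub>L.gr_module\<^esub> \<phi> \<xi>" if "\<alpha> \<in> carrier gr_ring" "\<xi> \<in> N_star" for \<alpha> \<xi>
    using smult[of \<alpha> \<xi>] that
    by (simp add: carrier_N_star_module twist_def) (simp add: initial_module_def graded_submodule_def)
  let ?Y = "hom_class s ` N"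
  have YN: "?Y \<subseteq> N_star" using hom_class_N_star N_subset by blast
  let ?H = "module_span gr_ring gr_module ?Y"
  have H: "submodule ?H gr_ring gr_module" by (rule gr_span_submodule[OF YN])
  have HN: "?H \<subseteq> N_star" by (rule module_span_minimal[OF YN N_star_submodule])
  interpret G: group "add_monoid gr_module" by (rule group_gr_module)
  interpret GL: group "add_monoid L.gr_module" by (rule L.group_gr_module)
  have sub: "subgroup ?H (add_monoid gr_module)" using H by (simp add: submodule_iff)
  have subN: "subgroup N_star (add_monoid gr_module)" using N_star_submodule by (simp add: submodule_iff)
  have "group_hom ((add_monoid gr_module)\<lparr>carrier := N_star\<rparr>) (add_monoid L.gr_module) \<phi>"
    using bij add
    by (intro group_hom.intro group_hom_axioms.intro homI G.subgroup_imp_group[OF subN] GL.is_group)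
      (auto dest: bij_betwE)
  moreover have "subgroup ?H ((add_monoid gr_module)\<lparr>carrier := N_star\<rparr>)"
    using HN by (rule G.subgroup_incl[OF sub subN])
  ultimately have "subgroup (\<phi> ` ?H) (add_monoid L.gr_module)" by (rule group_hom.subgroup_img_is_subgroup)
  moreover have "\<alpha> \<odot>\<^bsub>L.gr_module\<^esub> \<eta> \<in> \<phi> ` ?H" if "\<alpha> \<in> carrier gr_ring" "\<eta> \<in> \<phi> ` ?H" for \<alpha> \<eta>
  proof -
    obtain \<xi> where \<xi>: "\<xi> \<in> ?H" "\<eta> = \<phi> \<xi>" using \<open>\<eta> \<in> \<phi> ` ?H\<close> by auto
    then have "\<alpha> \<odot>\<^bsub>L.gr_module\<^esub> \<eta> = \<phi> (\<alpha> \<odot>\<^bsub>gr_module\<^esub> \<xi>)" using sm that(1) HN by auto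
    then show ?thesis using submodule_smult[OF H that(1) \<xi>(1)] by blast
  qed
  ultimately have K: "submodule (\<phi> ` ?H) gr_ring L.gr_module" by (simp add: submodule_iff)
  \<comment> \<open>Degree s of the twist by -s is degree 0.\<close>
  have "\<phi> ` graded_part N_star_module (int s) = graded_part L.gr_module (int 0)"
    unfolding part by (simp add: twist_def)
  moreover have "graded_part N_star_module (int s) = ?Y" by (simp add: part_N_star_nat N_filt_low)
  moreover have "graded_part L.gr_module (int 0) = L.hom_class 0 ` L.filt 0"
    using L.gr_image_part[OF L.compatible_filt, of 0] L.gr_image_filt by (simp add: L.graded_part_gr_module)
  ultimately have "L.hom_class 0 ` N = \<phi> ` ?Y" using L.filt_0 by simp
  then have K0: "L.hom_class 0 x \<in> \<phi> ` ?H" if "x \<in> N" for x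
  proof -
    have "L.hom_class 0 x \<in> L.hom_class 0 ` N" using that by (rule imageI)
    also have "\<dots> \<subseteq> \<phi> ` ?H" unfolding \<open>L.hom_class 0 ` N = \<phi> ` ?Y\<close> by (intro image_mono module_span_inc)
    finally show ?thesis .
  qed
  have "L.gr_image L.filt \<subseteq> \<phi> ` ?H"
  proof (rule L.gr_image_subset[OF K L.compatible_filt])
    fix i x assume "x \<in> L.filt i"
    then have x: "x \<in> L.set_smult (max_pow i) N" by (simp add: L.filt_eq)
    have "submodule N R (M\<lparr>carrier := N\<rparr>)" using L.carrier_is_submodule by simp
    from L.hom_class_set_smult[OF K this _ K0 x] show "L.hom_class i x \<in> \<phi> ` ?H"
      using L.filt_0 by simp
  qed
  then have surj: "carrier L.gr_module \<subseteq> \<phi> ` ?H" by (simp add: L.gr_image_filt)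
  have "N_star \<subseteq> ?H"
  proof
    fix \<xi> assume \<xi>: "\<xi> \<in> N_star"
    then have "\<phi> \<xi> \<in> \<phi> ` ?H"
      using bij_betwE[OF bij] surj by blast
    then obtain \<zeta> where \<zeta>: "\<zeta> \<in> ?H" "\<phi> \<xi> = \<phi> \<zeta>" by auto
    then have "\<xi> = \<zeta>" using \<xi> HN bij_betw_imp_inj_on[OF bij] by (blast dest: inj_onD)
    then show "\<xi> \<in> ?H" using \<zeta> by simp
  qed
  then show ?thesis using HN by (auto simp: equigen_s_iff)
qed

lemma all_equivalentI: "(\<And>P. P \<in> set Ps \<Longrightarrow> P = Q) \<Longrightarrow> all_equivalent Ps"
  unfolding all_equivalent_def by metis

text \<open>Statement (i) enters twice, with free degree and with degree s; the latter is the pivot.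
  It implies (iii), from which (ii), (iv) and (v) are derived; (vi) follows from (v) because a
  minimal generating set of the right size exists, and (ii), (iv) and (vi) lead back to the
  pivot.\<close>

lemma all_conditions:
  "all_equivalent
    [equigenerated gr_ring N_star_module,
     equigenerated_in gr_ring N_star_module (int s),
     graded_isomorphic gr_ring N_star_module (twist (- int s) L.gr_module),
     \<forall>i\<ge>s. N \<inter> filt i = L.filt (i - s),
     N \<inter> filt (s + 1) = ideal_smult R \<mm> (M\<lparr>carrier := N\<rparr>) \<and>
       min_number_homogeneous_generators gr_ring N_star_module = rank,
     \<forall>Y. minimal_generating_set R (M\<lparr>carrier := N\<rparr>) Y \<and> card Y = rank \<longrightarrow>
       standard_basis R \<mm> M N Y \<and> (\<forall>y\<in>Y. ord y = s),
     \<exists>Y. minimal_generating_set R (M\<lparr>carrier := N\<rparr>) Y \<and> card Y = rank \<and>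
       standard_basis R \<mm> M N Y \<and> (\<forall>y\<in>Y. ord y = s)]"
  (is "all_equivalent [?i, ?is, ?ii, ?iii, ?iv, ?v, ?vi]")
proof -
  have iii: "?iii \<longleftrightarrow> strict_filtration"
    by (simp add: strict_filtration_def N_filt_def filt_N)
  have mN: "ideal_smult R \<mm> (M\<lparr>carrier := N\<rparr>) = set_smult \<mm> N"
    by (rule ideal_smult_restrict[OF max_subset N])
  have 1: "?i \<Longrightarrow> ?is" by (rule equigenerated_imp_s)
  have 2: "?is \<Longrightarrow> ?i" by (auto simp: equigenerated_def)
  have 3: "?is \<Longrightarrow> ?iii" using equigen_s_imp_strict iii by simp
  have 4: "?iii \<Longrightarrow> ?ii" using strict_imp_isomorphic iii by simp
  have 5: "?ii \<Longrightarrow> ?is" by (rule isomorphic_imp_equigen_s)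
  have 6: "?iii \<Longrightarrow> ?iv"
  proof -
    assume ?iii
    then have strict: strict_filtration using iii by simp
    then have "N_filt (s + 1) = set_smult (max_pow (s + 1 - s)) N"
      unfolding strict_filtration_def by simp
    then have "N \<inter> filt (s + 1) = set_smult \<mm> N" by (simp add: N_filt_def max_pow_1)
    then show ?iv unfolding mN using strict_imp_homogeneous_rank[OF strict] by blast
  qed
  have 7: "?iv \<Longrightarrow> ?is"
    using homogeneous_rank_imp_equigen_s mN by (simp add: N_filt_def)
  have 8: "?iii \<Longrightarrow> ?v" using strict_imp_standard_basis iii by blast
  have 9: "?v \<Longrightarrow> ?vi" using minimal_generating_exists by blast
  have 10: "?vi \<Longrightarrow> ?is" by (elim exE conjE) (rule standard_basis_imp_equigen_s)
  have eqs: "?i \<longleftrightarrow> ?is" "?ii \<longleftrightarrow> ?is" "?iii \<longleftrightarrow> ?is" "?iv \<longleftrightarrow> ?is" "?v \<longleftrightarrow> ?is" "?vi \<longleftrightarrow> ?is"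
    by (rule iffI[OF 1 2] iffI[OF 5 4[OF 3]] iffI[OF 10[OF 9[OF 8]] 3]
        iffI[OF 7 6[OF 3]] iffI[OF 10[OF 9] 8[OF 3]] iffI[OF 10 9[OF 8[OF 3]]]; assumption)+
  show ?thesis
  proof (rule all_equivalentI)
    fix P assume "P \<in> set [?i, ?is, ?ii, ?iii, ?iv, ?v, ?vi]"
    then have "P = ?i \<or> P = ?is \<or> P = ?ii \<or> P = ?iii \<or> P = ?iv \<or> P = ?v \<or> P = ?vi"
      by (simp only: list.set insert_iff empty_iff HOL.simp_thms)
    then show "P = ?is"
      by (elim disjE; hypsubst) (rule eqs refl)+
  qed
qed

end

lemma free_of_finite_rank_fin_gen:
  assumes "free_of_finite_rank R F" shows "fin_gen R F (carrier F)"
proof -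
  obtain B where B: "B \<subseteq> carrier F" "finite B"
    and ex1: "\<forall>x\<in>carrier F. \<exists>!c. c \<in> B \<rightarrow>\<^sub>E carrier R \<and> x = (\<Oplus>\<^bsub>F\<^esub>b\<in>B. c b \<odot>\<^bsub>F\<^esub> b)"
    using assms unfolding free_of_finite_rank_def by (elim conjE exE)
  have ex: "\<exists>c. c \<in> B \<rightarrow>\<^sub>E carrier R \<and> x = (\<Oplus>\<^bsub>F\<^esub>b\<in>B. c b \<odot>\<^bsub>F\<^esub> b)" if "x \<in> carrier F" for x
    using bspec[OF ex1 that] by (rule ex1_implies_ex)
  have "module R F" using assms by (simp add: free_of_finite_rank_def)
  interpret module R F by fact
  have S: "submodule (module_span R F B) R F" by (rule span_submodule[OF B(1)])
  have "x \<in> module_span R F B" if x: "x \<in> carrier F" for x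
  proof -
    obtain c where c: "c \<in> B \<rightarrow>\<^sub>E carrier R" "x = (\<Oplus>\<^bsub>F\<^esub>b\<in>B. c b \<odot>\<^bsub>F\<^esub> b)" using ex[OF x] by blast
    show ?thesis unfolding c(2)
      using c(1) module_span_inc[of B R F] by (intro finsum_submodule[OF S B(2)] submodule_smult[OF S]) auto
  qed
  then have "module_span R F B = carrier F" using submodule_subset[OF S] by auto
  then show ?thesis using B by (auto simp: fin_gen_def)
qed

theorem theorem3p7:
  fixes R :: "('a, 'm) ring_scheme" and \<mm> :: "'a set"
    and F :: "('a, 'b, 'n) module_scheme" and N :: "'b set"
    and s k :: nat
  assumes "noetherian_local_ring R \<mm>"
    and "free_of_finite_rank R F"
    and "submodule N R F"
    and "N \<subseteq> ideal_smult R \<mm> F"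
    and "N \<noteq> {\<zero>\<^bsub>F\<^esub>}"
    and "s = submodule_order R \<mm> F N"
    and "k = min_number_generators R (restrict_module F N)"
  shows "all_equivalent
    [equigenerated (assoc_graded_ring R \<mm>) (initial_module R \<mm> F N),
     equigenerated_in (assoc_graded_ring R \<mm>) (initial_module R \<mm> F N) (int s),
     graded_isomorphic (assoc_graded_ring R \<mm>) (initial_module R \<mm> F N)
       (twist (- int s) (assoc_graded_module R \<mm> (restrict_module F N))),
     \<forall>i\<ge>s. N \<inter> adic_filtration R \<mm> F i = adic_filtration R \<mm> (restrict_module F N) (i - s),
     N \<inter> adic_filtration R \<mm> F (s + 1) = ideal_smult R \<mm> (restrict_module F N) \<and>
       min_number_homogeneous_generators (assoc_graded_ring R \<mm>) (initial_module R \<mm> F N) = k,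
     \<forall>Y. minimal_generating_set R (restrict_module F N) Y \<and> card Y = k \<longrightarrow>
       standard_basis R \<mm> F N Y \<and> (\<forall>y\<in>Y. elem_order R \<mm> F y = s),
     \<exists>Y. minimal_generating_set R (restrict_module F N) Y \<and> card Y = k \<and>
       standard_basis R \<mm> F N Y \<and> (\<forall>y\<in>Y. elem_order R \<mm> F y = s)]"
proof -
  have "module R F" using assms(2) by (simp add: free_of_finite_rank_def)
  then interpret initial_setting R \<mm> F N s
    using assms free_of_finite_rank_fin_gen[OF assms(2)]
    by (intro initial_setting.intro fg_local_module.intro local_module.intro
        fg_local_module_axioms.intro initial_setting_axioms.intro)
  show ?thesis using all_conditions by (simp only: assms(7) rank_def)
qed

end
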